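(* Let $n\ge 1$ and $0\le k\le n-1$. The operator $E_n^k$ defined on $\Lambda^k(\partial S_n)$ by $$E_n^k u=\frac1n\sum_{m=1}^{n}\ \sum_{I\in\Gamma_m}(-1)^{m+1}\sum_{s=0}^{k}\ \sum_{J\in\Gamma_s(I)}\frac{\phi_J}{\lambda_I^{s+1}}\wedge A_{I,J}^k u$$ is an extension operator, i.e. $\operatorname{tr}_{\partial S_n}E_n^k u=u$ for all $u\in\Lambda^k(\partial S_n)$.
   Context: Simplex and forms. $n\ge1$ is fixed and $S_n=[x_0,\dots,x_n]\subset\mathbb R^n$ is a fixed (nondegenerate) $n$-simplex with barycentric coordinates $\lambda_0,\dots,\lambda_n$ (so $\lambda_i$ is affine, $\lambda_i(x_j)=\delta_{ij}$) and boundary $\partial S_n=\{x\in S_n:\lambda_i(x)=0\text{ for some }i\}$. $\Lambda^k(S_n)$ is the space of smooth $k$-forms on $S_n$. $\Lambda^k(\partial S_n)$ is the space of piecewise smooth $k$-forms on $\partial S_n$: smooth on each $(n-1)$-dimensional face, with single-valued traces at the interfaces; equivalently $\Lambda^k(\partial S_n)=\operatorname{tr}_{\partial S_n}\Lambda^k(S_n)$, where $\operatorname{tr}_{\partial S_n}$ is the (facewise) pullback under the inclusion $\partial S_n\to S_n$. Index sets. An index set $J=\{j_0,\dots,j_s\}$ is an ordered list of distinct elements of $\{0,\dots,n\}$ (not necessarily increasing); $|J|$ is its number of elements, $J^c$ its complement in $\{0,\dots,n\}$, $J(\hat i)$ is $J$ with the entry $j_i$ removed, $\{p,J\}$ is $J$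 with $p$ placed in front, and $[x_J]$ is the simplex spanned by $\{x_j\}_{j\in J}$ with orientation induced by the order of $J$. $\Gamma$ is the set of (nonempty) increasingly ordered index sets, $\Gamma_m=\{J\in\Gamma:|J|=m+1\}$, $\Gamma_m(I)=\{J\in\Gamma_m: J\subset I\}$. $\lambda_J=\sum_{j\in J}\lambda_j$, and the Whitney form of $J=\{j_0,\dots,j_s\}$ is $\phi_J=\sum_{i=0}^s(-1)^i\lambda_{j_i}\,d\lambda_{j_0}\wedge\cdots\wedge\widehat{d\lambda_{j_i}}\wedge\cdots\wedge d\lambda_{j_s}$ (hat: omitted), so $\phi_{\{j\}}=\lambda_j$. Operators $R$. For $I\in\Gamma$ put $F_I(x,y)=x+\sum_{i\in I}\lambda_i(x)(y-x_i)$ and $P_{I,j}x=F_I(x,x_j)$. One has $D_yF_I=\lambda_I(x)\,\mathrm{Id}$. For an index set $J$ with $|J|=s+1$, $s\le k$, $R_{I,J}^ku$ is the $(k-s)$-form on $S_n$ $$(R_{I,J}^ku)_x(v_1,\dots,v_{k-s})=\lambda_I(x)^s\int_{[x_J]}u_{F_I(x,y)}(D_xF_I v_1,\dots,D_xF_I v_{k-s},t_1,\dots,t_s)\,dy,$$ where $t_1,\dots,t_s$ is an (oriented) orthonormal basis of the tangent space of $[x_J]$; for $s=0$, $J=\{j\}$, $R_{I,J}^k=P_{I,j}^*$ (pullback). $R_{I,J}^k=0$ for $s>k$. If $I\cap J^c\neq\emptyset$, then for any $i\in I\cap J^c$ the map $F_I$ sends $S_n\times[x_J]$ into $\{\lambda_i=0\}\subset\partial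 S_n$, and $R_{I,J}^ku$ is defined by the same formula for $u\in\Lambda^k(\partial S_n)$ (equivalently, by applying it to any smooth form with trace $u$). Operators $A$. For $I\in\Gamma_m$, $1\le m\le n$, and $J\in\Gamma_s(I)$, $0\le s\le k\le n-1$: $A_{I,J}^k:\Lambda^k(\partial S_n)\to\Lambda^{k-s}(S_n)$ is given by $A_{I,\{j\}}^ku=P_{I,j}^*u$ for $s=0$, and for $s\ge1$ $$A_{I,J}^k=c_{s,n}^k\sum_{p\in J^c}\sum_{i=0}^s(-1)^iR^k_{I,\{p,J(\hat i)\}},\qquad c_{s,n}^k=\frac{(-1)^{1+ks}(s!)^2}{(n-1)\cdots(n-s)}.$$ The rational expression defining $E_n^ku$ is read at points where the denominators $\lambda_I$ do not vanish (this includes the interior of $S_n$ and the relative interiors of the $(n-1)$-dimensional faces) and extended by continuity elsewhere. *)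

theory Defs
  imports "HOL-Analysis.Analysis"
begin

text \<open>A \<open>k\<close>-form takes a point and a list of \<open>k\<close> vectors. Values on lists of any other
  length carry no meaning.\<close>

type_synonym 'a form = "'a \<Rightarrow> 'a list \<Rightarrow> real"

definition alternating_map :: "nat \<Rightarrow> ('a::real_vector list \<Rightarrow> real) \<Rightarrow> bool" where
  "alternating_map k f \<longleftrightarrow>
     (\<forall>vs i. length vs = k \<longrightarrow> i < k \<longrightarrow> linear (\<lambda>v. f (vs[i := v]))) \<and>
     (\<forall>vs. length vs = k \<longrightarrow> \<not> distinct vs \<longrightarrow> f vs = 0)"

fun Ck_on :: "nat \<Rightarrow> 'a::real_normed_vector set \<Rightarrow> ('a \<Rightarrow> real) \<Rightarrow> bool" where
  "Ck_on 0 U f \<longleftrightarrow> continuous_on U f"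
| "Ck_on (Suc m) U f \<longleftrightarrow> (\<forall>x\<in>U. f differentiable (at x)) \<and>
     (\<forall>v. Ck_on m U (\<lambda>x. frechet_derivative f (at x) v))"

text \<open>To be used for open sets \<open>U\<close> only.\<close>

definition smooth_forms :: "nat \<Rightarrow> 'a::real_normed_vector set \<Rightarrow> 'a form set" where
  "smooth_forms k U = {w. (\<forall>x\<in>U. alternating_map k (w x)) \<and>
     (\<forall>vs. length vs = k \<longrightarrow> (\<forall>m. Ck_on m U (\<lambda>x. w x vs)))}"

text \<open>The wedge product of a \<open>p\<close>-form and a \<open>q\<close>-form, in the normalization in which
  \<open>d\<lambda>\<^sub>1 \<and> \<dots> \<and> d\<lambda>\<^sub>s\<close> is the determinant (equivalently, the signed sum over \<open>(p,q)\<close>-shuffles).\<close>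

definition wedge :: "nat \<Rightarrow> nat \<Rightarrow> 'a form \<Rightarrow> 'a form \<Rightarrow> 'a form" where
  "wedge p q \<alpha> \<beta> x vs =
     (\<Sum>\<pi> | \<pi> permutes {..<p + q}. of_int (sign \<pi>) *
        \<alpha> x (map (\<lambda>a. vs ! \<pi> a) [0..<p]) * \<beta> x (map (\<lambda>a. vs ! \<pi> a) [p..<p + q]))
     / (fact p * fact q)"

definition pullback :: "('a::real_normed_vector \<Rightarrow> 'a) \<Rightarrow> 'a form \<Rightarrow> 'a form" where
  "pullback f u x vs = u (f x) (map (frechet_derivative f (at x)) vs)"

text \<open>\<open>X 0, \<dots>, X n\<close> are the vertices, where \<open>n = DIM('a)\<close>; other values of \<open>X\<close> are not used.\<close>

definition nondegenerate_simplex :: "(nat \<Rightarrow> 'a::euclidean_space) \<Rightarrow> bool" where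
  "nondegenerate_simplex X \<longleftrightarrow>
     inj_on X {..DIM('a)} \<and> \<not> affine_dependent (X ` {..DIM('a)})"

definition simplex_S :: "(nat \<Rightarrow> 'a::euclidean_space) \<Rightarrow> 'a set" where
  "simplex_S X = convex hull (X ` {..DIM('a)})"

definition bary :: "(nat \<Rightarrow> 'a::euclidean_space) \<Rightarrow> nat \<Rightarrow> 'a \<Rightarrow> real" where
  "bary X i = (THE f. (\<exists>g c. linear g \<and> f = (\<lambda>x. g x + c)) \<and>
     (\<forall>j\<le>DIM('a). f (X j) = (if i = j then 1 else 0)))"

definition bary_sum :: "(nat \<Rightarrow> 'a::euclidean_space) \<Rightarrow> nat list \<Rightarrow> 'a \<Rightarrow> real" where
  "bary_sum X J x = (\<Sum>j\<in>set J. bary X j x)"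

definition dbary :: "(nat \<Rightarrow> 'a::euclidean_space) \<Rightarrow> nat \<Rightarrow> 'a form" where
  "dbary X i x vs = frechet_derivative (bary X i) (at x) (hd vs)"

definition tangent_space :: "(nat \<Rightarrow> 'a::real_vector) \<Rightarrow> nat set \<Rightarrow> 'a set" where
  "tangent_space X A = span {X a - X b | a b. a \<in> A \<and> b \<in> A}"

definition facet :: "(nat \<Rightarrow> 'a::euclidean_space) \<Rightarrow> nat \<Rightarrow> 'a set" where
  "facet X i = {x \<in> simplex_S X. bary X i x = 0}"

definition facet_tangent :: "(nat \<Rightarrow> 'a::euclidean_space) \<Rightarrow> nat \<Rightarrow> 'a set" where
  "facet_tangent X i = tangent_space X ({..DIM('a)} - {i})"

text \<open>A form on the boundary is one function, meaningful at those \<open>(x, vs)\<close> for which some facet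
  contains \<open>x\<close> and has all of \<open>vs\<close> as tangent vectors, and zero elsewhere. As \<open>u x vs\<close> does not
  depend on the choice of that facet, traces at the interfaces are single-valued by construction:
  for vectors tangent to the intersection of two facets there is only one value.\<close>

definition on_boundary :: "(nat \<Rightarrow> 'a::euclidean_space) \<Rightarrow> nat \<Rightarrow> 'a \<Rightarrow> 'a list \<Rightarrow> bool" where
  "on_boundary X k x vs \<longleftrightarrow>
     length vs = k \<and> (\<exists>i\<le>DIM('a). x \<in> facet X i \<and> set vs \<subseteq> facet_tangent X i)"

text \<open>Smoothness on a (closed) facet means being the pullback, under inclusion, of a smooth form
  on a neighbourhood of that facet. The neighbourhood form may differ from facet to facet.\<close>

definition boundary_forms :: "(nat \<Rightarrow> 'a::euclidean_space) \<Rightarrow> nat \<Rightarrow> 'a form set" where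
  "boundary_forms X k = {u.
     (\<forall>x vs. \<not> on_boundary X k x vs \<longrightarrow> u x vs = 0) \<and>
     (\<forall>i\<le>DIM('a). \<exists>U w. open U \<and> facet X i \<subseteq> U \<and> w \<in> smooth_forms k U \<and>
        (\<forall>x\<in>facet X i. \<forall>vs. length vs = k \<longrightarrow> set vs \<subseteq> facet_tangent X i \<longrightarrow> u x vs = w x vs))}"

definition boundary_trace :: "(nat \<Rightarrow> 'a::euclidean_space) \<Rightarrow> nat \<Rightarrow> 'a form \<Rightarrow> 'a form" where
  "boundary_trace X k w = (\<lambda>x vs. if on_boundary X k x vs then w x vs else 0)"

definition Gam :: "nat \<Rightarrow> nat \<Rightarrow> nat list set" where
  "Gam n m = {J. sorted_wrt (<) J \<and> set J \<subseteq> {..n} \<and> length J = m + 1}"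

definition Gam_sub :: "nat \<Rightarrow> nat \<Rightarrow> nat list \<Rightarrow> nat list set" where
  "Gam_sub n m I = {J \<in> Gam n m. set J \<subseteq> set I}"

definition omit :: "nat \<Rightarrow> 'b list \<Rightarrow> 'b list" where
  "omit i J = take i J @ drop (Suc i) J"

fun dbary_wedge :: "(nat \<Rightarrow> 'a::euclidean_space) \<Rightarrow> nat list \<Rightarrow> 'a form" where
  "dbary_wedge X [] = (\<lambda>x vs. 1)"
| "dbary_wedge X (j # J) = wedge 1 (length J) (dbary X j) (dbary_wedge X J)"

definition whitney :: "(nat \<Rightarrow> 'a::euclidean_space) \<Rightarrow> nat list \<Rightarrow> 'a form" where
  "whitney X J x vs = (\<Sum>i<length J. (-1) ^ i * bary X (J ! i) x * dbary_wedge X (omit i J) x vs)"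

definition Fmap :: "(nat \<Rightarrow> 'a::euclidean_space) \<Rightarrow> nat list \<Rightarrow> 'a \<Rightarrow> 'a \<Rightarrow> 'a" where
  "Fmap X I x y = x + (\<Sum>i\<in>set I. bary X i x *\<^sub>R (y - X i))"

definition Pmap :: "(nat \<Rightarrow> 'a::euclidean_space) \<Rightarrow> nat list \<Rightarrow> nat \<Rightarrow> 'a \<Rightarrow> 'a" where
  "Pmap X I j x = Fmap X I x (X j)"

text \<open>An orthonormal basis of the tangent space of \<open>[x\<^sub>J]\<close>, \<open>|J| = s + 1\<close>, inducing the same
  orientation as the edge vectors \<open>x\<^bsub>j\<^sub>1\<^esub> - x\<^bsub>j\<^sub>0\<^esub>, \<dots>, x\<^bsub>j\<^sub>s\<^esub> - x\<^bsub>j\<^sub>0\<^esub>\<close>: the last conjunct is the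
  Leibniz formula for the determinant of these edge vectors in the basis \<open>ts\<close>.\<close>

definition oriented_onb :: "(nat \<Rightarrow> 'a::euclidean_space) \<Rightarrow> nat list \<Rightarrow> 'a list \<Rightarrow> bool" where
  "oriented_onb X J ts \<longleftrightarrow>
     length ts = length J - 1 \<and>
     (\<forall>a<length ts. \<forall>b<length ts. ts ! a \<bullet> ts ! b = (if a = b then 1 else 0)) \<and>
     span (set ts) = tangent_space X (set J) \<and>
     (\<Sum>\<pi> | \<pi> permutes {..<length ts}. of_int (sign \<pi>) *
        (\<Prod>a<length ts. ts ! a \<bullet> (X (J ! Suc (\<pi> a)) - X (J ! 0)))) > 0"

text \<open>The \<open>s\<close>-dimensional Lebesgue measure on the affine subspace through \<open>b\<close> with orthonormal
  direction vectors \<open>ts\<close>, as the image of the Lebesgue measure on \<open>\<real>\<^sup>s\<close> under an isometry.\<close>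

definition flat_measure :: "'a::euclidean_space \<Rightarrow> 'a list \<Rightarrow> 'a measure" where
  "flat_measure b ts = distr (\<Pi>\<^sub>M a\<in>{..<length ts}. (lborel :: real measure)) borel
     (\<lambda>c. b + (\<Sum>a<length ts. c a *\<^sub>R ts ! a))"

definition Rop :: "(nat \<Rightarrow> 'a::euclidean_space) \<Rightarrow> nat \<Rightarrow> nat list \<Rightarrow> nat list \<Rightarrow> 'a form \<Rightarrow> 'a form" where
  "Rop X k I J u = (\<lambda>x vs.
     let s = length J - 1; ts = (SOME ts. oriented_onb X J ts) in
     if s > k then 0
     else if s = 0 then pullback (Pmap X I (J ! 0)) u x vs
     else bary_sum X I x ^ s *
       (LINT y : convex hull (X ` set J) | flat_measure (X (J ! 0)) ts.
          u (Fmap X I x y) (map (frechet_derivative (\<lambda>z. Fmap X I z y) (at x)) vs @ ts)))"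

definition c_coeff :: "nat \<Rightarrow> nat \<Rightarrow> nat \<Rightarrow> real" where
  "c_coeff n k s = (-1) ^ (1 + k * s) * (fact s)\<^sup>2 / (\<Prod>r=1..s. real n - real r)"

definition Aop :: "(nat \<Rightarrow> 'a::euclidean_space) \<Rightarrow> nat \<Rightarrow> nat list \<Rightarrow> nat list \<Rightarrow> 'a form \<Rightarrow> 'a form" where
  "Aop X k I J u = (\<lambda>x vs.
     let s = length J - 1 in
     if s = 0 then pullback (Pmap X I (J ! 0)) u x vs
     else c_coeff DIM('a) k s *
       (\<Sum>p\<in>{..DIM('a)} - set J. \<Sum>i=0..s. (-1) ^ i * Rop X k I (p # omit i J) u x vs))"

definition ext_rational :: "(nat \<Rightarrow> 'a::euclidean_space) \<Rightarrow> nat \<Rightarrow> 'a form \<Rightarrow> 'a form" where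
  "ext_rational X k u x vs =
     1 / real DIM('a) *
     (\<Sum>m=1..DIM('a). \<Sum>I\<in>Gam DIM('a) m. (-1) ^ (m + 1) *
       (\<Sum>s=0..k. \<Sum>J\<in>Gam_sub DIM('a) s I.
          wedge s (k - s) (\<lambda>z ws. whitney X J z ws / bary_sum X I z ^ (s + 1)) (Aop X k I J u) x vs))"

definition regular_points :: "(nat \<Rightarrow> 'a::euclidean_space) \<Rightarrow> 'a set" where
  "regular_points X =
     {x \<in> simplex_S X. \<forall>m\<in>{1..DIM('a)}. \<forall>I\<in>Gam DIM('a) m. bary_sum X I x \<noteq> 0}"

text \<open>Where some denominator vanishes, the value is the limit from the regular points.
  \<open>Lim\<close> is an unspecified number if there is no limit, so an equation about the value at such a
  point is provable only if the extension by continuity exists there.\<close>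

definition ext_op :: "(nat \<Rightarrow> 'a::euclidean_space) \<Rightarrow> nat \<Rightarrow> 'a form \<Rightarrow> 'a form" where
  "ext_op X k u = (\<lambda>x vs.
     if x \<in> regular_points X then ext_rational X k u x vs
     else Lim (at x within regular_points X) (\<lambda>z. ext_rational X k u z vs))"

end

theory Submission
  imports Defs
begin

text \<open>
  On the relative interior of the facet opposite to \<open>x\<^sub>q\<close> the theorem is a cancellation. There
  \<open>\<lambda>\<^sub>q = 0\<close>, and \<open>d\<lambda>\<^sub>q = 0\<close> on tangent vectors, so adding \<open>q\<close> to an index set \<open>I\<close> changes none of
  \<open>\<lambda>\<^sub>I\<close>, \<open>F\<^sub>I\<close> and its tangential derivative, while the Whitney forms of all \<open>J\<close> that contain \<open>q\<close> have zero
  trace. The terms of \<open>I\<close> and \<open>I \<union> {q}\<close> come with opposite signs and cancel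
  (\<open>term_form_insert\<close>). Only the \<open>n\<close> sets \<open>{i, q}\<close> survive, because their partner \<open>{i}\<close> is not part of
  the sum; for them \<open>F\<^sub>I(\<cdot>, x\<^sub>i)\<close> is the identity on the facet and each contributes \<open>u\<close>
  (\<open>ext_rational_facet\<close>).

  At the remaining boundary points some \<open>\<lambda>\<^sub>I\<close> vanishes, and the work lies in showing that the rational
  expression has a limit there, also along interior points. Once it has, the limit is found along a path
  inside the facet (\<open>ext_op_facet\<close>). The terms of each \<open>I\<close> converge separately
  (\<open>term_form_limit\<close>). The operator \<open>A\<^sub>I\<^sub>J\<close> contains the factor \<open>\<lambda>\<^sub>I\<^sup>s\<close>, and what remains of it is
  continuous (\<open>Aop_regular\<close>); so the singular factors are the \<open>\<phi>\<^sub>J / \<lambda>\<^sub>I\<close>, which are bounded but have no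
  limit at a point \<open>x\<close> with \<open>\<lambda>\<^sub>I(x) = 0\<close>. As they are bounded, the other factor may be replaced by its value at
  \<open>x\<close>, where \<open>F\<^sub>I(x, y) = x\<close> and \<open>u\<close> enters only through its value at \<open>x\<close>. The values of \<open>u\<close> at \<open>x\<close> on the
  facets through \<open>x\<close> are restrictions of a single alternating map \<open>\<omega>\<close> (\<open>common_extension\<close>), and the integrals
  become values of \<open>\<omega>\<close> on edge vectors (\<open>simplex_volume\<close>). It remains to show that for constant \<open>\<omega>\<close>
  the sum of all \<open>\<phi>\<^sub>J \<and> A\<^sub>I\<^sub>J \<omega>\<close>, without the powers of \<open>\<lambda>\<^sub>I\<close>, is \<open>\<lambda>\<^sub>I\<close> times a constant form
  (\<open>stationary_sum\<close>).

  This sum is linear in the \<open>\<lambda>\<^sub>a\<close>, so it has to be shown that the coefficients of \<open>\<lambda>\<^sub>a\<close> and \<open>\<lambda>\<^sub>b\<close>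
  coincide. By the Cauchy-Binet formula (\<open>cauchy_binet\<close>) such a coefficient is a polynomial in two commuting
  vector-valued one-forms, the derivative \<open>G\<^sub>a\<close> of \<open>F\<^sub>I(\<cdot>, x\<^sub>a)\<close> and \<open>\<eta>\<^sub>a = \<Sum>\<^sub>i d\<lambda>\<^sub>i (x\<^sub>i - x\<^sub>a)\<close>. Passing from
  \<open>a\<close> to \<open>b\<close> adds \<open>\<delta> = d\<lambda>\<^sub>I (x\<^sub>b - x\<^sub>a)\<close> to \<open>G\<^sub>a\<close> and subtracts it from \<open>\<eta>\<^sub>a\<close>. As \<open>\<delta>\<close> has square zero only
  first-order terms appear, and the constants \<open>c\<^sub>s\<close> in the definition of \<open>A\<close> are precisely those for which
  these terms telescope to zero (\<open>vertex_coeff_indep\<close>).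
\<close>

section \<open>Alternating maps on lists of vectors\<close>

lemma alternating_map_linear:
  assumes "alternating_map k f" "length xs + length ys + 1 = k"
  shows "linear (\<lambda>v. f (xs @ v # ys))"
proof -
  have "linear (\<lambda>v. f ((xs @ 0 # ys)[length xs := v]))"
    using assms unfolding alternating_map_def
    by (metis Suc_eq_plus1 add_Suc_right length_Cons length_append less_add_Suc1)
  then show ?thesis by simp
qed

lemma alternating_map_not_distinct:
  "alternating_map k f \<Longrightarrow> length vs = k \<Longrightarrow> \<not> distinct vs \<Longrightarrow> f vs = 0"
  by (simp add: alternating_map_def)

lemma alternating_mapI:
  assumes "\<And>xs ys. length xs + length ys + 1 = k \<Longrightarrow> linear (\<lambda>v. f (xs @ v # ys))"
    and "\<And>vs. length vs = k \<Longrightarrow> \<not> distinct vs \<Longrightarrow> f vs = 0"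
  shows "alternating_map k f"
  unfolding alternating_map_def
proof (intro conjI allI impI)
  fix vs :: "'a list" and i assume "length vs = k" "i < k"
  then show "linear (\<lambda>v. f (vs[i := v]))"
    using assms(1)[of "take i vs" "drop (Suc i) vs"] by (simp add: upd_conv_take_nth_drop)
qed (use assms(2) in blast)

lemma alternating_map_append:
  assumes "alternating_map k f" "k = length us + m + length zs"
  shows "alternating_map m (\<lambda>vs. f (us @ vs @ zs))"
proof (rule alternating_mapI)
  fix xs ys :: "'a list" assume "length xs + length ys + 1 = m"
  then show "linear (\<lambda>v. f (us @ (xs @ v # ys) @ zs))"
    using alternating_map_linear[OF assms(1), of "us @ xs" "ys @ zs"] assms(2) by simp
next
  fix vs :: "'a list" assume "length vs = m" "\<not> distinct vs"
  then show "f (us @ vs @ zs) = 0"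
    using assms by (intro alternating_map_not_distinct[OF assms(1)]) auto
qed

lemma alternating_map_Cons:
  assumes "alternating_map (Suc m) f"
  shows "alternating_map m (\<lambda>vs. f (u # vs))"
  using alternating_map_append[OF assms, of "[u]" m "[]"] by simp

lemma alternating_map_sub_Cons:
  "alternating_map k f \<Longrightarrow> length (xs @ ys) + 1 = k \<Longrightarrow>
    f (xs @ (v - w) # ys) = f (xs @ v # ys) - f (xs @ w # ys)"
  using linear_diff[OF alternating_map_linear[of k f xs ys], of v w] by simp

lemma alternating_map_add_Cons:
  "alternating_map k f \<Longrightarrow> length (xs @ ys) + 1 = k \<Longrightarrow>
    f (xs @ (v + w) # ys) = f (xs @ v # ys) + f (xs @ w # ys)"
  using linear_add[OF alternating_map_linear[of k f xs ys], of v w] by simp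

lemma alternating_map_scale_Cons:
  "alternating_map k f \<Longrightarrow> length (xs @ ys) + 1 = k \<Longrightarrow>
    f (xs @ (c *\<^sub>R v) # ys) = c * f (xs @ v # ys)"
  using linear_scale[OF alternating_map_linear[of k f xs ys], of c v] by simp

lemma alternating_map_swap:
  assumes "alternating_map k f" "length xs + length ys + length zs + 2 = k"
  shows "f (xs @ v # ys @ w # zs) = - f (xs @ w # ys @ v # zs)"
proof -
  let ?g = "\<lambda>a b. f (xs @ a # ys @ b # zs)"
  have nd: "?g a a = 0" for a
    using assms by (intro alternating_map_not_distinct[OF assms(1)]) auto
  have l: "?g (a + b) c = ?g a c + ?g b c" for a b c
    using alternating_map_add_Cons[OF assms(1), of xs "ys @ c # zs"] assms(2) by simp
  have r: "?g c (a + b) = ?g c a + ?g c b" for a b c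
    using alternating_map_add_Cons[OF assms(1), of "xs @ c # ys" "zs"] assms(2) by simp
  have "?g (v + w) (v + w) = ?g v v + ?g v w + (?g w v + ?g w w)"
    unfolding l r by simp
  then show ?thesis using nd by simp
qed

lemma alternating_map_move:
  assumes "alternating_map k f" "length xs + length zs + 1 = k"
  shows "f (xs @ y # zs) = (-1) ^ length xs * f (y # xs @ zs)"
  using assms(2)
proof (induction xs arbitrary: zs rule: rev_induct)
  case (snoc x xs)
  have "f ((xs @ [x]) @ y # zs) = - f (xs @ y # x # zs)"
    using alternating_map_swap[OF assms(1), of xs "[]" zs x y] snoc.prems by simp
  also have "f (xs @ y # x # zs) = (-1) ^ length xs * f (y # xs @ x # zs)"
    using snoc.IH[of "x # zs"] snoc.prems by simp
  finally show ?case by simp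
qed simp

text \<open>Each of the vectors of the second block passes the whole first block.\<close>

lemma alternating_map_move_block:
  assumes "alternating_map k f" "length xs + length ys = k"
  shows "f (xs @ ys) = (-1) ^ (length xs * length ys) * f (ys @ xs)"
  using assms
proof (induction ys arbitrary: f k)
  case (Cons y ys)
  obtain m where k: "k = Suc m" using Cons.prems(2) by (cases k) auto
  have "f (xs @ y # ys) = (-1) ^ length xs * f (y # xs @ ys)"
    using alternating_map_move[OF Cons.prems(1), of xs ys y] Cons.prems(2) by simp
  also have "f (y # xs @ ys) = (-1) ^ (length xs * length ys) * f (y # ys @ xs)"
    using Cons.IH[of m "\<lambda>vs. f (y # vs)"] alternating_map_Cons Cons.prems k by auto
  finally show ?case by (simp add: power_add)
qed simp

lemma alternating_map_omit:
  assumes "alternating_map k f" "length vs = k" "i < k"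
  shows "f (vs[i := y]) = (-1) ^ i * f (y # omit i vs)"
  using alternating_map_move[OF assms(1), of "take i vs" "drop (Suc i) vs" y] assms(2,3)
  by (simp add: upd_conv_take_nth_drop omit_def)

text \<open>Perturbing every argument by a multiple of one fixed vector has no effects beyond first
  order, because two slots filled with that vector cancel.\<close>

lemma alternating_map_rank_one:
  assumes "alternating_map k f" "length ws = k"
  shows "f (map (\<lambda>w. g w + c w *\<^sub>R y) ws) =
      f (map g ws) + (\<Sum>b<k. c (ws ! b) * f ((map g ws)[b := y]))"
  using assms
proof (induction ws arbitrary: f k)
  case (Cons w ws)
  let ?h = "\<lambda>w. g w + c w *\<^sub>R y"
  obtain m where k: "k = Suc m" "length ws = m" using Cons.prems(2) by auto
  note alt = Cons.prems(1)[unfolded k]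
  have "f (map ?h (w # ws)) = f (g w # map ?h ws) + c w * f (y # map ?h ws)"
    using alternating_map_add_Cons[OF alt, of "[]" "map ?h ws" "g w" "c w *\<^sub>R y"]
      alternating_map_scale_Cons[OF alt, of "[]" "map ?h ws" "c w" y] k by simp
  also have "f (g w # map ?h ws) = f (g w # map g ws) +
      (\<Sum>b<m. c (ws ! b) * f (g w # (map g ws)[b := y]))"
    using Cons.IH[of m "\<lambda>vs. f (g w # vs)"] alternating_map_Cons[OF alt] k by simp
  also have "f (y # map ?h ws) = f (y # map g ws) +
      (\<Sum>b<m. c (ws ! b) * f (y # (map g ws)[b := y]))"
    using Cons.IH[of m "\<lambda>vs. f (y # vs)"] alternating_map_Cons[OF alt] k by simp
  also have "(\<Sum>b<m. c (ws ! b) * f (y # (map g ws)[b := y])) = 0"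
  proof (intro sum.neutral ballI)
    fix b assume b: "b \<in> {..<m}"
    have "y \<in> set ((map g ws)[b := y])" using b k by (intro set_update_memI) auto
    then show "c (ws ! b) * f (y # (map g ws)[b := y]) = 0"
      using alternating_map_not_distinct[OF alt, of "y # (map g ws)[b := y]"] k by simp
  qed
  finally show ?case
    unfolding k sum.lessThan_Suc_shift by (simp add: algebra_simps)
qed simp

text \<open>If \<open>c\<close> is one of the last vectors there is a repetition; linearity in the slot does the rest.\<close>

lemma alternating_map_span_zero:
  assumes "alternating_map k f" "length us + length ts + 1 = k" "c \<in> span (set ts)"
  shows "f (us @ c # ts) = 0"
proof -
  define L where "L = (\<lambda>v. f (us @ v # ts))"
  have "linear L"
    unfolding L_def using alternating_map_linear[OF assms(1,2)] .
  moreover have "L t = 0" if "t \<in> set ts" for t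
    unfolding L_def
    by (rule alternating_map_not_distinct[OF assms(1)]) (use assms(2) that in auto)
  ultimately have "L c = 0"
    using assms(3) by (rule linear_eq_0_on_span)
  then show ?thesis by (simp add: L_def)
qed

text \<open>The arguments are shifted one at a time; each shift contributes a value with a slot in the span of
  the last vectors.\<close>

lemma alternating_map_shift:
  assumes "alternating_map k f" "length ws + length ts = k"
    and "\<And>w. w \<in> set ws \<Longrightarrow> g w - h w \<in> span (set ts)"
  shows "f (map g ws @ ts) = f (map h ws @ ts)"
  using assms
proof (induction ws arbitrary: f k)
  case (Cons w ws)
  obtain m where k: "k = Suc m" using Cons.prems(2) by auto
  note alt = Cons.prems(1)[unfolded k]
  have 1: "f (g w # map g ws @ ts) = f (g w # map h ws @ ts)"
    using Cons.IH[of m "\<lambda>vs. f (g w # vs)"] alternating_map_Cons[OF alt] Cons.prems k by simp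
  have "f ((g w - h w) # map h ws @ ts) =
        (-1) ^ length ws * f (map h ws @ (g w - h w) # ts)"
    using alternating_map_move[OF alt, of "map h ws" ts "g w - h w"] Cons.prems k by simp
  also have "\<dots> = 0"
    using alternating_map_span_zero[OF alt, of "map h ws" ts "g w - h w"] Cons.prems k by simp
  finally have "f (g w # map h ws @ ts) = f (h w # map h ws @ ts)"
    using alternating_map_sub_Cons[OF alt, of "[]" "map h ws @ ts" "g w" "h w"] Cons.prems(2) k
    by simp
  then show ?case using 1 by simp
qed simp

text \<open>For edge vectors of a simplex this is the statement that the base vertex may be exchanged.\<close>

lemma alternating_map_exchange:
  assumes "alternating_map k f" "length xs + length ys + 1 = k"
  shows "f (map (\<lambda>b. b - a) (xs @ x # ys)) = - f (map (\<lambda>b. b - x) (xs @ a # ys))"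
proof -
  have "f (map (\<lambda>b. b - a) xs @ map (\<lambda>b. b - a) ys @ [x - a]) =
        f (map (\<lambda>b. b - x) xs @ map (\<lambda>b. b - x) ys @ [x - a])"
    using alternating_map_shift[OF assms(1), of "xs @ ys" "[x - a]" "\<lambda>b. b - a" "\<lambda>b. b - x"] assms(2)
    by (simp add: span_base)
  moreover have "f (xs' @ d # ys') = (-1) ^ length ys' * f (xs' @ ys' @ [d])"
    if "length xs' + length ys' + 1 = k" for xs' ys' :: "'a list" and d
    using alternating_map_move_block[OF alternating_map_append[OF assms(1), of xs' "Suc (length ys')" "[]"],
        of "[d]" ys'] that by simp
  ultimately have "f (map (\<lambda>b. b - a) xs @ (x - a) # map (\<lambda>b. b - a) ys) =
        f (map (\<lambda>b. b - x) xs @ (x - a) # map (\<lambda>b. b - x) ys)"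
    using assms(2) by simp
  also have "\<dots> = - f (map (\<lambda>b. b - x) xs @ (a - x) # map (\<lambda>b. b - x) ys)"
    using alternating_map_scale_Cons[OF assms(1), of "map (\<lambda>b. b - x) xs" "map (\<lambda>b. b - x) ys" "-1" "a - x"]
      assms(2) by simp
  finally show ?thesis by simp
qed

lemma length_omit [simp]: "i < length J \<Longrightarrow> length (omit i J) = length J - 1"
  by (simp add: omit_def)

lemma omit_0 [simp]: "omit 0 (x # xs) = xs"
  and omit_Suc [simp]: "omit (Suc i) (x # xs) = x # omit i xs"
  by (simp_all add: omit_def)

lemma map_omit: "map g (omit i J) = omit i (map g J)"
  by (simp add: omit_def take_map drop_map)

text \<open>The boundary of a simplex carries no net \<open>s\<close>-dimensional area: the alternating sum over the
  facets of the cone with apex the origin equals the contribution of the base, and any vertex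
  of the base serves as origin of its edge vectors.\<close>

lemma alternating_sum_omit:
  assumes f: "alternating_map k f" and l: "length bs = Suc k" and i: "i \<le> k"
  shows "(\<Sum>m\<le>k. (-1) ^ m * f (omit m bs)) = (-1) ^ i * f (map (\<lambda>b. b - bs ! i) (omit i bs))"
proof -
  obtain x bs' where bs: "bs = x # bs'" "length bs' = k" using l by (cases bs) auto
  have "f (map (\<lambda>b. b - x) bs') = f bs' + (\<Sum>b<k. - f (bs'[b := x]))"
    using alternating_map_rank_one[OF f bs(2), of "\<lambda>b. b" "\<lambda>_. -1" x] by simp
  also have "\<dots> = f bs' + (\<Sum>b<k. (-1) ^ Suc b * f (x # omit b bs'))"
    using alternating_map_omit[OF f bs(2), of _ x] by simp
  also have "\<dots> = (\<Sum>m<Suc k. (-1) ^ m * f (omit m bs))"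
    unfolding sum.lessThan_Suc_shift bs by simp
  finally have front: "(\<Sum>m\<le>k. (-1) ^ m * f (omit m bs)) = f (map (\<lambda>b. b - x) bs')"
    by (simp add: lessThan_Suc_atMost)
  show ?thesis
  proof (cases i)
    case 0
    then show ?thesis using front bs by simp
  next
    case (Suc j)
    define xs where "xs = take j bs'"
    define ys where "ys = drop (Suc j) bs'"
    define a where "a = bs' ! j"
    have j: "j < k" using i Suc by simp
    have bs': "bs' = xs @ a # ys" unfolding xs_def a_def ys_def using j bs by (simp add: id_take_nth_drop)
    have lx: "length xs = j" using j bs by (simp add: xs_def)
    have "f (map (\<lambda>b. b - a) (x # xs @ ys)) = - f (map (\<lambda>b. b - x) (a # xs @ ys))"
      using alternating_map_exchange[OF f, of "[]" "xs @ ys" a x] bs bs' by simp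
    also have "f (map (\<lambda>b. b - x) (a # xs @ ys)) = (-1) ^ j * f (map (\<lambda>b. b - x) bs')"
      using alternating_map_move[OF f, of "map (\<lambda>b. b - x) xs" "map (\<lambda>b. b - x) ys" "a - x"] bs bs' lx
      by simp
    finally have "(-1) ^ i * f (map (\<lambda>b. b - a) (x # xs @ ys)) = f (map (\<lambda>b. b - x) bs')"
      using Suc by simp
    moreover have "omit i bs = x # xs @ ys" "bs ! i = a"
      using Suc lx by (simp_all add: bs bs' omit_def nth_append)
    ultimately show ?thesis using front by simp
  qed
qed

section \<open>Barycentric coordinates\<close>

locale nondeg_simplex =
  fixes X :: "nat \<Rightarrow> 'a::euclidean_space"
  assumes nondeg: "nondegenerate_simplex X"
begin

text \<open>The edges at vertex \<open>0\<close> form a basis, on which all affine identities below are checked.\<close>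

definition edges0 :: "'a set" where "edges0 = (\<lambda>j. X j - X 0) ` {1..DIM('a)}"

lemma inj_X: "inj_on X {..DIM('a)}"
  using nondeg by (simp add: nondegenerate_simplex_def)

lemma edges0_basis: "independent edges0" "span edges0 = UNIV"
proof -
  have S: "insert (X 0) (X ` {1..DIM('a)}) = X ` {..DIM('a)}"
    by (auto simp: image_iff) (metis Suc_leI atLeastAtMost_iff bot_nat_0.not_eq_extremum One_nat_def)
  have e: "{x - X 0 |x. x \<in> X ` {1..DIM('a)}} = edges0" by (auto simp: edges0_def)
  have "X 0 \<notin> X ` {1..DIM('a)}" by (auto dest: inj_onD[OF inj_X])
  then show ind: "independent edges0"
    using dependent_imp_affine_dependent[of "X 0" "X ` {1..DIM('a)}"] nondeg
    unfolding S e by (auto simp: nondegenerate_simplex_def)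
  have "inj_on (\<lambda>j. X j - X 0) {1..DIM('a)}" using inj_X by (auto simp: inj_on_def)
  then have "card edges0 = DIM('a)" by (simp add: edges0_def card_image)
  then show "span edges0 = UNIV"
    using ind card_eq_dim[of edges0 UNIV] by (auto simp: dim_UNIV edges0_def)
qed

lemma linear_eq_on_edges0:
  assumes "linear f" "linear g" "\<And>j. 1 \<le> j \<Longrightarrow> j \<le> DIM('a) \<Longrightarrow> f (X j - X 0) = g (X j - X 0)"
  shows "f = g"
proof
  fix v
  have "v \<in> span edges0" by (simp add: edges0_basis)
  moreover have "f w = g w" if "w \<in> edges0" for w
    using that assms(3) by (auto simp: edges0_def)
  ultimately show "f v = g v"
    using linear_eq_on_span[OF assms(1,2)] by blast
qed

text \<open>The definite description is meaningful: an affine function is determined by its values at the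
  vertices, and these may be prescribed, because the edges at \<open>x\<^sub>0\<close> form a basis.\<close>

lemma bary_spec:
  "(\<exists>g c. linear g \<and> bary X i = (\<lambda>x. g x + c)) \<and>
     (\<forall>j\<le>DIM('a). bary X i (X j) = (if i = j then 1 else 0))"
proof -
  define d where "d j = (if i = j then 1 else (0::real))" for j
  let ?P = "\<lambda>f. (\<exists>g c. linear g \<and> f = (\<lambda>x. g x + c)) \<and>
     (\<forall>j\<le>DIM('a). f (X j) = (if i = j then 1 else (0::real)))"
  \<comment> \<open>the linear part of an affine function with value \<open>d j\<close> at vertex \<open>j\<close>, prescribed on the edges\<close>
  define h where "h v = d (inv_into {..DIM('a)} X (v + X 0)) - d 0" for v
  obtain g :: "'a \<Rightarrow> real" where g: "linear g" "\<And>v. v \<in> edges0 \<Longrightarrow> g v = h v"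
    using linear_independent_extend[OF edges0_basis(1), of h] by blast
  have gj: "g (X j - X 0) = d j - d 0" if "j \<le> DIM('a)" for j
  proof (cases "j = 0")
    case True
    then show ?thesis using linear_0[OF g(1)] by simp
  next
    case False
    then have "X j - X 0 \<in> edges0" using that by (auto simp: edges0_def)
    then show ?thesis using g(2) that inj_X by (simp add: h_def inv_into_f_f)
  qed
  have "\<exists>!f. ?P f"
  proof (rule ex1I[of _ "\<lambda>x. g x + (d 0 - g (X 0))"])
    show "?P (\<lambda>x. g x + (d 0 - g (X 0)))"
    proof (intro conjI allI impI)
      show "\<exists>h c. linear h \<and> (\<lambda>x. g x + (d 0 - g (X 0))) = (\<lambda>x. h x + c)"
        using g(1) by blast
      fix j assume "j \<le> DIM('a)"
      then show "g (X j) + (d 0 - g (X 0)) = (if i = j then 1 else 0)"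
        using gj[of j] linear_diff[OF g(1), of "X j" "X 0"] by (simp add: d_def)
    qed
  next
    fix f assume f: "?P f"
    then obtain g' c where g': "linear g'" "f = (\<lambda>x. g' x + c)" by blast
    have vf: "f (X j) = d j" if "j \<le> DIM('a)" for j using f that by (simp add: d_def)
    have "g' = g"
    proof (rule linear_eq_on_edges0[OF g'(1) g(1)])
      fix j assume "1 \<le> j" "j \<le> DIM('a)"
      then show "g' (X j - X 0) = g (X j - X 0)"
        using vf[of j] vf[of 0] gj[of j] linear_diff[OF g'(1), of "X j" "X 0"] g'(2) by simp
    qed
    moreover have "c = d 0 - g' (X 0)" using vf[of 0] g'(2) by simp
    ultimately show "f = (\<lambda>x. g x + (d 0 - g (X 0)))" using g'(2) by simp
  qed
  then have "?P (THE f. ?P f)" by (rule theI')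
  then show ?thesis unfolding bary_def .
qed

text \<open>The linear part of \<open>\<lambda>\<^sub>i\<close>, that is the form \<open>d\<lambda>\<^sub>i\<close>.\<close>

definition dl :: "nat \<Rightarrow> 'a \<Rightarrow> real" where
  "dl i v = bary X i v - bary X i 0"

lemma bary_vertex: "j \<le> DIM('a) \<Longrightarrow> bary X i (X j) = (if i = j then 1 else 0)"
  using bary_spec by blast

lemma linear_dl: "linear (dl i)"
proof -
  obtain g c where g: "linear g" "bary X i = (\<lambda>x. g x + c)" using bary_spec by blast
  then have "dl i = g" using linear_0[OF g(1)] by (auto simp: dl_def)
  then show ?thesis using g by simp
qed

lemma bary_diff: "bary X i x - bary X i y = dl i (x - y)"
  using linear_diff[OF linear_dl, of i x y] by (simp add: dl_def)

lemma bary_add: "bary X i (x + v) = bary X i x + dl i v"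
  using bary_diff[of i "x + v" x] by simp

lemma dl_vertex_diff: "j \<le> DIM('a) \<Longrightarrow> dl i (y - X j) = bary X i y - (if i = j then 1 else 0)"
  using bary_diff[of i y "X j"] by (simp add: bary_vertex)

lemma sum_dl: "(\<Sum>i\<le>DIM('a). dl i v) = 0"
proof -
  have "(\<lambda>v. \<Sum>i\<le>DIM('a). dl i v) = (\<lambda>v. 0)"
  proof (rule linear_eq_on_edges0)
    show "linear (\<lambda>v. \<Sum>i\<le>DIM('a). dl i v)" by (intro linear_compose_sum ballI linear_dl)
    fix j assume "1 \<le> j" "j \<le> DIM('a)"
    then show "(\<Sum>i\<le>DIM('a). dl i (X j - X 0)) = 0"
      by (simp add: dl_vertex_diff bary_vertex sum_subtractf)
  qed (simp add: linear_zero)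
  then show ?thesis by (simp add: fun_eq_iff)
qed

lemma sum_dl_X: "(\<Sum>i\<le>DIM('a). dl i v *\<^sub>R X i) = v"
proof -
  have "(\<lambda>v. \<Sum>i\<le>DIM('a). dl i v *\<^sub>R X i) = (\<lambda>v. v)"
  proof (rule linear_eq_on_edges0)
    show "linear (\<lambda>v. \<Sum>i\<le>DIM('a). dl i v *\<^sub>R X i)"
      by (intro linear_compose_sum ballI) (auto intro!: linearI simp: linear_add[OF linear_dl]
        linear_scale[OF linear_dl] algebra_simps)
    fix j assume j: "1 \<le> j" "j \<le> DIM('a)"
    have "(\<Sum>i\<le>DIM('a). (if i = m then 1 else 0) *\<^sub>R X i) = X m" if "m \<le> DIM('a)" for m
    proof -
      have "(\<Sum>i\<le>DIM('a). (if i = m then 1 else 0) *\<^sub>R X i) =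
          (\<Sum>i\<le>DIM('a). if i = m then X i else 0)" by (intro sum.cong) auto
      then show ?thesis using that by simp
    qed
    from this[of j] this[of 0] show "(\<Sum>i\<le>DIM('a). dl i (X j - X 0) *\<^sub>R X i) = X j - X 0"
      using j by (simp add: dl_vertex_diff bary_vertex sum_subtractf scaleR_diff_left)
  qed (simp add: linear_ident)
  then show ?thesis by (simp add: fun_eq_iff)
qed

lemma sum_bary: "(\<Sum>i\<le>DIM('a). bary X i x) = 1"
proof -
  have "(\<Sum>i\<le>DIM('a). bary X i x) = (\<Sum>i\<le>DIM('a). bary X i (X 0)) + (\<Sum>i\<le>DIM('a). dl i (x - X 0))"
    using bary_add[of _ "X 0" "x - X 0"] by (simp add: sum.distrib)
  then show ?thesis by (simp add: sum_dl bary_vertex)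
qed

lemma sum_bary_X: "(\<Sum>i\<le>DIM('a). bary X i x *\<^sub>R X i) = x"
proof -
  have "(\<Sum>i\<le>DIM('a). bary X i x *\<^sub>R X i) =
      (\<Sum>i\<le>DIM('a). bary X i (X 0) *\<^sub>R X i) + (\<Sum>i\<le>DIM('a). dl i (x - X 0) *\<^sub>R X i)"
    using bary_add[of _ "X 0" "x - X 0"] by (simp add: sum.distrib scaleR_add_left)
  also have "(\<Sum>i\<le>DIM('a). bary X i (X 0) *\<^sub>R X i) = (\<Sum>i\<le>DIM('a). if i = 0 then X i else 0)"
    by (intro sum.cong) (auto simp: bary_vertex)
  finally show ?thesis by (simp add: sum_dl_X)
qed

lemma bary_has_derivative: "(bary X i has_derivative dl i) (at x)"
proof -
  have "bary X i = (\<lambda>x. dl i x + bary X i 0)" by (auto simp: dl_def)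
  moreover have "((\<lambda>x. dl i x + bary X i 0) has_derivative dl i) (at x)"
    using linear_imp_has_derivative[OF linear_dl] by (auto intro!: derivative_eq_intros)
  ultimately show ?thesis by simp
qed

lemma frechet_bary: "frechet_derivative (bary X i) (at x) = dl i"
  using frechet_derivative_at[OF bary_has_derivative] by simp

lemma dbary_eq: "dbary X i x vs = dl i (hd vs)"
  by (simp add: dbary_def frechet_bary)

lemma continuous_on_bary: "continuous_on A (bary X i)"
  using bary_has_derivative has_derivative_continuous continuous_at_imp_continuous_on by blast

lemma convex_bary_nonneg: "convex {x. \<forall>i\<le>DIM('a). bary X i x \<ge> 0}"
proof (rule convexI)
  fix x y and s t :: real
  assume x: "x \<in> {x. \<forall>i\<le>DIM('a). bary X i x \<ge> 0}" and y: "y \<in> {x. \<forall>i\<le>DIM('a). bary X i x \<ge> 0}"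
    and st: "0 \<le> s" "0 \<le> t" "s + t = 1"
  have "bary X i (s *\<^sub>R x + t *\<^sub>R y) = s * bary X i x + t * bary X i y" for i
  proof -
    have "bary X i (s *\<^sub>R x + t *\<^sub>R y) = s * dl i x + t * dl i y + (s + t) * bary X i 0"
      using bary_add[of i 0 "s *\<^sub>R x + t *\<^sub>R y"] st linear_add[OF linear_dl] linear_scale[OF linear_dl]
      by simp
    then show ?thesis by (simp add: dl_def algebra_simps)
  qed
  then show "s *\<^sub>R x + t *\<^sub>R y \<in> {x. \<forall>i\<le>DIM('a). bary X i x \<ge> 0}"
    using x y st by simp
qed

lemma mem_simplex_S: "x \<in> simplex_S X \<longleftrightarrow> (\<forall>i\<le>DIM('a). bary X i x \<ge> 0)"
proof
  assume "x \<in> simplex_S X"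
  moreover have "simplex_S X \<subseteq> {x. \<forall>i\<le>DIM('a). bary X i x \<ge> 0}"
    unfolding simplex_S_def by (rule hull_minimal) (auto simp: bary_vertex convex_bary_nonneg)
  ultimately show "\<forall>i\<le>DIM('a). bary X i x \<ge> 0" by auto
next
  assume a: "\<forall>i\<le>DIM('a). bary X i x \<ge> 0"
  have "(\<Sum>i\<le>DIM('a). bary X i x *\<^sub>R X i) \<in> simplex_S X"
    unfolding simplex_S_def using a
    by (intro convex_sum) (auto simp: sum_bary hull_inc)
  then show "x \<in> simplex_S X" by (simp add: sum_bary_X)
qed

lemma facet_mem: "x \<in> facet X i \<longleftrightarrow> (\<forall>i\<le>DIM('a). bary X i x \<ge> 0) \<and> bary X i x = 0"
  by (simp add: facet_def mem_simplex_S)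

lemma compact_simplex_S: "compact (simplex_S X)"
  unfolding simplex_S_def by (intro compact_convex_hull finite_imp_compact) simp

lemma compact_facet: "compact (facet X i)"
proof -
  have "closed (bary X i -` {0})"
    by (intro continuous_closed_vimage closed_singleton)
      (use bary_has_derivative has_derivative_continuous in blast)
  moreover have "facet X i = simplex_S X \<inter> bary X i -` {0}" by (auto simp: facet_def)
  ultimately show ?thesis using compact_simplex_S by (auto intro: compact_Int_closed)
qed

text \<open>All edges of the face avoid vertex \<open>i\<close>, and \<open>d\<lambda>\<^sub>i\<close> vanishes on them.\<close>

lemma tangent_space_dl:
  assumes "A \<subseteq> {..DIM('a)}" "i \<notin> A" "v \<in> tangent_space X A"
  shows "dl i v = 0"
  using linear_dl
proof (rule linear_eq_0_on_span)
  show "v \<in> span {X a - X b | a b. a \<in> A \<and> b \<in> A}"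
    using assms(3) by (simp add: tangent_space_def)
  fix w assume "w \<in> {X a - X b | a b. a \<in> A \<and> b \<in> A}"
  then obtain a b where "w = X a - X b" "a \<in> A" "b \<in> A" by blast
  moreover from this have "a \<le> DIM('a)" "b \<le> DIM('a)" "a \<noteq> i" "b \<noteq> i" using assms(1,2) by auto
  ultimately show "dl i w = 0" by (simp add: dl_vertex_diff bary_vertex)
qed

text \<open>Expand \<open>v = \<Sum>\<^sub>j d\<lambda>\<^sub>j(v) x\<^sub>j\<close> and subtract \<open>\<Sum>\<^sub>j d\<lambda>\<^sub>j(v) x\<^sub>r = 0\<close> for a vertex \<open>r\<close> of the facet.\<close>

lemma facet_tangent_eq:
  assumes "i \<le> DIM('a)"
  shows "facet_tangent X i = {v. dl i v = 0}"
proof (intro set_eqI iffI)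
  fix v assume "v \<in> facet_tangent X i"
  then show "v \<in> {v. dl i v = 0}"
    using tangent_space_dl[of "{..DIM('a)} - {i}" i v] by (simp add: facet_tangent_def)
next
  fix v assume v: "v \<in> {v. dl i v = 0}"
  define r where "r = (if i = 0 then 1 else 0::nat)"
  have r: "r \<le> DIM('a)" "r \<noteq> i" using DIM_positive[where 'a = 'a] by (auto simp: r_def)
  have "v = (\<Sum>j\<le>DIM('a). dl j v *\<^sub>R X j) - (\<Sum>j\<le>DIM('a). dl j v) *\<^sub>R X r"
    by (simp add: sum_dl sum_dl_X)
  also have "\<dots> = (\<Sum>j\<le>DIM('a). dl j v *\<^sub>R (X j - X r))"
    by (simp add: sum_subtractf scaleR_diff_right scaleR_left.sum)
  also have "\<dots> \<in> facet_tangent X i"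
    unfolding facet_tangent_def tangent_space_def
  proof (intro span_sum)
    fix j assume j: "j \<in> {..DIM('a)}"
    show "dl j v *\<^sub>R (X j - X r) \<in> span {X a - X b |a b. a \<in> {..DIM('a)} - {i} \<and> b \<in> {..DIM('a)} - {i}}"
    proof (cases "j = i")
      case True
      then show ?thesis using v by (simp add: span_zero)
    next
      case False
      then show ?thesis using j r by (intro span_scale span_base) blast
    qed
  qed
  finally show "v \<in> facet_tangent X i" .
qed

subsection \<open>The contractions\<close>

definition bsum :: "nat set \<Rightarrow> 'a \<Rightarrow> real" where
  "bsum I x = (\<Sum>i\<in>I. bary X i x)"

definition dbsum :: "nat set \<Rightarrow> 'a \<Rightarrow> real" where
  "dbsum I v = (\<Sum>i\<in>I. dl i v)"

text \<open>The derivative of \<open>x \<mapsto> F\<^sub>I(x, y)\<close>, which does not depend on \<open>x\<close>.\<close>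

definition dF :: "nat set \<Rightarrow> 'a \<Rightarrow> 'a \<Rightarrow> 'a" where
  "dF I y v = v + (\<Sum>i\<in>I. dl i v *\<^sub>R (y - X i))"

lemma bary_sum_eq: "bary_sum X J x = bsum (set J) x"
  by (simp add: bary_sum_def bsum_def)

lemma frechet_Fmap: "frechet_derivative (\<lambda>z. Fmap X I z y) (at x) = dF (set I) y"
proof -
  have "((\<lambda>z. Fmap X I z y) has_derivative dF (set I) y) (at x)"
    unfolding Fmap_def dF_def
    by (auto intro!: derivative_eq_intros bary_has_derivative)
  then show ?thesis using frechet_derivative_at by metis
qed

lemma frechet_Pmap: "frechet_derivative (Pmap X I j) (at x) = dF (set I) (X j)"
  using frechet_Fmap[of I "X j" x] by (simp add: Pmap_def[abs_def])

lemma dF_shift: "dF I y v - dF I y' v = dbsum I v *\<^sub>R (y - y')"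
  by (simp add: dF_def dbsum_def algebra_simps sum_subtractf scaleR_left.sum flip: sum.distrib)

lemma dl_dF:
  assumes "I \<subseteq> {..DIM('a)}"
  shows "dl l (dF I y v) = (if l \<in> I then 0 else dl l v) + dbsum I v * bary X l y"
proof -
  have fin: "finite I" using assms finite_subset by blast
  have "dl l (dF I y v) = dl l v + (\<Sum>i\<in>I. dl i v * dl l (y - X i))"
    by (simp add: dF_def linear_add[OF linear_dl] linear_sum[OF linear_dl] linear_scale[OF linear_dl])
  also have "(\<Sum>i\<in>I. dl i v * dl l (y - X i)) =
      (\<Sum>i\<in>I. dl i v * bary X l y - (if i = l then dl i v else 0))"
    using assms by (intro sum.cong) (auto simp: dl_vertex_diff algebra_simps)
  also have "\<dots> = dbsum I v * bary X l y - (if l \<in> I then dl l v else 0)"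
    using fin by (simp add: sum_subtractf dbsum_def sum_distrib_right)
  finally show ?thesis by simp
qed

text \<open>The map \<open>F\<^sub>I\<close> takes the mass of \<open>x\<close> at the vertices in \<open>I\<close> and places it at \<open>y\<close>.\<close>

lemma bary_Fmap:
  assumes "set I \<subseteq> {..DIM('a)}"
  shows "bary X l (Fmap X I x y) = (if l \<in> set I then 0 else bary X l x) + bsum (set I) x * bary X l y"
proof -
  have "bary X l (Fmap X I x y) = bary X l x + (\<Sum>i\<in>set I. bary X i x * dl l (y - X i))"
    by (simp add: Fmap_def bary_add linear_sum[OF linear_dl] linear_scale[OF linear_dl])
  also have "(\<Sum>i\<in>set I. bary X i x * dl l (y - X i)) =
      (\<Sum>i\<in>set I. bary X i x * bary X l y - (if i = l then bary X i x else 0))"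
    using assms by (intro sum.cong) (auto simp: dl_vertex_diff algebra_simps)
  also have "\<dots> = bsum (set I) x * bary X l y - (if l \<in> set I then bary X l x else 0)"
    by (simp add: sum_subtractf bsum_def sum_distrib_right)
  finally show ?thesis by simp
qed

lemma bsum_nonneg: "x \<in> simplex_S X \<Longrightarrow> I \<subseteq> {..DIM('a)} \<Longrightarrow> bsum I x \<ge> 0"
  unfolding bsum_def by (intro sum_nonneg) (auto simp: mem_simplex_S)

lemma bary_le_bsum:
  assumes "x \<in> simplex_S X" "I \<subseteq> {..DIM('a)}" "i \<in> I"
  shows "bary X i x \<le> bsum I x"
proof -
  have "finite I" using assms(2) finite_subset by blast
  moreover have "bary X j x \<ge> 0" if "j \<in> I" for j using assms(1,2) that by (auto simp: mem_simplex_S)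
  ultimately show ?thesis unfolding bsum_def using assms(3) by (intro member_le_sum) auto
qed

text \<open>The mass at a vertex \<open>j\<close> in \<open>I\<close> is removed, and \<open>y\<close> brings nothing back.\<close>

lemma Fmap_facet:
  assumes "set I \<subseteq> {..DIM('a)}" "x \<in> simplex_S X" "A \<subseteq> {..DIM('a)}" "y \<in> convex hull (X ` A)"
    and "j \<in> set I" "j \<notin> A"
  shows "Fmap X I x y \<in> facet X j"
proof -
  have "y \<in> simplex_S X"
    using assms(3,4) hull_mono[of "X ` A" "X ` {..DIM('a)}"] by (auto simp: simplex_S_def)
  moreover have "bary X j y = 0"
  proof -
    have "convex {y. bary X j y = 0}"
    proof -
      have "{y. bary X j y = 0} = {y. dl j y = - bary X j 0}" by (auto simp: dl_def)
      moreover have "convex {y. dl j y = - bary X j 0}"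
        by (rule convexI) (simp add: linear_add[OF linear_dl] linear_scale[OF linear_dl] algebra_simps flip: distrib_right)
      ultimately show ?thesis by simp
    qed
    then have "convex hull (X ` A) \<subseteq> {y. bary X j y = 0}"
      using assms(3,6) by (intro hull_minimal) (auto simp: bary_vertex)
    then show ?thesis using assms(4) by auto
  qed
  ultimately show ?thesis
    using assms bsum_nonneg[of x "set I"] by (auto simp: facet_mem bary_Fmap mem_simplex_S)
qed

lemma Fmap_degenerate:
  assumes "set I \<subseteq> {..DIM('a)}" "x \<in> simplex_S X" "bsum (set I) x = 0"
  shows "Fmap X I x y = x"
proof -
  have "bary X i x = 0" if i: "i \<in> set I" for i
  proof (rule antisym)
    show "bary X i x \<le> 0" using bary_le_bsum[OF assms(2,1) i] assms(3) by simp
    show "0 \<le> bary X i x" using assms(1,2) i by (auto simp: mem_simplex_S)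
  qed
  then show ?thesis by (simp add: Fmap_def)
qed

lemma continuous_on_Fmap: "continuous_on A (\<lambda>x. Fmap X I x y)"
  unfolding Fmap_def
  by (intro continuous_on_add continuous_on_sum continuous_on_scaleR continuous_on_bary
      continuous_on_const continuous_on_diff continuous_on_id)

lemma continuous_on_Fmap': "continuous_on A (\<lambda>y. Fmap X I x y)"
  unfolding Fmap_def
  by (intro continuous_on_add continuous_on_sum continuous_on_scaleR continuous_on_bary
      continuous_on_const continuous_on_diff continuous_on_id)

end

lemma Gam_mem:
  assumes "I \<in> Gam n m"
  shows "set I \<subseteq> {..n}" "card (set I) = m + 1" "sorted_list_of_set (set I) = I" "distinct I"
proof -
  have I: "sorted I" "distinct I" "set I \<subseteq> {..n}" "length I = m + 1"
    using assms by (auto simp: Gam_def strict_sorted_iff)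
  show "set I \<subseteq> {..n}" "distinct I" by fact+
  show "card (set I) = m + 1" using distinct_card[OF I(2)] I(4) by simp
  show "sorted_list_of_set (set I) = I"
    using sorted_list_of_set.idem_if_sorted_distinct[OF I(1,2)] .
qed

lemma sorted_list_Gam: "S \<subseteq> {..n} \<Longrightarrow> card S = m + 1 \<Longrightarrow> sorted_list_of_set S \<in> Gam n m"
  using finite_subset[of S "{..n}"] by (auto simp: Gam_def)

text \<open>Index lists of positive dimension correspond to sets with at least two elements; in terms of sets
  the sign is \<open>(-1)\<^bsup>card S\<^esup>\<close> and the lists for \<open>S\<close> and \<open>insert q S\<close> can be paired.\<close>

lemma sum_Gam_sets:
  fixes T :: "nat list \<Rightarrow> real"
  shows "(\<Sum>m=1..n. \<Sum>I\<in>Gam n m. (-1) ^ (m + 1) * T I) =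
    (\<Sum>S | S \<subseteq> {..n} \<and> 2 \<le> card S. (-1) ^ card S * T (sorted_list_of_set S))"
proof -
  have fin: "finite (Gam n m)" for m
    by (rule finite_subset[OF _ finite_lists_length_eq[of "{..n}" "m + 1"]]) (auto simp: Gam_def)
  have "(\<Sum>m=1..n. \<Sum>I\<in>Gam n m. (-1) ^ (m + 1) * T I) =
     (\<Sum>(m, I)\<in>Sigma {1..n} (Gam n). (-1) ^ (m + 1) * T I)"
    using fin by (subst sum.Sigma) auto
  also have "\<dots> = (\<Sum>S | S \<subseteq> {..n} \<and> 2 \<le> card S. (-1) ^ card S * T (sorted_list_of_set S))"
  proof (rule sum.reindex_bij_witness[where i = "\<lambda>S. (card S - 1, sorted_list_of_set S)"
        and j = "\<lambda>(m, I). set I"])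
    fix S assume S: "S \<in> {S. S \<subseteq> {..n} \<and> 2 \<le> card S}"
    then have f: "finite S" using finite_subset by blast
    have "card S \<le> n + 1" using S card_mono[of "{..n}" S] by simp
    then show "(card S - 1, sorted_list_of_set S) \<in> Sigma {1..n} (Gam n)"
      using S sorted_list_Gam[of S n "card S - 1"] by auto
    show "(case (card S - 1, sorted_list_of_set S) of (m, I) \<Rightarrow> set I) = S"
      using f by simp
  next
    fix p assume p: "p \<in> Sigma {1..n} (Gam n)"
    obtain m I where mI: "p = (m, I)" by (cases p)
    then have I: "set I \<subseteq> {..n}" "card (set I) = m + 1" "sorted_list_of_set (set I) = I" "1 \<le> m"
      using p Gam_mem[of I n m] by auto
    then show "(card (case p of (m, I) \<Rightarrow> set I) - 1, sorted_list_of_set (case p of (m, I) \<Rightarrow> set I)) = p"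
      "(case p of (m, I) \<Rightarrow> set I) \<in> {S. S \<subseteq> {..n} \<and> 2 \<le> card S}"
      "(- 1) ^ card (case p of (m, I) \<Rightarrow> set I) * T (sorted_list_of_set (case p of (m, I) \<Rightarrow> set I)) =
        (case p of (m, I) \<Rightarrow> (- 1) ^ (m + 1) * T I)"
      using mI by auto
  qed
  finally show ?thesis .
qed

section \<open>Wedge products\<close>

lemma alternating_map_permute_fun:
  assumes f: "alternating_map k f" and p: "p permutes {m..<m + k}"
  shows "f (map (\<lambda>a. w (p a)) [m..<m + k]) = of_int (sign p) * f (map w [m..<m + k])"
proof -
  have "finite {m..<m + k}" by simp
  from this p show ?thesis
  proof (induction rule: permutes_rev_induct)
    case id
    show ?case by simp
  next
    case (swap a b p)
    have *: "f (map (\<lambda>c. w ((p \<circ> Transposition.transpose a b) c)) [m..<m + k]) =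
        - f (map (\<lambda>c. w (p c)) [m..<m + k])" if ab: "m \<le> a" "a < b" "b < m + k" for a b
    proof -
      define g where "g = (\<lambda>c. w (p c))"
      define t where "t = Transposition.transpose a b"
      have t: "t a = b" "t b = a" "\<And>c. c \<noteq> a \<Longrightarrow> c \<noteq> b \<Longrightarrow> t c = c"
        by (simp_all add: t_def)
      have 1: "[m..<m + k] = [m..<a] @ [a..<m + k]"
        using upt_add_eq_append[of m a "m + k - a"] ab by simp
      have 2: "[a..<m + k] = a # [Suc a..<m + k]" using ab by (intro upt_conv_Cons) simp
      have 3: "[Suc a..<m + k] = [Suc a..<b] @ [b..<m + k]"
        using upt_add_eq_append[of "Suc a" b "m + k - b"] ab by simp
      have 4: "[b..<m + k] = b # [Suc b..<m + k]" using ab by (intro upt_conv_Cons) simp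
      have spl: "map h [m..<m + k] =
          map h [m..<a] @ h a # map h [Suc a..<b] @ h b # map h [Suc b..<m + k]"
        for h :: "nat \<Rightarrow> 'a"
        unfolding 1 2 3 4 by simp
      have len: "length [m..<a] + length [Suc a..<b] + length [Suc b..<m + k] + 2 = k"
        using ab by simp
      have gt: "map (g \<circ> t) [m..<m + k] =
         map g [m..<a] @ g b # map g [Suc a..<b] @ g a # map g [Suc b..<m + k]"
        unfolding spl[of "g \<circ> t"] using ab by (simp add: t)
      have "f (map (g \<circ> t) [m..<m + k]) = - f (map g [m..<m + k])"
        unfolding gt spl[of g] by (rule alternating_map_swap[OF f]) (use len in simp)
      then show ?thesis by (simp add: g_def t_def comp_def)
    qed
    have pp: "permutation p" using swap permutes_imp_permutation by blast
    have A: "sign (p \<circ> Transposition.transpose a b) = - sign p"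
      using swap pp by (simp add: sign_compose sign_swap_id permutation_swap_id)
    have B: "f (map (\<lambda>c. w ((p \<circ> Transposition.transpose a b) c)) [m..<m + k]) =
        - f (map (\<lambda>c. w (p c)) [m..<m + k])"
    proof (cases "a < b")
      case True
      show ?thesis by (rule *[OF _ True]) (use swap(1,2) in simp_all)
    next
      case False
      then have ba: "b < a" using swap(3) by simp
      show ?thesis unfolding transpose_commute[of a b]
        by (rule *[OF _ ba]) (use swap(1,2) in simp_all)
    qed
    show ?case unfolding A B using swap(5) by simp
  qed
qed

lemma wedge_cong:
  assumes "\<And>ws. length ws = p \<Longrightarrow> set ws \<subseteq> set vs \<Longrightarrow> \<alpha> x ws = \<alpha>' x' ws"
    and "\<And>ws. length ws = q \<Longrightarrow> set ws \<subseteq> set vs \<Longrightarrow> \<beta> x ws = \<beta>' x' ws"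
    and "length vs = p + q"
  shows "wedge p q \<alpha> \<beta> x vs = wedge p q \<alpha>' \<beta>' x' vs"
proof -
  have sub: "set (map (\<lambda>a. vs ! \<pi> a) [i..<j]) \<subseteq> set vs" if "\<pi> permutes {..<p + q}" "j \<le> p + q" for \<pi> i j
  proof -
    have "\<pi> a < p + q" if "a < j" for a
      using permutes_in_image[OF \<open>\<pi> permutes {..<p + q}\<close>, of a] that \<open>j \<le> p + q\<close> by simp
    then show ?thesis using assms(3) by auto
  qed
  show ?thesis
    unfolding wedge_def
  proof (intro arg_cong2[of _ _ _ _ "(/)"] sum.cong refl)
    fix \<pi> assume "\<pi> \<in> {\<pi>. \<pi> permutes {..<p + q}}"
    then have \<pi>: "\<pi> permutes {..<p + q}" by simp
    have "\<alpha> x (map (\<lambda>a. vs ! \<pi> a) [0..<p]) = \<alpha>' x' (map (\<lambda>a. vs ! \<pi> a) [0..<p])"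
      using sub[OF \<pi>, of p 0] by (intro assms(1)) auto
    moreover have "\<beta> x (map (\<lambda>a. vs ! \<pi> a) [p..<p + q]) = \<beta>' x' (map (\<lambda>a. vs ! \<pi> a) [p..<p + q])"
      using sub[OF \<pi>, of "p + q" p] by (intro assms(2)) auto
    ultimately show "of_int (sign \<pi>) * \<alpha> x (map (\<lambda>a. vs ! \<pi> a) [0..<p]) * \<beta> x (map (\<lambda>a. vs ! \<pi> a) [p..<p + q]) =
       of_int (sign \<pi>) * \<alpha>' x' (map (\<lambda>a. vs ! \<pi> a) [0..<p]) * \<beta>' x' (map (\<lambda>a. vs ! \<pi> a) [p..<p + q])"
      by simp
  qed
qed

lemma wedge_sum_left:
  "wedge p q (\<lambda>x ws. \<Sum>i\<in>A. c i x * \<alpha> i x ws) \<beta> x vs = (\<Sum>i\<in>A. c i x * wedge p q (\<alpha> i) \<beta> x vs)"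
proof -
  have "(\<Sum>\<pi> | \<pi> permutes {..<p + q}. of_int (sign \<pi>) *
        (\<Sum>i\<in>A. c i x * \<alpha> i x (map (\<lambda>a. vs ! \<pi> a) [0..<p])) * \<beta> x (map (\<lambda>a. vs ! \<pi> a) [p..<p + q])) =
      (\<Sum>i\<in>A. c i x * (\<Sum>\<pi> | \<pi> permutes {..<p + q}. of_int (sign \<pi>) *
        \<alpha> i x (map (\<lambda>a. vs ! \<pi> a) [0..<p]) * \<beta> x (map (\<lambda>a. vs ! \<pi> a) [p..<p + q])))"
    by (simp add: sum_distrib_left sum_distrib_right algebra_simps)
      (rule sum.swap)
  then show ?thesis by (simp add: wedge_def sum_divide_distrib[where A = A])
qed

text \<open>Composing with the transposition of two equal entries reverses the sign of every summand.\<close>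

lemma sum_permutes_repeated:
  fixes h :: "(nat \<Rightarrow> 'b) \<Rightarrow> real"
  assumes ij: "i < k" "j < k" "i \<noteq> j" and w: "w i = w j"
  shows "(\<Sum>\<pi> | \<pi> permutes {..<k}. of_int (sign \<pi>) * h (\<lambda>a. w (\<pi> a))) = 0"
proof -
  define t where "t = Transposition.transpose i j"
  have t: "t permutes {..<k}" using ij by (auto simp: t_def intro: permutes_swap_id)
  have wt: "w (t a) = w a" for a using w by (auto simp: t_def Transposition.transpose_def)
  have tt: "t \<circ> t = id" by (simp add: t_def fun_eq_iff)
  define T where "T \<pi> = of_int (sign \<pi>) * h (\<lambda>a. w (\<pi> a))" for \<pi>
  have T: "T (t \<circ> \<pi>) = - T \<pi>" if "\<pi> permutes {..<k}" for \<pi>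
  proof -
    have "permutation \<pi>" "permutation t" using that t permutes_imp_permutation by blast+
    then have "sign (t \<circ> \<pi>) = - sign \<pi>" using ij by (simp add: sign_compose t_def sign_swap_id)
    then show ?thesis by (simp add: T_def wt)
  qed
  have "(\<Sum>\<pi> | \<pi> permutes {..<k}. T \<pi>) = (\<Sum>\<pi> | \<pi> permutes {..<k}. - T \<pi>)"
  proof (rule sum.reindex_bij_witness[where i = "\<lambda>\<pi>. t \<circ> \<pi>" and j = "\<lambda>\<pi>. t \<circ> \<pi>"])
    fix \<pi> assume "\<pi> \<in> {\<pi>. \<pi> permutes {..<k}}"
    then show "t \<circ> (t \<circ> \<pi>) = \<pi>" "t \<circ> \<pi> \<in> {\<pi>. \<pi> permutes {..<k}}" "- T (t \<circ> \<pi>) = T \<pi>"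
      "t \<circ> (t \<circ> \<pi>) = \<pi>" "t \<circ> \<pi> \<in> {\<pi>. \<pi> permutes {..<k}}"
      using T t tt permutes_compose[OF _ t, of \<pi>] by (auto simp flip: comp_assoc)
  qed
  then show ?thesis by (simp add: sum_negf T_def)
qed

lemma alternating_wedge:
  assumes \<alpha>: "alternating_map p (\<alpha> x)" and \<beta>: "alternating_map q (\<beta> x)"
  shows "alternating_map (p + q) (wedge p q \<alpha> \<beta> x)"
proof (rule alternating_mapI)
  fix xs ys :: "'a list" assume l: "length xs + length ys + 1 = p + q"
  define i where "i = length xs"
  define vs where "vs v = xs @ v # ys" for v
  define us0 where "us0 = vs 0"
  have vs: "vs v ! a = (if a = i then v else us0 ! a)" for v a
    by (auto simp: us0_def vs_def i_def nth_append nth_Cons')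
  have i: "i < p + q" using l by (simp add: i_def)
  have lin: "linear (\<lambda>v. of_int (sign \<pi>) * \<alpha> x (map (\<lambda>a. vs v ! \<pi> a) [0..<p]) *
      \<beta> x (map (\<lambda>a. vs v ! \<pi> a) [p..<p + q]))" if \<pi>: "\<pi> permutes {..<p + q}" for \<pi>
  proof -
    obtain c where ci: "i = \<pi> c" using surjD[OF permutes_surj[OF \<pi>]] by blast
    have c: "\<pi> c = i" "c < p + q"
      using ci i permutes_in_image[OF \<pi>, of c] by simp_all
    have inj: "\<pi> a = i \<longleftrightarrow> a = c" for a using permutes_inj[OF \<pi>] c by (auto dest: injD)
    have upd: "map (\<lambda>a. vs v ! \<pi> a) [m..<m'] =
        (if m \<le> c \<and> c < m' then (map (\<lambda>a. us0 ! \<pi> a) [m..<m'])[c - m := v]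
         else map (\<lambda>a. us0 ! \<pi> a) [m..<m'])" for v m m'
      by (intro nth_equalityI) (auto simp: vs[of v] inj nth_list_update)
    have alt: "linear (\<lambda>v. f (us[j := v]))" if "alternating_map k f" "length us = k" "j < k" for k f j and us :: "'a list"
      using that unfolding alternating_map_def by blast
    have sc: "linear (\<lambda>v. r * h v * r')" if "linear h" for h :: "'a \<Rightarrow> real" and r r'
      using that by (auto intro!: linearI simp: linear_add linear_scale algebra_simps)
    show ?thesis
    proof (cases "c < p")
      case True
      then have "linear (\<lambda>v. of_int (sign \<pi>) * \<alpha> x ((map (\<lambda>a. us0 ! \<pi> a) [0..<p])[c := v]) *
         \<beta> x (map (\<lambda>a. us0 ! \<pi> a) [p..<p + q]))"
        by (intro sc, intro alt[OF \<alpha>]) auto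
      then show ?thesis using True by (simp add: upd)
    next
      case False
      then have "linear (\<lambda>v. of_int (sign \<pi>) * \<alpha> x (map (\<lambda>a. us0 ! \<pi> a) [0..<p]) *
         \<beta> x ((map (\<lambda>a. us0 ! \<pi> a) [p..<p + q])[c - p := v]) * 1)"
        using c by (intro sc, intro alt[OF \<beta>]) auto
      then show ?thesis using False c by (simp add: upd)
    qed
  qed
  have "linear (\<lambda>v. (\<Sum>\<pi> | \<pi> permutes {..<p + q}. of_int (sign \<pi>) * \<alpha> x (map (\<lambda>a. vs v ! \<pi> a) [0..<p]) *
      \<beta> x (map (\<lambda>a. vs v ! \<pi> a) [p..<p + q])))"
    by (intro linear_compose_sum ballI lin) simp
  moreover have "linear (\<lambda>v. h v / c)" if "linear h" for h :: "'a \<Rightarrow> real" and c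
    using that by (auto intro!: linearI simp: linear_add linear_scale add_divide_distrib)
  ultimately have "linear (\<lambda>v. wedge p q \<alpha> \<beta> x (vs v))"
    unfolding wedge_def by blast
  then show "linear (\<lambda>v. wedge p q \<alpha> \<beta> x (xs @ v # ys))" by (simp add: vs_def)
next
  fix vs :: "'a list" assume l: "length vs = p + q" "\<not> distinct vs"
  then obtain i j where ij: "i < p + q" "j < p + q" "i \<noteq> j" "vs ! i = vs ! j"
    by (auto simp: distinct_conv_nth)
  from sum_permutes_repeated[of i "p + q" j "\<lambda>a. vs ! a"
      "\<lambda>g. \<alpha> x (map g [0..<p]) * \<beta> x (map g [p..<p + q])", OF ij]
  show "wedge p q \<alpha> \<beta> x vs = 0" by (simp add: wedge_def mult.assoc)
qed

text \<open>Expansion along a one-form: the \<open>q!\<close> orderings of the remaining arguments agree.\<close>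

lemma wedge_one_form:
  assumes \<beta>: "alternating_map q (\<beta> x)" and l: "length vs = Suc q"
  shows "wedge 1 q \<alpha> \<beta> x vs = (\<Sum>b\<le>q. (-1) ^ b * \<alpha> x [vs ! b] * \<beta> x (omit b vs))"
proof -
  define T where "T \<pi> = of_int (sign \<pi>) * \<alpha> x (map (\<lambda>a. vs ! \<pi> a) [0..<1]) *
      \<beta> x (map (\<lambda>a. vs ! \<pi> a) [1..<1 + q])" for \<pi>
  have set: "{..<1 + q} = insert 0 {1..<1 + q}" by auto
  have T: "T (Transposition.transpose 0 b \<circ> \<sigma>) = (-1) ^ b * \<alpha> x [vs ! b] * \<beta> x (omit b vs)"
    if b: "b \<in> insert 0 {1..<1 + q}" and \<sigma>: "\<sigma> permutes {1..<1 + q}" for b \<sigma>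
  proof -
    let ?t = "Transposition.transpose 0 b"
    have \<sigma>0: "\<sigma> 0 = 0" using permutes_not_in[OF \<sigma>, of 0] by simp
    have "permutation \<sigma>" using \<sigma> permutes_imp_permutation by blast
    then have sg: "sign (?t \<circ> \<sigma>) = sign ?t * sign \<sigma>"
      by (intro sign_compose permutation_swap_id)
    have "\<beta> x (map (\<lambda>a. vs ! (?t \<circ> \<sigma>) a) [1..<1 + q]) =
        of_int (sign \<sigma>) * \<beta> x (map (\<lambda>a. vs ! ?t a) [1..<1 + q])"
      using alternating_map_permute_fun[OF \<beta> \<sigma>, of "\<lambda>a. vs ! ?t a"] by simp
    moreover have "(of_int (sign \<sigma>) :: real) * of_int (sign \<sigma>) = 1"
      by (simp add: sign_def)
    ultimately have "T (?t \<circ> \<sigma>) = of_int (sign ?t) * \<alpha> x [vs ! b] * \<beta> x (map (\<lambda>a. vs ! ?t a) [1..<1 + q])"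
      unfolding T_def sg by (simp add: \<sigma>0)
    also have "\<dots> = (-1) ^ b * \<alpha> x [vs ! b] * \<beta> x (omit b vs)"
    proof (cases b)
      case 0
      have "map (\<lambda>a. vs ! ?t a) [1..<1 + q] = omit b vs"
        using l 0 by (intro nth_equalityI) (auto simp: omit_def simp del: upt_Suc)
      then show ?thesis using 0 by simp
    next
      case (Suc j)
      obtain v vs' where vs: "vs = v # vs'" "length vs' = q" using l by (cases vs) auto
      have "map (\<lambda>a. vs ! ?t a) [1..<1 + q] = vs'[j := v]"
        using Suc vs by (intro nth_equalityI) (auto simp: Transposition.transpose_def nth_list_update simp del: upt_Suc)
      moreover have "\<beta> x (vs'[j := v]) = (-1) ^ j * \<beta> x (v # omit j vs')"
        using alternating_map_omit[OF \<beta> vs(2)] b Suc by simp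
      moreover have "omit b vs = v # omit j vs'" by (simp add: vs Suc)
      moreover have "sign ?t = -1" using Suc by (simp add: sign_swap_id)
      ultimately show ?thesis using Suc by simp
    qed
    finally show ?thesis .
  qed
  have "(\<Sum>\<pi> | \<pi> permutes {..<1 + q}. T \<pi>) =
     (\<Sum>b\<in>insert 0 {1..<1 + q}. \<Sum>\<sigma> | \<sigma> permutes {1..<1 + q}. T (Transposition.transpose 0 b \<circ> \<sigma>))"
    unfolding set by (rule sum_over_permutations_insert) auto
  also have "\<dots> = (\<Sum>b\<in>insert 0 {1..<1 + q}. fact q * ((-1) ^ b * \<alpha> x [vs ! b] * \<beta> x (omit b vs)))"
  proof (intro sum.cong refl)
    fix b assume b: "b \<in> insert 0 {1..<1 + q}"
    have "(\<Sum>\<sigma> | \<sigma> permutes {1..<1 + q}. T (Transposition.transpose 0 b \<circ> \<sigma>)) =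
       (\<Sum>\<sigma> | \<sigma> permutes {1..<1 + q}. (-1) ^ b * \<alpha> x [vs ! b] * \<beta> x (omit b vs))"
      by (intro sum.cong refl T b) simp
    also have "\<dots> = fact q * ((-1) ^ b * \<alpha> x [vs ! b] * \<beta> x (omit b vs))"
      using card_permutations[of "{1..<1 + q}" q] by (simp only: sum_constant) simp
    finally show "(\<Sum>\<sigma> | \<sigma> permutes {1..<1 + q}. T (Transposition.transpose 0 b \<circ> \<sigma>)) =
       fact q * ((-1) ^ b * \<alpha> x [vs ! b] * \<beta> x (omit b vs))" .
  qed
  also have "insert 0 {1..<1 + q} = {..q}" by auto
  finally have "(\<Sum>\<pi> | \<pi> permutes {..<1 + q}. T \<pi>) =
      fact q * (\<Sum>b\<le>q. (-1) ^ b * \<alpha> x [vs ! b] * \<beta> x (omit b vs))"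
    by (simp add: sum_distrib_left)
  then show ?thesis by (simp add: wedge_def T_def)
qed

section \<open>The commutative algebra of alternated insertions\<close>

text \<open>Inserting maps \<open>f\<^sub>1, \<dots>, f\<^sub>k\<close> into the slots of \<open>\<omega>\<close> and alternating over the arguments is
  symmetric and multilinear in the \<open>f\<^sub>i\<close>: vector-valued one-forms commute. Up to a factorial this is
  the product \<open>f\<^sub>1 \<dots> f\<^sub>k\<close> of one-forms with values in the exterior algebra, paired with \<open>\<omega>\<close>.\<close>

definition alt_insert :: "('a::real_vector list \<Rightarrow> real) \<Rightarrow> 'a list \<Rightarrow> ('a \<Rightarrow> 'a) list \<Rightarrow> real" where
  "alt_insert \<omega> vs fs = (\<Sum>\<pi> | \<pi> permutes {..<length fs}. of_int (sign \<pi>) *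
     \<omega> (map (\<lambda>a. (fs ! a) (vs ! \<pi> a)) [0..<length fs]))"

lemma map_apply_append_Cons:
  "map (\<lambda>a. ((xs @ h # ys) ! a) (u a)) [0..<length (xs @ h # ys)] =
     map (\<lambda>a. (xs ! a) (u a)) [0..<length xs] @ h (u (length xs)) #
     map (\<lambda>a. (ys ! a) (u (Suc (length xs + a)))) [0..<length ys]"
  by (intro nth_equalityI) (auto simp: nth_append nth_Cons' simp del: upt_Suc)

lemma alt_insert_add:
  assumes "alternating_map k \<omega>" "length xs + length ys + 1 = k"
  shows "alt_insert \<omega> vs (xs @ (\<lambda>v. f v + g v) # ys) =
     alt_insert \<omega> vs (xs @ f # ys) + alt_insert \<omega> vs (xs @ g # ys)"
  unfolding alt_insert_def map_apply_append_Cons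
  by (subst alternating_map_add_Cons[OF assms(1)])
    (use assms(2) in \<open>simp_all add: sum.distrib algebra_simps\<close>)

lemma sum_permutes_transpose:
  fixes h :: "(nat \<Rightarrow> nat) \<Rightarrow> real"
  assumes "i < k" "j < k" "i \<noteq> j"
  shows "(\<Sum>\<pi> | \<pi> permutes {..<k}. of_int (sign \<pi>) * h \<pi>) =
     - (\<Sum>\<pi> | \<pi> permutes {..<k}. of_int (sign \<pi>) * h (\<pi> \<circ> Transposition.transpose i j))"
proof -
  define t where "t = Transposition.transpose i j"
  have t: "t permutes {..<k}" using assms by (auto simp: t_def intro: permutes_swap_id)
  have tt: "t \<circ> t = id" by (simp add: t_def fun_eq_iff)
  have "(\<Sum>\<pi> | \<pi> permutes {..<k}. of_int (sign \<pi>) * h \<pi>) =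
     (\<Sum>\<pi> | \<pi> permutes {..<k}. - (of_int (sign \<pi>) * h (\<pi> \<circ> t)))"
  proof (rule sum.reindex_bij_witness[where i = "\<lambda>\<pi>. \<pi> \<circ> t" and j = "\<lambda>\<pi>. \<pi> \<circ> t"])
    fix \<pi> assume "\<pi> \<in> {\<pi>. \<pi> permutes {..<k}}"
    then have \<pi>: "\<pi> permutes {..<k}" by simp
    have "permutation \<pi>" "permutation t" using \<pi> t permutes_imp_permutation by blast+
    then have sg: "sign (\<pi> \<circ> t) = - sign \<pi>" using assms by (simp add: sign_compose t_def sign_swap_id)
    have e: "\<pi> \<circ> t \<circ> t = \<pi>" by (simp add: comp_assoc tt)
    show "\<pi> \<circ> t \<circ> t = \<pi>" "\<pi> \<circ> t \<circ> t = \<pi>" by (fact e)+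
    show "\<pi> \<circ> t \<in> {\<pi>. \<pi> permutes {..<k}}" "\<pi> \<circ> t \<in> {\<pi>. \<pi> permutes {..<k}}"
      using permutes_compose[OF t \<pi>] by simp_all
    show "- (of_int (sign (\<pi> \<circ> t)) * h (\<pi> \<circ> t \<circ> t)) = of_int (sign \<pi>) * h \<pi>"
      unfolding sg e by simp
  qed
  then show ?thesis by (simp add: sum_negf t_def)
qed

lemma map_apply_append_Cons2:
  "map (\<lambda>a. ((xs @ f # g # ys) ! a) (u a)) [0..<length (xs @ f # g # ys)] =
     map (\<lambda>a. (xs ! a) (u a)) [0..<length xs] @ f (u (length xs)) # g (u (Suc (length xs))) #
     map (\<lambda>a. (ys ! a) (u (Suc (Suc (length xs + a))))) [0..<length ys]"
  unfolding map_apply_append_Cons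
  using map_apply_append_Cons[of "[]" g ys "\<lambda>a. u (Suc (length xs + a))"] by simp

lemma alt_insert_swap:
  assumes "alternating_map k \<omega>" "length xs + length ys + 2 = k"
  shows "alt_insert \<omega> vs (xs @ f # g # ys) = alt_insert \<omega> vs (xs @ g # f # ys)"
proof -
  let ?i = "length xs"
  define L where "L f g \<pi> = map (\<lambda>a. (xs ! a) (vs ! \<pi> a)) [0..<?i] @ f (vs ! \<pi> ?i) # g (vs ! \<pi> (Suc ?i)) #
     map (\<lambda>a. (ys ! a) (vs ! \<pi> (Suc (Suc (?i + a))))) [0..<length ys]" for f g \<pi>
  have k: "length (xs @ f # g # ys) = k" for f g using assms(2) by simp
  have A: "alt_insert \<omega> vs (xs @ f # g # ys) = (\<Sum>\<pi> | \<pi> permutes {..<k}. of_int (sign \<pi>) * \<omega> (L f g \<pi>))" for f g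
    unfolding alt_insert_def map_apply_append_Cons2 unfolding k L_def by simp
  have B: "\<omega> (L f g (\<pi> \<circ> Transposition.transpose ?i (Suc ?i))) = - \<omega> (L g f \<pi>)" for \<pi>
  proof -
    have e: "L f g (\<pi> \<circ> Transposition.transpose ?i (Suc ?i)) =
       map (\<lambda>a. (xs ! a) (vs ! \<pi> a)) [0..<?i] @ f (vs ! \<pi> (Suc ?i)) # g (vs ! \<pi> ?i) #
       map (\<lambda>a. (ys ! a) (vs ! \<pi> (Suc (Suc (?i + a))))) [0..<length ys]"
      by (simp add: L_def Transposition.transpose_def)
    show ?thesis unfolding e unfolding L_def
      using alternating_map_swap[OF assms(1), of "map (\<lambda>a. (xs ! a) (vs ! \<pi> a)) [0..<?i]" "[]"
        "map (\<lambda>a. (ys ! a) (vs ! \<pi> (Suc (Suc (?i + a))))) [0..<length ys]"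
        "f (vs ! \<pi> (Suc ?i))" "g (vs ! \<pi> ?i)"] assms(2) by simp
  qed
  have "(\<Sum>\<pi> | \<pi> permutes {..<k}. of_int (sign \<pi>) * \<omega> (L f g \<pi>)) =
     - (\<Sum>\<pi> | \<pi> permutes {..<k}. of_int (sign \<pi>) * \<omega> (L f g (\<pi> \<circ> Transposition.transpose ?i (Suc ?i))))"
    by (rule sum_permutes_transpose) (use assms(2) in simp_all)
  also have "\<dots> = (\<Sum>\<pi> | \<pi> permutes {..<k}. of_int (sign \<pi>) * \<omega> (L g f \<pi>))"
    unfolding B by (simp add: sum_negf)
  finally show ?thesis unfolding A .
qed

lemma alt_insert_move:
  assumes "alternating_map k \<omega>" "length xs + length ys + 1 = k"
  shows "alt_insert \<omega> vs (xs @ f # ys) = alt_insert \<omega> vs (f # xs @ ys)"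
  using assms(2)
proof (induction xs arbitrary: ys rule: rev_induct)
  case (snoc x xs)
  have "alt_insert \<omega> vs ((xs @ [x]) @ f # ys) = alt_insert \<omega> vs (xs @ f # x # ys)"
    using alt_insert_swap[OF assms(1), of xs ys vs x f] snoc.prems by simp
  also have "\<dots> = alt_insert \<omega> vs (f # xs @ x # ys)"
    using snoc.IH[of "x # ys"] snoc.prems by simp
  finally show ?case by simp
qed simp

lemma alt_insert_rotate:
  assumes "alternating_map k \<omega>" "length xs + length ys + length zs = k"
  shows "alt_insert \<omega> vs (zs @ xs @ ys) = alt_insert \<omega> vs (zs @ ys @ xs)"
  using assms(2)
proof (induction ys arbitrary: zs)
  case (Cons y ys)
  have "alt_insert \<omega> vs (zs @ xs @ y # ys) = alt_insert \<omega> vs (y # zs @ xs @ ys)"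
    using alt_insert_move[OF assms(1), of "zs @ xs" ys vs y] Cons.prems by simp
  also have "\<dots> = alt_insert \<omega> vs (zs @ y # xs @ ys)"
    using alt_insert_move[OF assms(1), of "zs" "xs @ ys" vs y] Cons.prems by simp
  also have "\<dots> = alt_insert \<omega> vs ((zs @ [y]) @ ys @ xs)"
    using Cons.IH[of "zs @ [y]"] Cons.prems by simp
  finally show ?case by simp
qed simp

text \<open>Two maps of rank one with the same functional annihilate each other: exchanging the arguments fed
  into them changes the sign of the permutation, but not the value.\<close>

lemma alt_insert_rank_one_twice:
  assumes "alternating_map k \<omega>" "length fs + 2 = k"
  shows "alt_insert \<omega> vs ((\<lambda>v. \<theta> v *\<^sub>R y) # (\<lambda>v. \<theta> v *\<^sub>R z) # fs) = 0"
proof -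
  define L where "L \<pi> = (\<theta> (vs ! \<pi> 0) *\<^sub>R y) # (\<theta> (vs ! \<pi> 1) *\<^sub>R z) #
     map (\<lambda>a. (fs ! a) (vs ! \<pi> (Suc (Suc a)))) [0..<length fs]" for \<pi>
  have k: "length ([] @ f # g # fs) = k" for f g using assms(2) by simp
  have A: "alt_insert \<omega> vs ([] @ (\<lambda>v. \<theta> v *\<^sub>R y) # (\<lambda>v. \<theta> v *\<^sub>R z) # fs) =
      (\<Sum>\<pi> | \<pi> permutes {..<k}. of_int (sign \<pi>) * \<omega> (L \<pi>))"
    unfolding alt_insert_def map_apply_append_Cons2 unfolding k L_def by simp
  have B: "\<omega> (L \<pi>) = \<theta> (vs ! \<pi> 0) * \<theta> (vs ! \<pi> 1) *
     \<omega> (y # z # map (\<lambda>a. (fs ! a) (vs ! \<pi> (Suc (Suc a)))) [0..<length fs])" for \<pi>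
  proof -
    let ?m = "map (\<lambda>a. (fs ! a) (vs ! \<pi> (Suc (Suc a)))) [0..<length fs]"
    show ?thesis unfolding L_def
      using alternating_map_scale_Cons[OF assms(1), of "[]" "(\<theta> (vs ! \<pi> 1) *\<^sub>R z) # ?m" "\<theta> (vs ! \<pi> 0)" y]
        alternating_map_scale_Cons[OF assms(1), of "[y]" ?m "\<theta> (vs ! \<pi> 1)" z] assms(2) by simp
  qed
  have C: "\<omega> (L (\<pi> \<circ> Transposition.transpose 0 1)) = \<omega> (L \<pi>)" for \<pi>
    unfolding B by (simp add: Transposition.transpose_def)
  have "(\<Sum>\<pi> | \<pi> permutes {..<k}. of_int (sign \<pi>) * \<omega> (L \<pi>)) =
     - (\<Sum>\<pi> | \<pi> permutes {..<k}. of_int (sign \<pi>) * \<omega> (L \<pi>))"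
    using sum_permutes_transpose[of 0 k 1 "\<lambda>\<pi>. \<omega> (L \<pi>)"] assms(2) unfolding C by simp
  then show ?thesis using A by simp
qed

text \<open>A perturbation of rank one has only a first-order effect, by nilpotency.\<close>

lemma alt_insert_perturb:
  assumes "alternating_map k \<omega>" "length fs + m = k"
  shows "alt_insert \<omega> vs (replicate m (\<lambda>v. f v + \<theta> v *\<^sub>R y) @ fs) =
     alt_insert \<omega> vs (replicate m f @ fs) +
     real m * alt_insert \<omega> vs ((\<lambda>v. \<theta> v *\<^sub>R y) # replicate (m - 1) f @ fs)"
  using assms(2)
proof (induction m arbitrary: fs)
  case (Suc m)
  let ?d = "\<lambda>v. \<theta> v *\<^sub>R y" and ?g = "\<lambda>v. f v + \<theta> v *\<^sub>R y"
  note A = assms(1)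
  have l: "length fs + Suc m = k" by fact
  have "alt_insert \<omega> vs (replicate (Suc m) ?g @ fs) = alt_insert \<omega> vs (replicate m ?g @ ?g # fs)"
    using alt_insert_move[OF A, of "replicate m ?g" fs vs ?g] l by simp
  also have "\<dots> = alt_insert \<omega> vs (replicate m f @ ?g # fs) +
      real m * alt_insert \<omega> vs (?d # replicate (m - 1) f @ ?g # fs)"
    using Suc.IH[of "?g # fs"] l by simp
  also have "alt_insert \<omega> vs (replicate m f @ ?g # fs) =
     alt_insert \<omega> vs (replicate m f @ f # fs) + alt_insert \<omega> vs (replicate m f @ ?d # fs)"
    by (rule alt_insert_add[OF A]) (use l in simp)
  also have "alt_insert \<omega> vs (replicate m f @ f # fs) = alt_insert \<omega> vs (replicate (Suc m) f @ fs)"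
    using alt_insert_move[OF A, of "replicate m f" fs vs f] l by simp
  also have "alt_insert \<omega> vs (replicate m f @ ?d # fs) = alt_insert \<omega> vs (?d # replicate m f @ fs)"
    using alt_insert_move[OF A, of "replicate m f" fs vs ?d] l by simp
  also have "real m * alt_insert \<omega> vs (?d # replicate (m - 1) f @ ?g # fs) =
      real m * alt_insert \<omega> vs (?d # replicate m f @ fs)"
  proof (cases m)
    case (Suc m')
    have "alt_insert \<omega> vs (?d # replicate m' f @ ?g # fs) =
       alt_insert \<omega> vs ((?d # replicate m' f) @ f # fs) + alt_insert \<omega> vs ((?d # replicate m' f) @ ?d # fs)"
      using alt_insert_add[OF A, of "?d # replicate m' f" fs vs f ?d] l Suc by simp
    also have "alt_insert \<omega> vs ((?d # replicate m' f) @ ?d # fs) = alt_insert \<omega> vs (?d # ?d # replicate m' f @ fs)"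
      using alt_insert_move[OF A, of "?d # replicate m' f" fs vs ?d] l Suc by simp
    also have "\<dots> = 0"
      using alt_insert_rank_one_twice[OF A, of "replicate m' f @ fs"] l Suc by simp
    also have "(?d # replicate m' f) @ f # fs = [?d] @ replicate m' f @ f # fs" by simp
    also have "alt_insert \<omega> vs ([?d] @ replicate m' f @ f # fs) = alt_insert \<omega> vs (?d # f # replicate m' f @ fs)"
      using alt_insert_rotate[OF A, of "replicate m' f" "[f]" "[]"] 
      by (simp add: replicate_app_Cons_same)
    finally show ?thesis using Suc by simp
  qed simp
  finally show ?case by (simp add: algebra_simps)
qed simp

text \<open>Once the functional \<open>\<theta>\<close> has been used, further perturbations along it have no effect.\<close>

lemma alt_insert_absorb:
  assumes "alternating_map k \<omega>" "length fs + m + 1 = k"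
  shows "alt_insert \<omega> vs ((\<lambda>v. \<theta> v *\<^sub>R z) # replicate m (\<lambda>v. f v + \<theta> v *\<^sub>R y) @ fs) =
     alt_insert \<omega> vs ((\<lambda>v. \<theta> v *\<^sub>R z) # replicate m f @ fs)"
proof -
  let ?d = "\<lambda>v. \<theta> v *\<^sub>R z" and ?g = "\<lambda>v. f v + \<theta> v *\<^sub>R y"
  note A = assms(1)
  have "alt_insert \<omega> vs (?d # replicate m ?g @ fs) = alt_insert \<omega> vs (replicate m ?g @ ?d # fs)"
    using alt_insert_move[OF A, of "replicate m ?g" fs vs ?d] assms(2) by simp
  also have "\<dots> = alt_insert \<omega> vs (replicate m f @ ?d # fs) +
     real m * alt_insert \<omega> vs ((\<lambda>v. \<theta> v *\<^sub>R y) # replicate (m - 1) f @ ?d # fs)"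
    using alt_insert_perturb[OF A, of "?d # fs" m] assms(2) by simp
  also have "real m * alt_insert \<omega> vs ((\<lambda>v. \<theta> v *\<^sub>R y) # replicate (m - 1) f @ ?d # fs) = 0"
  proof (cases m)
    case (Suc m')
    have "alt_insert \<omega> vs (((\<lambda>v. \<theta> v *\<^sub>R y) # replicate m' f) @ ?d # fs) =
        alt_insert \<omega> vs (?d # (\<lambda>v. \<theta> v *\<^sub>R y) # replicate m' f @ fs)"
      using alt_insert_move[OF A, of "(\<lambda>v. \<theta> v *\<^sub>R y) # replicate m' f" fs vs ?d] assms(2) Suc by simp
    also have "\<dots> = 0"
      using alt_insert_rank_one_twice[OF A, of "replicate m' f @ fs"] assms(2) Suc by simp
    finally show ?thesis using Suc by simp
  qed simp
  also have "alt_insert \<omega> vs (replicate m f @ ?d # fs) = alt_insert \<omega> vs (?d # replicate m f @ fs)"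
    using alt_insert_move[OF A, of "replicate m f" fs vs ?d] assms(2) by simp
  finally show ?thesis by simp
qed

section \<open>Sorted index lists\<close>

definition sorted_lists :: "nat set \<Rightarrow> nat \<Rightarrow> nat list set" where
  "sorted_lists A s = {K. sorted_wrt (<) K \<and> set K \<subseteq> A \<and> length K = s}"

lemma finite_sorted_lists: "finite A \<Longrightarrow> finite (sorted_lists A s)"
  by (rule finite_subset[OF _ finite_lists_length_eq[of A s]]) (auto simp: sorted_lists_def)

text \<open>A sorted list contains a lower bound of all entries only as its head.\<close>

lemma sorted_lists_insert_min:
  assumes "\<And>a. a \<in> A \<Longrightarrow> i < a"
  shows "sorted_lists (insert i A) (Suc s) = sorted_lists A (Suc s) \<union> (#) i ` sorted_lists A s"
proof (intro set_eqI iffI)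
  fix K assume K: "K \<in> sorted_lists (insert i A) (Suc s)"
  then obtain j K' where K': "K = j # K'" by (cases K) (auto simp: sorted_lists_def)
  have "set K' \<subseteq> A"
  proof
    fix a assume a: "a \<in> set K'"
    then have "j < a" "a \<in> insert i A" "j \<in> insert i A" using K K' by (auto simp: sorted_lists_def)
    then show "a \<in> A" using assms by fastforce
  qed
  then show "K \<in> sorted_lists A (Suc s) \<union> (#) i ` sorted_lists A s"
    using K K' by (auto simp: sorted_lists_def)
next
  fix K assume "K \<in> sorted_lists A (Suc s) \<union> (#) i ` sorted_lists A s"
  then show "K \<in> sorted_lists (insert i A) (Suc s)"
    using assms by (fastforce simp: sorted_lists_def)
qed

text \<open>Removing one entry from a sorted list and remembering it loses no information.\<close>

lemma sum_omit_reindex: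
  fixes f :: "nat \<Rightarrow> nat list \<Rightarrow> real"
  assumes "finite A"
  shows "(\<Sum>J\<in>sorted_lists A (Suc s). \<Sum>i<Suc s. f (J ! i) (omit i J)) =
    (\<Sum>a\<in>A. \<Sum>K\<in>sorted_lists (A - {a}) s. f a K)"
proof -
  define ins where "ins a K = filter (\<lambda>x. x < a) K @ a # filter (\<lambda>x. a < x) K" for a :: nat and K
  have spl: "filter (\<lambda>x. x < a) K @ filter (\<lambda>x. a < x) K = K"
    if "sorted_wrt (<) K" "a \<notin> set K" for a :: nat and K
    using that
  proof (induction K)
    case (Cons x K)
    show ?case
    proof (cases "x < a")
      case False
      then have "filter (\<lambda>x. x < a) K = []" "filter (\<lambda>x. a < x) K = K" "a < x"
        using Cons.prems by (auto simp: filter_empty_conv filter_id_conv)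
      then show ?thesis by simp
    qed (use Cons in simp)
  qed simp
  have "(\<Sum>J\<in>sorted_lists A (Suc s). \<Sum>i<Suc s. f (J ! i) (omit i J)) =
     (\<Sum>(J, i)\<in>sorted_lists A (Suc s) \<times> {..<Suc s}. f (J ! i) (omit i J))"
    by (rule sum.cartesian_product)
  also have "\<dots> = (\<Sum>(a, K)\<in>Sigma A (\<lambda>a. sorted_lists (A - {a}) s). f a K)"
  proof (rule sum.reindex_bij_witness[where i = "\<lambda>(a, K). (ins a K, length (filter (\<lambda>x. x < a) K))"
        and j = "\<lambda>(J, i). (J ! i, omit i J)"])
    fix p assume "p \<in> sorted_lists A (Suc s) \<times> {..<Suc s}"
    then obtain J i where p: "p = (J, i)" "J \<in> sorted_lists A (Suc s)" "i < Suc s" by auto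
    define xs a ys where "xs = take i J" and "a = J ! i" and "ys = drop (Suc i) J"
    have J: "J = xs @ a # ys" "length xs = i" "omit i J = xs @ ys"
      using p by (auto simp: xs_def a_def ys_def sorted_lists_def id_take_nth_drop omit_def)
    have srt: "\<forall>x\<in>set xs. x < a" "\<forall>y\<in>set ys. a < y" "sorted_wrt (<) (xs @ ys)" "set (xs @ ys) \<subseteq> A - {a}" "a \<in> A"
      "length (xs @ ys) = s"
      using p(2) unfolding J(1) by (fastforce simp: sorted_lists_def sorted_wrt_append)+
    have fl: "filter (\<lambda>x. x < a) (xs @ ys) = xs" "filter (\<lambda>x. a < x) (xs @ ys) = ys"
      using srt(1,2) by (auto simp: filter_empty_conv filter_id_conv)
    have Ji: "(xs @ a # ys) ! i = a" using J(2) by (simp add: nth_append)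
    show "(case (case p of (J, i) \<Rightarrow> (J ! i, omit i J)) of (a, K) \<Rightarrow> (ins a K, length (filter (\<lambda>x. x < a) K))) = p"
      using p(1) J fl by (simp add: ins_def Ji)
    show "(case p of (J, i) \<Rightarrow> (J ! i, omit i J)) \<in> Sigma A (\<lambda>a. sorted_lists (A - {a}) s)"
      using p(1) J srt by (simp add: Ji sorted_lists_def)
    show "(case (case p of (J, i) \<Rightarrow> (J ! i, omit i J)) of (a, K) \<Rightarrow> f a K) = (case p of (J, i) \<Rightarrow> f (J ! i) (omit i J))"
      using p(1) by simp
  next
    fix p assume "p \<in> Sigma A (\<lambda>a. sorted_lists (A - {a}) s)"
    then obtain a K where p: "p = (a, K)" "a \<in> A" "sorted_wrt (<) K" "set K \<subseteq> A - {a}" "length K = s"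
      by (auto simp: sorted_lists_def)
    define xs ys where "xs = filter (\<lambda>x. x < a) K" and "ys = filter (\<lambda>x. a < x) K"
    have "a \<notin> set K" using p(4) by blast
    then have K: "K = xs @ ys" using spl[of K a] p(3) by (simp add: xs_def ys_def)
    have le: "length xs + length ys = s" using p(5) K by simp
    have w: "\<forall>x\<in>set xs. x < a" "\<forall>y\<in>set ys. a < y" "set xs \<subseteq> A" "set ys \<subseteq> A"
      using p(4) by (auto simp: xs_def ys_def)
    have s: "sorted_wrt (<) (xs @ a # ys)"
      using p(3) w unfolding K by (auto simp: sorted_wrt_append)
    have i: "ins a K = xs @ a # ys" by (simp add: ins_def xs_def ys_def)
    show "(case p of (a, K) \<Rightarrow> (ins a K, length (filter (\<lambda>x. x < a) K))) \<in> sorted_lists A (Suc s) \<times> {..<Suc s}"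
      using p(1,2) i s w le by (simp add: xs_def[symmetric] sorted_lists_def)
    show "(case (case p of (a, K) \<Rightarrow> (ins a K, length (filter (\<lambda>x. x < a) K))) of (J, i) \<Rightarrow> (J ! i, omit i J)) = p"
      unfolding p(1) prod.case i xs_def[symmetric] by (simp add: omit_def K)
  qed
  also have "\<dots> = (\<Sum>a\<in>A. \<Sum>K\<in>sorted_lists (A - {a}) s. f a K)"
    using assms by (subst sum.Sigma) (auto intro: finite_sorted_lists)
  finally show ?thesis .
qed

section \<open>The operators on constant forms\<close>

text \<open>The coefficients satisfy \<open>a\<^sub>s\<^sub>+\<^sub>1 (n - s - 1) = - a\<^sub>s (k - s)\<close>, so the part of one summand with \<open>z s\<close> cancels
  against the part of the next.\<close>

lemma telescoping_coefficients:
  fixes z :: "nat \<Rightarrow> real"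
  assumes "k \<le> n - 1" "n \<ge> 1"
  shows "real k * z 0 / fact k + (\<Sum>s=1..k. (-1) ^ (1 + s) / ((\<Prod>r=1..s. real n - real r) * fact (k - s)) *
      ((real n - real s) * (real (k - s) * z s - real s * z (s - 1)) - real (k - s) * (real n + 1) * z s)) = 0"
proof -
  define P where "P s = (\<Prod>r=1..s. real n - real r)" for s
  have P0: "P s \<noteq> 0" if "s \<le> k" for s
    unfolding P_def using that assms by (auto simp: prod_zero_iff)
  have PS: "P (Suc s) = P s * (real n - real (Suc s))" for s by (simp add: P_def)
  \<comment> \<open>minus the part of summand \<open>s\<close> that contains \<open>z (s - 1)\<close>\<close>
  define h where "h s = (if s \<le> k then (-1) ^ (1 + s) * real s * z (s - 1) / (P (s - 1) * fact (k - s)) else 0)" for s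
  have step: "(-1) ^ (1 + s) / (P s * fact (k - s)) *
      ((real n - real s) * (real (k - s) * z s - real s * z (s - 1)) - real (k - s) * (real n + 1) * z s) =
      h (Suc s) - h s" if s: "1 \<le> s" "s \<le> k" for s
  proof -
    have e1: "(real n - real s) * (real (k - s) * z s - real s * z (s - 1)) - real (k - s) * (real n + 1) * z s =
       - (real (k - s) * (real s + 1) * z s) - (real n - real s) * real s * z (s - 1)"
      by (simp add: algebra_simps)
    have e2: "(-1) ^ (1 + s) / (P s * fact (k - s)) * ((real n - real s) * real s * z (s - 1)) = h s"
    proof -
      obtain j where j: "s = Suc j" using s by (cases s) auto
      have "real n - real s \<noteq> 0" "P j \<noteq> 0" using s assms P0[of j] j by auto
      then show ?thesis using s by (simp add: h_def j PS)
    qed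
    have e3: "(-1) ^ (1 + s) / (P s * fact (k - s)) * - (real (k - s) * (real s + 1) * z s) = h (Suc s)"
    proof (cases "s = k")
      case False
      then obtain d where d: "k - s = Suc d" "k - Suc s = d" using s by (metis Suc_diff_Suc le_neq_implies_less)
      define D where "D = real (Suc d)"
      have D: "fact (k - s) = D * (fact d :: real)" "real (k - s) = D" "D \<noteq> 0"
        unfolding d(1) D_def fact_Suc by simp_all
      show ?thesis unfolding D(1,2) using s False P0[OF s(2)] D(3) by (simp add: h_def d(2) field_simps)
    qed (simp add: h_def)
    show ?thesis unfolding e1 by (rule trans[OF right_diff_distrib]) (simp only: e2 e3)
  qed
  have "(\<Sum>s=1..k. (-1) ^ (1 + s) / (P s * fact (k - s)) *
      ((real n - real s) * (real (k - s) * z s - real s * z (s - 1)) - real (k - s) * (real n + 1) * z s)) =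
     (\<Sum>s=1..k. h (Suc s) - h s)"
    by (intro sum.cong refl step) auto
  also have "\<dots> = h (Suc k) - h 1"
    using sum_Suc_diff[of 1 k h] by (cases k) (simp_all add: h_def)
  also have "\<dots> = - (real k * z 0 / fact k)"
  proof (cases k)
    case (Suc j)
    then have "(fact k :: real) = real k * fact j" "k - 1 = j" "real k \<noteq> 0" by (simp_all only: fact_Suc)
    then show ?thesis by (simp add: h_def P_def)
  qed (simp add: h_def)
  finally show ?thesis by (simp add: P_def)
qed

context nondeg_simplex
begin

lemma alternating_dbary: "alternating_map 1 (dbary X i x)"
proof (rule alternating_mapI)
  fix xs ys :: "'a list" assume "length xs + length ys + 1 = 1"
  then show "linear (\<lambda>v. dbary X i x (xs @ v # ys))" using linear_dl[of i] by (simp add: dbary_eq)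
qed (auto simp: length_Suc_conv)

lemma alternating_dbary_wedge: "alternating_map (length K) (dbary_wedge X K x)"
proof (induction K)
  case (Cons j K)
  then show ?case using alternating_wedge[OF alternating_dbary] by simp
qed (simp add: alternating_map_def)

lemma dbary_wedge_const: "dbary_wedge X K x vs = dbary_wedge X K y vs"
proof (induction K arbitrary: vs)
  case (Cons j K)
  have "dbary_wedge X K x = dbary_wedge X K y" using Cons.IH by blast
  then show ?case by (simp add: wedge_def dbary_eq)
qed simp

lemma dbary_wedge_Cons:
  assumes "length vs = Suc (length K)"
  shows "dbary_wedge X (j # K) x vs = (\<Sum>b\<le>length K. (-1) ^ b * dl j (vs ! b) * dbary_wedge X K x (omit b vs))"
  using wedge_one_form[OF alternating_dbary_wedge assms] by (simp add: dbary_eq)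

text \<open>This is the Cauchy-Binet formula for the map with components \<open>dl i\<close>: expanding
  \<open>h\<close> over a spanning family collects the minors \<open>d\<lambda>\<^sub>K\<close>.\<close>

lemma cauchy_binet:
  assumes "finite A" "alternating_map s h" "length ws = s"
  shows "(\<Sum>K\<in>sorted_lists A s. dbary_wedge X K x ws * h (map y K)) =
    h (map (\<lambda>w. \<Sum>i\<in>A. dl i w *\<^sub>R y i) ws)"
  using assms
proof (induction A arbitrary: s h ws rule: finite_linorder_min_induct)
  case empty
  show ?case
  proof (cases ws)
    case Nil
    have "sorted_lists {} 0 = {[]}" by (auto simp: sorted_lists_def)
    then show ?thesis using Nil empty by simp
  next
    case (Cons w ws')
    have "sorted_lists {} s = {}" using Cons empty(2) by (auto simp: sorted_lists_def)
    moreover have "h (0 # map (\<lambda>w. 0) ws') = 0"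
      using linear_0[OF alternating_map_linear[OF empty(1), of "[]" "map (\<lambda>w. 0) ws'"]] Cons empty(2)
      by simp
    ultimately show ?thesis using Cons by simp
  qed
next
  case (insert i A)
  let ?\<eta> = "\<lambda>w. \<Sum>i\<in>A. dl i w *\<^sub>R y i"
  have iA: "i \<notin> A" using insert.hyps by auto
  show ?case
  proof (cases s)
    case 0
    have "sorted_lists (insert i A) 0 = {[]}" by (auto simp: sorted_lists_def)
    then show ?thesis using 0 insert.prems by simp
  next
    case (Suc m)
    note alt = insert.prems(1)[unfolded Suc]
    have l: "length ws = Suc m" using insert.prems Suc by simp
    have sl: "sorted_lists (insert i A) (Suc m) = sorted_lists A (Suc m) \<union> (#) i ` sorted_lists A m"
      by (rule sorted_lists_insert_min) (use insert.hyps in blast)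
    have "(\<Sum>K\<in>sorted_lists (insert i A) s. dbary_wedge X K x ws * h (map y K)) =
        (\<Sum>K\<in>sorted_lists A s. dbary_wedge X K x ws * h (map y K)) +
        (\<Sum>K\<in>(#) i ` sorted_lists A m. dbary_wedge X K x ws * h (map y K))"
      unfolding Suc sl
    proof (rule sum.union_disjoint)
      show "sorted_lists A (Suc m) \<inter> (#) i ` sorted_lists A m = {}"
        using iA by (auto simp: sorted_lists_def)
    qed (use insert.hyps in \<open>auto intro: finite_sorted_lists\<close>)
    also have "(\<Sum>K\<in>sorted_lists A s. dbary_wedge X K x ws * h (map y K)) = h (map ?\<eta> ws)"
      by (rule insert.IH[OF insert.prems])
    also have "(\<Sum>K\<in>(#) i ` sorted_lists A m. dbary_wedge X K x ws * h (map y K)) =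
        (\<Sum>K\<in>sorted_lists A m. dbary_wedge X (i # K) x ws * h (y i # map y K))"
      by (subst sum.reindex) (auto simp: inj_on_def)
    also have "\<dots> = (\<Sum>K\<in>sorted_lists A m. \<Sum>b\<le>m. (-1) ^ b * dl i (ws ! b) *
        (dbary_wedge X K x (omit b ws) * h (y i # map y K)))"
      using l by (intro sum.cong refl, subst dbary_wedge_Cons)
        (auto simp: sorted_lists_def sum_distrib_right mult.assoc)
    also have "\<dots> = (\<Sum>b\<le>m. (-1) ^ b * dl i (ws ! b) *
        (\<Sum>K\<in>sorted_lists A m. dbary_wedge X K x (omit b ws) * h (y i # map y K)))"
      by (subst sum.swap) (simp add: sum_distrib_left)
    also have "\<dots> = (\<Sum>b\<le>m. dl i (ws ! b) * h ((map ?\<eta> ws)[b := y i]))"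
    proof (intro sum.cong refl)
      fix b assume b: "b \<in> {..m}"
      have "(\<Sum>K\<in>sorted_lists A m. dbary_wedge X K x (omit b ws) * h (y i # map y K)) =
          h (y i # map ?\<eta> (omit b ws))"
        using insert.IH[OF alternating_map_Cons[OF alt, of "y i"], of "omit b ws"] l b by simp
      moreover have "h ((map ?\<eta> ws)[b := y i]) = (-1) ^ b * h (y i # omit b (map ?\<eta> ws))"
        using alternating_map_omit[OF alt, of "map ?\<eta> ws" b] l b by simp
      ultimately show "(-1) ^ b * dl i (ws ! b) *
        (\<Sum>K\<in>sorted_lists A m. dbary_wedge X K x (omit b ws) * h (y i # map y K)) =
        dl i (ws ! b) * h ((map ?\<eta> ws)[b := y i])"
        by (simp add: map_omit)
    qed
    also have "h (map ?\<eta> ws) + \<dots> = h (map (\<lambda>w. ?\<eta> w + dl i w *\<^sub>R y i) ws)"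
      using alternating_map_rank_one[OF insert.prems, of ?\<eta> "dl i" "y i"] Suc
      by (simp add: lessThan_Suc_atMost)
    also have "(\<lambda>w. ?\<eta> w + dl i w *\<^sub>R y i) = (\<lambda>w. \<Sum>i\<in>insert i A. dl i w *\<^sub>R y i)"
      using iA insert.hyps(1) by (simp add: add.commute)
    finally show ?thesis .
  qed
qed

text \<open>The differential of \<open>\<Sum>\<^sub>i\<^sub>\<in>\<^sub>I \<lambda>\<^sub>i (x\<^sub>i - x\<^sub>a)\<close>, a vector-valued one-form.\<close>

definition eta :: "nat set \<Rightarrow> nat \<Rightarrow> 'a \<Rightarrow> 'a" where
  "eta I a v = (\<Sum>i\<in>I. dl i v *\<^sub>R (X i - X a))"

text \<open>The sum over all index sets of the minors \<open>d\<lambda>\<^sub>K\<close> turns into a product of copies of \<open>eta\<close>. The sign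
  moves the first \<open>s\<close> arguments in front, where \<open>alt_insert\<close> expects them.\<close>

lemma sum_wedge_dbary:
  assumes \<omega>: "alternating_map k \<omega>" and s: "s \<le> k" and I: "finite I" and vs: "length vs = k"
  shows "(\<Sum>K\<in>sorted_lists (I - {a}) s.
      wedge s (k - s) (dbary_wedge X K) (\<lambda>_ ws. \<omega> (map G ws @ map (\<lambda>j. X j - X a) K)) x vs) =
    (-1) ^ (s * (k - s)) / (fact s * fact (k - s)) *
      alt_insert \<omega> vs (replicate s (eta I a) @ replicate (k - s) G)"
proof -
  have eta: "eta I a = (\<lambda>w. \<Sum>i\<in>I - {a}. dl i w *\<^sub>R (X i - X a))"
  proof
    fix w
    show "eta I a w = (\<Sum>i\<in>I - {a}. dl i w *\<^sub>R (X i - X a))"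
      unfolding eta_def by (intro sum.mono_neutral_right) (use I in auto)
  qed
  let ?A = "\<lambda>\<pi>. map (\<lambda>b. vs ! \<pi> b) [0..<s]" and ?B = "\<lambda>\<pi>. map (\<lambda>b. vs ! \<pi> b) [s..<k]"
  have sk: "s + (k - s) = k" using s by simp
  have "(\<Sum>K\<in>sorted_lists (I - {a}) s.
      wedge s (k - s) (dbary_wedge X K) (\<lambda>_ ws. \<omega> (map G ws @ map (\<lambda>j. X j - X a) K)) x vs) =
      (\<Sum>K\<in>sorted_lists (I - {a}) s. \<Sum>\<pi> | \<pi> permutes {..<k}. of_int (sign \<pi>) *
        (dbary_wedge X K x (?A \<pi>) * \<omega> (map G (?B \<pi>) @ map (\<lambda>j. X j - X a) K))) / (fact s * fact (k - s))"
    unfolding wedge_def sk by (simp add: sum_divide_distrib mult.assoc)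
  also have "(\<Sum>K\<in>sorted_lists (I - {a}) s. \<Sum>\<pi> | \<pi> permutes {..<k}. of_int (sign \<pi>) *
        (dbary_wedge X K x (?A \<pi>) * \<omega> (map G (?B \<pi>) @ map (\<lambda>j. X j - X a) K))) =
     (\<Sum>\<pi> | \<pi> permutes {..<k}. of_int (sign \<pi>) *
        (\<Sum>K\<in>sorted_lists (I - {a}) s. dbary_wedge X K x (?A \<pi>) * \<omega> (map G (?B \<pi>) @ map (\<lambda>j. X j - X a) K)))"
    by (subst sum.swap) (simp add: sum_distrib_left)
  also have "\<dots> = (\<Sum>\<pi> | \<pi> permutes {..<k}. of_int (sign \<pi>) * \<omega> (map G (?B \<pi>) @ map (eta I a) (?A \<pi>)))"
  proof (intro sum.cong refl arg_cong2[of _ _ _ _ "(*)"])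
    fix \<pi>
    have "alternating_map s (\<lambda>zs. \<omega> (map G (?B \<pi>) @ zs @ []))"
      by (rule alternating_map_append[OF \<omega>]) (use s in simp)
    then have alt: "alternating_map s (\<lambda>zs. \<omega> (map G (?B \<pi>) @ zs))" by simp
    show "(\<Sum>K\<in>sorted_lists (I - {a}) s. dbary_wedge X K x (?A \<pi>) * \<omega> (map G (?B \<pi>) @ map (\<lambda>j. X j - X a) K)) =
       \<omega> (map G (?B \<pi>) @ map (eta I a) (?A \<pi>))"
      unfolding eta by (rule cauchy_binet[OF _ alt]) (use I in simp_all)
  qed
  also have "\<dots> = (\<Sum>\<pi> | \<pi> permutes {..<k}. (-1) ^ (s * (k - s)) * (of_int (sign \<pi>) * 
      \<omega> (map (\<lambda>b. ((replicate s (eta I a) @ replicate (k - s) G) ! b) (vs ! \<pi> b)) [0..<k])))"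
  proof (intro sum.cong refl)
    fix \<pi>
    have "map (\<lambda>b. ((replicate s (eta I a) @ replicate (k - s) G) ! b) (vs ! \<pi> b)) [0..<k] =
        map (eta I a) (?A \<pi>) @ map G (?B \<pi>)"
      using s by (intro nth_equalityI) (auto simp: nth_append)
    moreover have "\<omega> (map G (?B \<pi>) @ map (eta I a) (?A \<pi>)) =
       (-1) ^ ((k - s) * s) * \<omega> (map (eta I a) (?A \<pi>) @ map G (?B \<pi>))"
      using alternating_map_move_block[OF \<omega>, of "map G (?B \<pi>)" "map (eta I a) (?A \<pi>)"] s by simp
    ultimately show "of_int (sign \<pi>) * \<omega> (map G (?B \<pi>) @ map (eta I a) (?A \<pi>)) =
      (-1) ^ (s * (k - s)) * (of_int (sign \<pi>) * 
      \<omega> (map (\<lambda>b. ((replicate s (eta I a) @ replicate (k - s) G) ! b) (vs ! \<pi> b)) [0..<k]))"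
      by (simp only: mult.commute mult.left_commute)
  qed
  also have "\<dots> = (-1) ^ (s * (k - s)) * alt_insert \<omega> vs (replicate s (eta I a) @ replicate (k - s) G)"
    using s by (simp add: alt_insert_def sum_distrib_left)
  finally show ?thesis by simp
qed

text \<open>This is \<open>A\<^sub>I\<^sub>J\<close>, without its factor \<open>\<lambda>\<^sub>I\<^sup>s\<close>, on the constant form \<open>\<omega>\<close>: there the integral over a
  simplex \<open>[x\<^sub>K]\<close> equals \<open>\<omega>\<close> on its edge vectors, taken from the first vertex, over \<open>s!\<close>.\<close>

definition stationaryA :: "nat \<Rightarrow> nat set \<Rightarrow> nat list \<Rightarrow> ('a list \<Rightarrow> real) \<Rightarrow> 'a list \<Rightarrow> real" where
  "stationaryA k I J \<omega> ws = (let s = length J - 1 in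
     if s = 0 then \<omega> (map (dF I (X (J ! 0))) ws)
     else c_coeff DIM('a) k s * (\<Sum>p\<in>{..DIM('a)} - set J. \<Sum>i=0..s. (-1) ^ i *
        (\<omega> (map (dF I (X p)) ws @ map (\<lambda>j. X j - X p) (omit i J)) / fact s)))"

text \<open>The contribution of \<open>J\<close>, seen from its vertex \<open>a\<close>, with \<open>K\<close> the remaining vertices. The sum over the
  vertices outside \<open>J\<close> is written as the sum over all vertices minus \<open>s + 1\<close> equal terms.\<close>

definition stationaryT :: "nat \<Rightarrow> nat set \<Rightarrow> ('a list \<Rightarrow> real) \<Rightarrow> nat \<Rightarrow> nat list \<Rightarrow> 'a list \<Rightarrow> real" where
  "stationaryT k I \<omega> a K ws = (if K = [] then \<omega> (map (dF I (X a)) ws)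
     else c_coeff DIM('a) k (length K) / fact (length K) *
      ((\<Sum>p\<le>DIM('a). \<omega> (map (dF I (X p)) ws @ map (\<lambda>j. X j - X a) K)) -
       (real (length K) + 1) * \<omega> (map (dF I (X a)) ws @ map (\<lambda>j. X j - X a) K)))"

text \<open>The facets with apex \<open>p\<close> of the simplex \<open>{p, J}\<close> add up to its base, by \<open>alternating_sum_omit\<close>. The terms
  with \<open>p\<close> in \<open>J\<close> agree, since moving \<open>p\<close> inside \<open>J\<close> changes the derivative only along the face.\<close>

lemma stationaryA_eq:
  assumes \<omega>: "alternating_map k \<omega>" and J: "length J = Suc s" "distinct J" "set J \<subseteq> {..DIM('a)}"
    and i: "i \<le> s" and ws: "length ws + s = k"
  shows "(-1) ^ i * stationaryA k I J \<omega> ws = stationaryT k I \<omega> (J ! i) (omit i J) ws"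
proof (cases "s = 0")
  case True
  then obtain j where "J = [j]" using J(1) by (auto simp: length_Suc_conv)
  then show ?thesis using True i by (simp add: stationaryA_def stationaryT_def)
next
  case False
  define a K where "a = J ! i" and "K = omit i J"
  have K: "length K = s" "K \<noteq> []" using J i False by (auto simp: K_def dest: arg_cong[of _ _ length])
  have Jsp: "J = take i J @ a # drop (Suc i) J" using J(1) i by (simp add: a_def id_take_nth_drop)
  have setJ: "set J = insert a (set K)" by (subst Jsp) (auto simp: K_def omit_def)
  have alt: "alternating_map s (\<lambda>zs. \<omega> (us @ zs))" if "length us + s = k" for us
    using alternating_map_append[OF \<omega>, of us s "[]"] that by simp
  define S where "S p = (\<Sum>m=0..s. (-1) ^ m * (\<omega> (map (dF I (X p)) ws @ map (\<lambda>j. X j - X p) (omit m J)) / fact s))" for p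
  have "(-1) ^ i * S p =
      \<omega> (map (dF I (X p)) ws @ map (\<lambda>j. X j - X a) K) / fact s" for p
  proof -
    let ?bs = "map (\<lambda>j. X j - X p) J"
    have "(\<Sum>m\<le>s. (-1) ^ m * \<omega> (map (dF I (X p)) ws @ omit m ?bs)) =
        (-1) ^ i * \<omega> (map (dF I (X p)) ws @ map (\<lambda>b. b - ?bs ! i) (omit i ?bs))"
      by (rule alternating_sum_omit[OF alt]) (use ws J i in simp_all)
    moreover have "map (\<lambda>b. b - ?bs ! i) (omit i ?bs) = map (\<lambda>j. X j - X a) K"
      using J(1) i by (simp add: map_omit[symmetric] K_def a_def)
    ultimately have "(-1) ^ i * (\<Sum>m\<le>s. (-1) ^ m * \<omega> (map (dF I (X p)) ws @ omit m ?bs)) =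
        \<omega> (map (dF I (X p)) ws @ map (\<lambda>j. X j - X a) K)"
      by (simp flip: power_add mult.assoc)
    moreover have "S p =
        (\<Sum>m\<le>s. (-1) ^ m * \<omega> (map (dF I (X p)) ws @ omit m ?bs)) / fact s"
      by (simp add: S_def atLeast0AtMost sum_divide_distrib map_omit)
    ultimately show ?thesis by simp
  qed
  moreover have "stationaryA k I J \<omega> ws = c_coeff DIM('a) k s * (\<Sum>p\<in>{..DIM('a)} - set J. S p)"
    using False J(1) by (simp add: stationaryA_def Let_def S_def)
  then have "(-1) ^ i * stationaryA k I J \<omega> ws = c_coeff DIM('a) k s * (\<Sum>p\<in>{..DIM('a)} - set J. (-1) ^ i * S p)"
    by (simp add: sum_distrib_left mult.left_commute)
  ultimately have "(-1) ^ i * stationaryA k I J \<omega> ws = c_coeff DIM('a) k s * (\<Sum>p\<in>{..DIM('a)} - set J.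
      \<omega> (map (dF I (X p)) ws @ map (\<lambda>j. X j - X a) K) / fact s)"
    by simp
  also have "\<dots> = c_coeff DIM('a) k s / fact s * (\<Sum>p\<in>{..DIM('a)} - set J.
      \<omega> (map (dF I (X p)) ws @ map (\<lambda>j. X j - X a) K))"
    by (simp add: sum_divide_distrib[symmetric])
  also have "(\<Sum>p\<in>{..DIM('a)} - set J. \<omega> (map (dF I (X p)) ws @ map (\<lambda>j. X j - X a) K)) =
     (\<Sum>p\<le>DIM('a). \<omega> (map (dF I (X p)) ws @ map (\<lambda>j. X j - X a) K)) -
     (\<Sum>p\<in>set J. \<omega> (map (dF I (X p)) ws @ map (\<lambda>j. X j - X a) K))"
    using J(3) by (simp add: sum_diff)
  also have "(\<Sum>p\<in>set J. \<omega> (map (dF I (X p)) ws @ map (\<lambda>j. X j - X a) K)) =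
     (\<Sum>p\<in>set J. \<omega> (map (dF I (X a)) ws @ map (\<lambda>j. X j - X a) K))"
  proof (intro sum.cong refl)
    fix p assume p: "p \<in> set J"
    have sp: "X p - X a \<in> span (set (map (\<lambda>j. X j - X a) K))"
    proof (cases "p = a")
      case False
      then show ?thesis using p setJ by (intro span_base) auto
    qed (simp add: span_zero)
    show "\<omega> (map (dF I (X p)) ws @ map (\<lambda>j. X j - X a) K) = \<omega> (map (dF I (X a)) ws @ map (\<lambda>j. X j - X a) K)"
      by (rule alternating_map_shift[OF \<omega>]) (use ws K sp in \<open>auto simp: dF_shift intro!: span_scale\<close>)
  qed
  also have "\<dots> = (real s + 1) * \<omega> (map (dF I (X a)) ws @ map (\<lambda>j. X j - X a) K)"
    using distinct_card[OF J(2)] J(1) by simp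
  finally show ?thesis unfolding a_def[symmetric] K_def[symmetric] using K by (simp add: stationaryT_def)
qed

text \<open>The coefficient of \<open>\<lambda>\<^sub>a\<close> after expanding the Whitney forms.\<close>

definition vertex_coeff :: "nat \<Rightarrow> nat set \<Rightarrow> ('a list \<Rightarrow> real) \<Rightarrow> 'a list \<Rightarrow> nat \<Rightarrow> real" where
  "vertex_coeff k I \<omega> vs a = (\<Sum>s=0..k. \<Sum>K\<in>sorted_lists (I - {a}) s.
     wedge s (k - s) (dbary_wedge X K) (\<lambda>_. stationaryT k I \<omega> a K) 0 vs)"

lemma vertex_coeff_alt_insert:
  assumes \<omega>: "alternating_map k \<omega>" and I: "finite I" and vs: "length vs = k"
  shows "vertex_coeff k I \<omega> vs a = alt_insert \<omega> vs (replicate k (dF I (X a))) / fact k +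
    (\<Sum>s=1..k. (-1) ^ (1 + s) / ((\<Prod>r=1..s. real DIM('a) - real r) * fact (k - s)) *
      ((\<Sum>p\<le>DIM('a). alt_insert \<omega> vs (replicate s (eta I a) @ replicate (k - s) (dF I (X p)))) -
       (real s + 1) * alt_insert \<omega> vs (replicate s (eta I a) @ replicate (k - s) (dF I (X a)))))"
proof -
  let ?W = "\<lambda>s K G. wedge s (k - s) (dbary_wedge X K) (\<lambda>_ ws. \<omega> (map G ws @ map (\<lambda>j. X j - X a) K)) 0 vs"
  let ?Om = "\<lambda>s G. alt_insert \<omega> vs (replicate s (eta I a) @ replicate (k - s) G)"
  have W: "(\<Sum>K\<in>sorted_lists (I - {a}) s. ?W s K G) =
    (-1) ^ (s * (k - s)) / (fact s * fact (k - s)) * ?Om s G" if "s \<le> k" for s G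
    by (rule sum_wedge_dbary[OF \<omega> that I vs])
  have s0: "(\<Sum>K\<in>sorted_lists (I - {a}) 0. wedge 0 (k - 0) (dbary_wedge X K) (\<lambda>_. stationaryT k I \<omega> a K) 0 vs) =
     alt_insert \<omega> vs (replicate k (dF I (X a))) / fact k"
  proof -
    have "sorted_lists (I - {a}) 0 = {[]}" by (auto simp: sorted_lists_def)
    then show ?thesis using W[of 0 "dF I (X a)"] by (simp add: stationaryT_def[abs_def])
  qed
  have step: "(\<Sum>K\<in>sorted_lists (I - {a}) s. wedge s (k - s) (dbary_wedge X K) (\<lambda>_. stationaryT k I \<omega> a K) 0 vs) =
     (-1) ^ (1 + s) / ((\<Prod>r=1..s. real DIM('a) - real r) * fact (k - s)) *
      ((\<Sum>p\<le>DIM('a). ?Om s (dF I (X p))) - (real s + 1) * ?Om s (dF I (X a)))"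
    if s: "s \<in> {1..k}" for s
  proof -
    let ?c = "c_coeff DIM('a) k s / fact s"
    have "wedge s (k - s) (dbary_wedge X K) (\<lambda>_. stationaryT k I \<omega> a K) 0 vs =
       ?c * ((\<Sum>p\<le>DIM('a). ?W s K (dF I (X p))) - (real s + 1) * ?W s K (dF I (X a)))"
      if K: "K \<in> sorted_lists (I - {a}) s" for K
    proof -
      have K': "K \<noteq> []" "length K = s" using K s by (auto simp: sorted_lists_def)
      define d where "d \<pi> = of_int (sign \<pi>) * dbary_wedge X K 0 (map (\<lambda>b. vs ! \<pi> b) [0..<s])" for \<pi>
      define e where "e \<pi> G = \<omega> (map G (map (\<lambda>b. vs ! \<pi> b) [s..<s + (k - s)]) @ map (\<lambda>j. X j - X a) K)" for \<pi> G
      have Wd: "?W s K G = (\<Sum>\<pi> | \<pi> permutes {..<s + (k - s)}. d \<pi> * e \<pi> G) / (fact s * fact (k - s))" for G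
        by (simp only: wedge_def d_def e_def)
      have "wedge s (k - s) (dbary_wedge X K) (\<lambda>_. stationaryT k I \<omega> a K) 0 vs =
         (\<Sum>\<pi> | \<pi> permutes {..<s + (k - s)}. d \<pi> * (?c * ((\<Sum>p\<le>DIM('a). e \<pi> (dF I (X p))) -
           (real s + 1) * e \<pi> (dF I (X a))))) / (fact s * fact (k - s))"
        using K' by (simp only: wedge_def d_def e_def stationaryT_def if_False)
      also have "(\<Sum>\<pi> | \<pi> permutes {..<s + (k - s)}. d \<pi> * (?c * ((\<Sum>p\<le>DIM('a). e \<pi> (dF I (X p))) -
           (real s + 1) * e \<pi> (dF I (X a))))) =
         ?c * ((\<Sum>p\<le>DIM('a). \<Sum>\<pi> | \<pi> permutes {..<s + (k - s)}. d \<pi> * e \<pi> (dF I (X p))) -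
           (real s + 1) * (\<Sum>\<pi> | \<pi> permutes {..<s + (k - s)}. d \<pi> * e \<pi> (dF I (X a))))"
        by (subst sum.swap[of _ _ "{..DIM('a)}"])
          (simp add: sum_distrib_left sum_subtractf right_diff_distrib mult.left_commute)
      finally show ?thesis unfolding Wd sum_divide_distrib[symmetric]
        by (simp add: diff_divide_distrib right_diff_distrib)
    qed
    then have "(\<Sum>K\<in>sorted_lists (I - {a}) s. wedge s (k - s) (dbary_wedge X K) (\<lambda>_. stationaryT k I \<omega> a K) 0 vs) =
      (\<Sum>K\<in>sorted_lists (I - {a}) s. ?c * ((\<Sum>p\<le>DIM('a). ?W s K (dF I (X p))) - (real s + 1) * ?W s K (dF I (X a))))"
      by (intro sum.cong refl)
    also have "\<dots> = ?c * ((\<Sum>K\<in>sorted_lists (I - {a}) s. \<Sum>p\<le>DIM('a). ?W s K (dF I (X p))) -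
       (real s + 1) * (\<Sum>K\<in>sorted_lists (I - {a}) s. ?W s K (dF I (X a))))"
      unfolding sum_distrib_left[symmetric] sum_subtractf ..
    finally have "(\<Sum>K\<in>sorted_lists (I - {a}) s. wedge s (k - s) (dbary_wedge X K) (\<lambda>_. stationaryT k I \<omega> a K) 0 vs) =
       ?c * ((\<Sum>p\<le>DIM('a). \<Sum>K\<in>sorted_lists (I - {a}) s. ?W s K (dF I (X p))) -
       (real s + 1) * (\<Sum>K\<in>sorted_lists (I - {a}) s. ?W s K (dF I (X a))))"
      by (subst sum.swap)
    also have "\<dots> = ?c * ((\<Sum>p\<le>DIM('a). (-1) ^ (s * (k - s)) / (fact s * fact (k - s)) * ?Om s (dF I (X p))) -
       (real s + 1) * ((-1) ^ (s * (k - s)) / (fact s * fact (k - s)) * ?Om s (dF I (X a))))"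
      using W[of s] s by simp
    also have "\<dots> = ?c * ((-1) ^ (s * (k - s)) / (fact s * fact (k - s))) *
       ((\<Sum>p\<le>DIM('a). ?Om s (dF I (X p))) - (real s + 1) * ?Om s (dF I (X a)))"
    proof -
      have alg: "c * (x * S - r * (x * y)) = c * x * (S - r * y)" for c x S r y :: real
        by (simp add: algebra_simps)
      show ?thesis unfolding sum_distrib_left[symmetric] by (rule alg)
    qed
    also have "?c * ((-1) ^ (s * (k - s)) / (fact s * fact (k - s))) =
       (-1) ^ (1 + s) / ((\<Prod>r=1..s. real DIM('a) - real r) * fact (k - s))"
    proof -
      obtain r where r: "k = s + r" using s le_Suc_ex by auto
      have "even (1 + k * s + s * (k - s)) = even (1 + s)"
        unfolding r by auto
      then have "(- 1 :: real) ^ (1 + k * s + s * (k - s)) = (- 1) ^ (1 + s)"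
        unfolding minus_one_power_iff by (rule arg_cong)
      then have "(-1) ^ (1 + k * s) * (-1) ^ (s * (k - s)) = (- 1 :: real) ^ (1 + s)"
        by (simp only: power_add)
      moreover have "(x * F\<^sup>2 / P) / F * (y / (F * H)) = (x * y) / (P * H)" if "F \<noteq> 0" for x y F P H :: real
        using that by (cases "P = 0"; cases "H = 0") (simp_all add: field_simps power2_eq_square)
      ultimately show ?thesis unfolding c_coeff_def by (metis fact_nonzero)
    qed
    finally show ?thesis .
  qed
  have "vertex_coeff k I \<omega> vs a = alt_insert \<omega> vs (replicate k (dF I (X a))) / fact k +
     (\<Sum>s=1..k. \<Sum>K\<in>sorted_lists (I - {a}) s. wedge s (k - s) (dbary_wedge X K) (\<lambda>_. stationaryT k I \<omega> a K) 0 vs)"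
    unfolding vertex_coeff_def by (subst sum.atLeast_Suc_atMost) (simp_all add: s0[simplified])
  then show ?thesis using step by simp
qed

text \<open>The coefficients in the definition of \<open>A\<close> are exactly those for which all first-order terms
  cancel when the base vertex is changed.\<close>

lemma vertex_coeff_indep:
  assumes \<omega>: "alternating_map k \<omega>" and I: "finite I" and vs: "length vs = k" and k: "k \<le> DIM('a) - 1"
  shows "vertex_coeff k I \<omega> vs b = vertex_coeff k I \<omega> vs a"
proof -
  \<comment> \<open>passing from \<open>a\<close> to \<open>b\<close> changes both one-forms only by multiples of \<open>\<theta>\<close>, hence to first order\<close>
  define \<theta> where "\<theta> = dbsum I"
  define rk where "rk y = (\<lambda>v. \<theta> v *\<^sub>R y)" for y :: 'a
  let ?O = "alt_insert \<omega> vs"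
  define \<eta> G where "\<eta> = eta I a" and "G = dF I (X a)"
  define d where "d = X b - X a"
  have Gp: "dF I (X p) = (\<lambda>v. G v + \<theta> v *\<^sub>R (X p - X a))" for p
    using dF_shift[of I "X p" _ "X a"] by (auto simp: G_def \<theta>_def fun_eq_iff algebra_simps)
  have \<eta>b: "eta I b = (\<lambda>v. \<eta> v + \<theta> v *\<^sub>R (- d))"
    by (auto simp: fun_eq_iff eta_def \<eta>_def \<theta>_def dbsum_def d_def scaleR_left.sum algebra_simps
        simp flip: sum.distrib sum_negf sum_subtractf)
  define W where "W s = ?O (replicate s \<eta> @ replicate (k - s) G)" for s
  define V where "V s y = ?O (rk y # replicate s \<eta> @ replicate (k - s - 1) G)" for s y
  have rot: "?O (xs @ ys) = ?O (ys @ xs)" if "length xs + length ys = k" for xs ys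
    using alt_insert_rotate[OF \<omega>, of xs ys "[]"] that by simp
  have rot1: "?O (g # xs @ ys) = ?O (g # ys @ xs)" if "length xs + length ys + 1 = k" for g xs ys
    using alt_insert_rotate[OF \<omega>, of xs ys "[g]"] that by simp
  have Wp: "?O (replicate s \<eta> @ replicate (k - s) (dF I (X p))) = W s + real (k - s) * V s (X p - X a)"
    if "s \<le> k" for s p
  proof -
    have "?O (replicate s \<eta> @ replicate (k - s) (dF I (X p))) = ?O (replicate (k - s) (dF I (X p)) @ replicate s \<eta>)"
      using that by (intro rot) simp
    also have "\<dots> = ?O (replicate (k - s) G @ replicate s \<eta>) +
        real (k - s) * ?O (rk (X p - X a) # replicate (k - s - 1) G @ replicate s \<eta>)"
      unfolding Gp rk_def by (rule alt_insert_perturb[OF \<omega>]) (use that in simp)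
    also have "?O (replicate (k - s) G @ replicate s \<eta>) = W s"
      unfolding W_def using that by (intro rot) simp
    also have "real (k - s) * ?O (rk (X p - X a) # replicate (k - s - 1) G @ replicate s \<eta>) =
      real (k - s) * V s (X p - X a)"
    proof (cases "s = k")
      case False
      then show ?thesis unfolding V_def using that by (intro arg_cong[of _ _ "(*) _"] rot1) simp
    qed simp
    finally show ?thesis .
  qed
  have Vb: "?O (rk y # replicate s (eta I b) @ replicate m (dF I (X b))) =
      ?O (rk y # replicate s \<eta> @ replicate m G)" if "s + m + 1 = k" for y s m
  proof -
    have "?O (rk y # replicate s (eta I b) @ replicate m (dF I (X b))) =
        ?O (rk y # replicate s \<eta> @ replicate m (dF I (X b)))"
      unfolding \<eta>b rk_def by (rule alt_insert_absorb[OF \<omega>]) (use that in simp)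
    also have "\<dots> = ?O (rk y # replicate m (dF I (X b)) @ replicate s \<eta>)"
      using that by (intro rot1) simp
    also have "\<dots> = ?O (rk y # replicate m G @ replicate s \<eta>)"
      unfolding Gp[of b] rk_def by (rule alt_insert_absorb[OF \<omega>]) (use that in simp)
    also have "\<dots> = ?O (rk y # replicate s \<eta> @ replicate m G)"
      using that by (intro rot1) simp
    finally show ?thesis .
  qed
  have Vadd: "V s (y + z) = V s y + V s z" if "s < k" for s y z
  proof -
    have e: "rk (y + z) = (\<lambda>v. rk y v + rk z v)" by (simp add: rk_def scaleR_add_right)
    show ?thesis unfolding V_def e
      using alt_insert_add[OF \<omega>, of "[]" "replicate s \<eta> @ replicate (k - s - 1) G" vs "rk y" "rk z"] that
      by simp
  qed
  have Vneg: "V s (- y) = - V s y" if "s < k" for s y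
    using Vadd[OF that, of y "- y"] Vadd[OF that, of 0 0] by simp
  have Wb: "?O (replicate s (eta I b) @ replicate (k - s) (dF I (X b))) =
     W s + real (k - s) * V s d - real s * V (s - 1) d" if s: "s \<le> k" for s
  proof -
    have "?O (replicate s (eta I b) @ replicate (k - s) (dF I (X b))) =
       ?O (replicate s \<eta> @ replicate (k - s) (dF I (X b))) +
       real s * ?O (rk (- d) # replicate (s - 1) \<eta> @ replicate (k - s) (dF I (X b)))"
      unfolding \<eta>b rk_def by (rule alt_insert_perturb[OF \<omega>]) (use s in simp)
    also have "?O (replicate s \<eta> @ replicate (k - s) (dF I (X b))) = W s + real (k - s) * V s d"
      using Wp[OF s, of b] by (simp add: d_def)
    also have "real s * ?O (rk (- d) # replicate (s - 1) \<eta> @ replicate (k - s) (dF I (X b))) =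
       real s * (- V (s - 1) d)"
    proof (cases s)
      case (Suc j)
      have "?O (rk (- d) # replicate j \<eta> @ replicate (k - s) (dF I (X b))) =
         ?O (rk (- d) # replicate (k - s) (dF I (X b)) @ replicate j \<eta>)"
        using s Suc by (intro rot1) simp
      also have "\<dots> = ?O (rk (- d) # replicate (k - s) G @ replicate j \<eta>)"
        unfolding Gp[of b] rk_def by (rule alt_insert_absorb[OF \<omega>]) (use s Suc in simp)
      also have "\<dots> = ?O (rk (- d) # replicate j \<eta> @ replicate (k - s) G)"
        using s Suc by (intro rot1) simp
      also have "\<dots> = V j (- d)" using Suc by (simp add: V_def)
      also have "\<dots> = - V j d" using Vneg[of j d] s Suc by simp
      finally show ?thesis using Suc by simp
    qed simp
    finally show ?thesis by simp
  qed
  have Wbp: "?O (replicate s (eta I b) @ replicate (k - s) (dF I (X p))) =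
     W s + real (k - s) * V s d - real s * V (s - 1) d + real (k - s) * (V s (X p - X a) - V s d)"
    if s: "s \<le> k" for s p
  proof -
    have Gpb: "dF I (X p) = (\<lambda>v. dF I (X b) v + \<theta> v *\<^sub>R (X p - X b))"
      using dF_shift[of I "X p" _ "X b"] by (auto simp: \<theta>_def fun_eq_iff algebra_simps)
    have "?O (replicate s (eta I b) @ replicate (k - s) (dF I (X p))) =
        ?O (replicate (k - s) (dF I (X p)) @ replicate s (eta I b))"
      using s by (intro rot) simp
    also have "\<dots> = ?O (replicate (k - s) (dF I (X b)) @ replicate s (eta I b)) +
        real (k - s) * ?O (rk (X p - X b) # replicate (k - s - 1) (dF I (X b)) @ replicate s (eta I b))"
      unfolding Gpb rk_def by (rule alt_insert_perturb[OF \<omega>]) (use s in simp)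
    also have "?O (replicate (k - s) (dF I (X b)) @ replicate s (eta I b)) =
       W s + real (k - s) * V s d - real s * V (s - 1) d"
      using Wb[OF s] rot[of "replicate (k - s) (dF I (X b))" "replicate s (eta I b)"] s by simp
    also have "real (k - s) * ?O (rk (X p - X b) # replicate (k - s - 1) (dF I (X b)) @ replicate s (eta I b)) =
       real (k - s) * (V s (X p - X a) - V s d)"
    proof (cases "s = k")
      case False
      then have sk: "s < k" using s by simp
      have "?O (rk (X p - X b) # replicate (k - s - 1) (dF I (X b)) @ replicate s (eta I b)) =
          ?O (rk (X p - X b) # replicate s (eta I b) @ replicate (k - s - 1) (dF I (X b)))"
        using sk by (intro rot1) simp
      also have "\<dots> = V s (X p - X b)" unfolding V_def using sk by (intro Vb) simp
      also have "V s (X p - X b) = V s ((X p - X a) + (- d))" by (simp add: d_def)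
      also have "\<dots> = V s (X p - X a) - V s d" unfolding Vadd[OF sk] Vneg[OF sk] by simp
      finally show ?thesis by simp
    qed simp
    finally show ?thesis .
  qed
  let ?cf = "\<lambda>s. (-1) ^ (1 + s) / ((\<Prod>r=1..s. real DIM('a) - real r) * fact (k - s)) :: real"
  have qa: "vertex_coeff k I \<omega> vs a = W 0 / fact k + (\<Sum>s=1..k. ?cf s *
      ((\<Sum>p\<le>DIM('a). W s + real (k - s) * V s (X p - X a)) - (real s + 1) * W s))"
    unfolding vertex_coeff_alt_insert[OF \<omega> I vs] \<eta>_def[symmetric] G_def[symmetric]
    using Wp by (simp add: W_def[symmetric]) (simp add: W_def)
  have qb: "vertex_coeff k I \<omega> vs b = (W 0 + real k * V 0 d) / fact k + (\<Sum>s=1..k. ?cf s *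
      ((\<Sum>p\<le>DIM('a). W s + real (k - s) * V s d - real s * V (s - 1) d + real (k - s) * (V s (X p - X a) - V s d))
       - (real s + 1) * (W s + real (k - s) * V s d - real s * V (s - 1) d)))"
    unfolding vertex_coeff_alt_insert[OF \<omega> I vs]
    using Wb[of 0] by (simp add: Wb Wbp d_def[symmetric])
  have e: "(\<Sum>p\<le>DIM('a). W s + real (k - s) * V s d - real s * V (s - 1) d + real (k - s) * (V s (X p - X a) - V s d))
       - (real s + 1) * (W s + real (k - s) * V s d - real s * V (s - 1) d) =
     ((\<Sum>p\<le>DIM('a). W s + real (k - s) * V s (X p - X a)) - (real s + 1) * W s) +
      ((real DIM('a) - real s) * (real (k - s) * V s d - real s * V (s - 1) d)
         - real (k - s) * (real DIM('a) + 1) * V s d)" for s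
    by (simp add: sum.distrib sum_subtractf algebra_simps sum_distrib_left)
  define A where "A s = (\<Sum>p\<le>DIM('a). W s + real (k - s) * V s (X p - X a)) - (real s + 1) * W s" for s
  define B where "B s = (real DIM('a) - real s) * (real (k - s) * V s d - real s * V (s - 1) d)
         - real (k - s) * (real DIM('a) + 1) * V s d" for s
  have "vertex_coeff k I \<omega> vs a = W 0 / fact k + (\<Sum>s=1..k. ?cf s * A s)"
    using qa by (simp only: A_def)
  moreover have "vertex_coeff k I \<omega> vs b = (W 0 + real k * V 0 d) / fact k + (\<Sum>s=1..k. ?cf s * (A s + B s))"
    using qb by (simp only: A_def B_def e)
  moreover have "(\<Sum>s=1..k. ?cf s * (A s + B s)) = (\<Sum>s=1..k. ?cf s * A s) + (\<Sum>s=1..k. ?cf s * B s)"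
    by (simp only: distrib_left sum.distrib)
  ultimately have "vertex_coeff k I \<omega> vs b = vertex_coeff k I \<omega> vs a + (real k * V 0 d / fact k + (\<Sum>s=1..k. ?cf s * B s))"
    by (simp only: add_divide_distrib add_ac)
  then show ?thesis
    using telescoping_coefficients[of k "DIM('a)" "\<lambda>s. V s d"] k DIM_positive[where 'a = 'a]
    unfolding B_def by simp
qed

lemma Gam_sub_eq: "set I \<subseteq> {..n} \<Longrightarrow> Gam_sub n s I = sorted_lists (set I) (Suc s)"
  by (auto simp: Gam_sub_def Gam_def sorted_lists_def)

text \<open>Being linear in the barycentric coordinates with equal coefficients, the sum is a fixed number times
  \<open>\<lambda>\<^sub>I\<close>. Its quotient by \<open>\<lambda>\<^sub>I\<close> therefore extends continuously to the zeros of \<open>\<lambda>\<^sub>I\<close>.\<close>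

lemma stationary_sum:
  assumes \<omega>: "alternating_map k \<omega>" and I: "set I \<subseteq> {..DIM('a)}" "I \<noteq> []"
    and vs: "length vs = k" and k: "k \<le> DIM('a) - 1"
  obtains C where "\<And>z. (\<Sum>s=0..k. \<Sum>J\<in>Gam_sub DIM('a) s I.
      wedge s (k - s) (whitney X J) (\<lambda>_. stationaryA k (set I) J \<omega>) z vs) = bsum (set I) z * C"
proof -
  define f where "f s a K = wedge s (k - s) (dbary_wedge X K) (\<lambda>_. stationaryT k (set I) \<omega> a K) 0 vs" for s a K
  have 1: "wedge s (k - s) (whitney X J) (\<lambda>_. stationaryA k (set I) J \<omega>) z vs =
     (\<Sum>i<Suc s. bary X (J ! i) z * f s (J ! i) (omit i J))"
    if s: "s \<le> k" and J: "J \<in> sorted_lists (set I) (Suc s)" for s J z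
  proof -
    have J': "length J = Suc s" "distinct J" "set J \<subseteq> {..DIM('a)}"
      using J I by (auto simp: sorted_lists_def strict_sorted_iff)
    have "wedge s (k - s) (whitney X J) (\<lambda>_. stationaryA k (set I) J \<omega>) z vs =
       wedge s (k - s) (\<lambda>z ws. \<Sum>i<Suc s. ((-1) ^ i * bary X (J ! i) z) * dbary_wedge X (omit i J) z ws)
        (\<lambda>_. stationaryA k (set I) J \<omega>) z vs"
      using J'(1) by (intro wedge_cong) (simp_all add: whitney_def s vs del: sum.lessThan_Suc)
    also have "\<dots> = (\<Sum>i<Suc s. ((-1) ^ i * bary X (J ! i) z) *
        wedge s (k - s) (dbary_wedge X (omit i J)) (\<lambda>_. stationaryA k (set I) J \<omega>) z vs)"
      by (rule wedge_sum_left)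
    also have "\<dots> = (\<Sum>i<Suc s. bary X (J ! i) z * f s (J ! i) (omit i J))"
    proof (intro sum.cong refl)
      fix i assume i: "i \<in> {..<Suc s}"
      have "(-1) ^ i * wedge s (k - s) (dbary_wedge X (omit i J)) (\<lambda>_. stationaryA k (set I) J \<omega>) z vs =
        wedge s (k - s) (dbary_wedge X (omit i J)) (\<lambda>_ ws. (-1) ^ i * stationaryA k (set I) J \<omega> ws) z vs"
        by (simp add: wedge_def sum_distrib_left mult.left_commute)
      also have "\<dots> = f s (J ! i) (omit i J)"
        unfolding f_def
        by (rule wedge_cong)
          (use i s vs in \<open>auto simp: stationaryA_eq[OF \<omega> J'] intro: dbary_wedge_const\<close>)
      finally show "((-1) ^ i * bary X (J ! i) z) *
        wedge s (k - s) (dbary_wedge X (omit i J)) (\<lambda>_. stationaryA k (set I) J \<omega>) z vs =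
        bary X (J ! i) z * f s (J ! i) (omit i J)" by (simp add: mult.left_commute mult.assoc)
    qed
    finally show ?thesis .
  qed
  obtain a0 where "a0 \<in> set I" using I(2) by (cases I) auto
  have "(\<Sum>s=0..k. \<Sum>J\<in>Gam_sub DIM('a) s I.
      wedge s (k - s) (whitney X J) (\<lambda>_. stationaryA k (set I) J \<omega>) z vs) =
      bsum (set I) z * vertex_coeff k (set I) \<omega> vs a0" for z
  proof -
    have "(\<Sum>s=0..k. \<Sum>J\<in>Gam_sub DIM('a) s I.
      wedge s (k - s) (whitney X J) (\<lambda>_. stationaryA k (set I) J \<omega>) z vs) =
      (\<Sum>s=0..k. \<Sum>J\<in>sorted_lists (set I) (Suc s). \<Sum>i<Suc s. bary X (J ! i) z * f s (J ! i) (omit i J))"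
      unfolding Gam_sub_eq[OF I(1)] by (intro sum.cong refl 1) auto
    also have "\<dots> = (\<Sum>s=0..k. \<Sum>a\<in>set I. \<Sum>K\<in>sorted_lists (set I - {a}) s. bary X a z * f s a K)"
      by (intro sum.cong refl sum_omit_reindex) simp
    also have "\<dots> = (\<Sum>a\<in>set I. bary X a z * vertex_coeff k (set I) \<omega> vs a)"
      unfolding vertex_coeff_def f_def by (subst sum.swap) (simp add: sum_distrib_left)
    also have "\<dots> = (\<Sum>a\<in>set I. bary X a z * vertex_coeff k (set I) \<omega> vs a0)"
      by (intro sum.cong refl arg_cong[of _ _ "(*) _"] vertex_coeff_indep[OF \<omega> _ vs k]) simp
    finally show ?thesis by (simp add: bsum_def sum_distrib_right)
  qed
  then show ?thesis by (rule that)
qed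

end

section \<open>Volumes of flat simplices\<close>

text \<open>The integral of \<open>g\<close> over a parallel flat through \<open>v\<close>, in the coordinates of the family \<open>l\<close>. It allows
  one coordinate to be integrated at a time.\<close>

definition slab_integral :: "(nat \<Rightarrow> 'a::euclidean_space) \<Rightarrow> ('a \<Rightarrow> ennreal) \<Rightarrow> nat set \<Rightarrow> 'a \<Rightarrow> ennreal" where
  "slab_integral l g J v = (\<integral>\<^sup>+x. g (v + (\<Sum>j\<in>J. x j *\<^sub>R l j)) \<partial>Pi\<^sub>M J (\<lambda>_. lborel))"

lemma slab_integral_insert:
  fixes l :: "nat \<Rightarrow> 'a::euclidean_space"
  assumes g [measurable]: "g \<in> borel_measurable borel" and J: "finite J" "i \<notin> J"
  shows "slab_integral l g (insert i J) v = (\<integral>\<^sup>+y. slab_integral l g J (v + y *\<^sub>R l i) \<partial>lborel)"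
proof -
  interpret product_sigma_finite "\<lambda>_::nat. lborel :: real measure" by standard
  have [measurable]: "(\<lambda>x. g (v + (\<Sum>j\<in>insert i J. x j *\<^sub>R l j))) \<in> borel_measurable (Pi\<^sub>M (insert i J) (\<lambda>_. lborel))"
    by measurable
  have "slab_integral l g (insert i J) v =
     (\<integral>\<^sup>+y. \<integral>\<^sup>+x. g (v + (\<Sum>j\<in>insert i J. (x(i := y)) j *\<^sub>R l j)) \<partial>Pi\<^sub>M J (\<lambda>_. lborel) \<partial>lborel)"
    unfolding slab_integral_def by (rule product_nn_integral_insert_rev) (use J in simp_all)
  also have "\<dots> = (\<integral>\<^sup>+y. slab_integral l g J (v + y *\<^sub>R l i) \<partial>lborel)"
  proof (intro nn_integral_cong)
    fix y
    have "(\<Sum>j\<in>J. (x(i := y)) j *\<^sub>R l j) = (\<Sum>j\<in>J. x j *\<^sub>R l j)" for x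
      using J by (intro sum.cong) auto
    then show "(\<integral>\<^sup>+x. g (v + (\<Sum>j\<in>insert i J. (x(i := y)) j *\<^sub>R l j)) \<partial>Pi\<^sub>M J (\<lambda>_. lborel)) =
       slab_integral l g J (v + y *\<^sub>R l i)"
      using J by (simp add: slab_integral_def add.assoc)
  qed
  finally show ?thesis .
qed

lemma slab_integral_measurable:
  fixes l :: "nat \<Rightarrow> 'a::euclidean_space"
  assumes g [measurable]: "g \<in> borel_measurable borel" and J: "finite J"
  shows "(\<lambda>y. slab_integral l g J (v + y *\<^sub>R w)) \<in> borel_measurable borel"
proof -
  interpret product_sigma_finite "\<lambda>_::nat. lborel :: real measure" by standard
  interpret sigma_finite_measure "Pi\<^sub>M J (\<lambda>_. lborel :: real measure)" by (rule sigma_finite[OF J])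
  show ?thesis unfolding slab_integral_def by measurable
qed

lemma slab_integral_translate:
  fixes l :: "nat \<Rightarrow> 'a::euclidean_space"
  assumes g: "g \<in> borel_measurable borel" and J: "finite J"
  shows "slab_integral l g J (v + (\<Sum>j\<in>J. t j *\<^sub>R l j)) = slab_integral l g J v"
  using J
proof (induction J arbitrary: v rule: finite_induct)
  case (insert i J)
  let ?w = "\<Sum>j\<in>J. t j *\<^sub>R l j"
  have "slab_integral l g (insert i J) (v + (\<Sum>j\<in>insert i J. t j *\<^sub>R l j)) =
      (\<integral>\<^sup>+y. slab_integral l g J ((v + (t i + 1 * y) *\<^sub>R l i) + ?w) \<partial>lborel)"
    using insert.hyps by (simp add: slab_integral_insert[OF g] algebra_simps)
  also have "\<dots> = (\<integral>\<^sup>+y. slab_integral l g J (v + (t i + 1 * y) *\<^sub>R l i) \<partial>lborel)"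
    unfolding insert.IH ..
  also have "\<dots> = (\<integral>\<^sup>+y. slab_integral l g J (v + y *\<^sub>R l i) \<partial>lborel)"
    using nn_integral_real_affine[OF slab_integral_measurable[OF g insert.hyps(1), of l v "l i"], of 1 "t i"]
    by simp
  also have "\<dots> = slab_integral l g (insert i J) v"
    using insert.hyps by (simp add: slab_integral_insert[OF g])
  finally show ?case .
qed simp

lemma emeasure_flat_measure:
  assumes "B \<in> sets borel"
  shows "emeasure (flat_measure b ts) B = slab_integral (\<lambda>a. ts ! a) (indicator B) {..<length ts} b"
proof -
  have [measurable]: "(\<lambda>c. b + (\<Sum>a<length ts. c a *\<^sub>R ts ! a)) \<in>
      measurable (Pi\<^sub>M {..<length ts} (\<lambda>_. lborel :: real measure)) borel"
    by measurable
  have "emeasure (flat_measure b ts) B = (\<integral>\<^sup>+y. indicator B y \<partial>flat_measure b ts)"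
    using assms by (simp add: flat_measure_def)
  also have "\<dots> = (\<integral>\<^sup>+c. indicator B (b + (\<Sum>a<length ts. c a *\<^sub>R ts ! a)) \<partial>Pi\<^sub>M {..<length ts} (\<lambda>_. lborel))"
    unfolding flat_measure_def by (rule nn_integral_distr) (use assms in measurable)
  finally show ?thesis by (simp only: slab_integral_def)
qed

text \<open>Replacing one basis vector by a combination of all of them scales the measure by the
  coefficient of the replaced vector: the other coefficients only produce a shear.\<close>

lemma flat_measure_replace:
  assumes i: "i < length l" and \<alpha>: "\<alpha> i \<noteq> 0" and B: "B \<in> sets borel"
  shows "emeasure (flat_measure b l) B =
     ennreal \<bar>\<alpha> i\<bar> * emeasure (flat_measure b (l[i := \<Sum>j<length l. \<alpha> j *\<^sub>R l ! j])) B"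
proof -
  define J where "J = {..<length l} - {i}"
  have J: "finite J" "i \<notin> J" "{..<length l} = insert i J" using i by (auto simp: J_def)
  let ?w = "\<Sum>j<length l. \<alpha> j *\<^sub>R l ! j"
  let ?l' = "l[i := ?w]"
  have g: "indicator B \<in> borel_measurable borel" using B by simp
  have w: "?w = \<alpha> i *\<^sub>R l ! i + (\<Sum>j\<in>J. \<alpha> j *\<^sub>R l ! j)" using J by simp
  let ?H = "\<lambda>y. slab_integral (\<lambda>a. l ! a) (indicator B) J (b + y *\<^sub>R l ! i)"
  have "emeasure (flat_measure b ?l') B =
      (\<integral>\<^sup>+y. slab_integral (\<lambda>a. ?l' ! a) (indicator B) J (b + y *\<^sub>R ?l' ! i) \<partial>lborel)"
    unfolding emeasure_flat_measure[OF B] length_list_update J(3)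
    by (rule slab_integral_insert[OF g J(1,2)])
  also have "\<dots> = (\<integral>\<^sup>+y. ?H (0 + \<alpha> i * y) \<partial>lborel)"
  proof (intro nn_integral_cong)
    fix y
    have 1: "slab_integral (\<lambda>a. l[i := u] ! a) (indicator B) J v = slab_integral (\<lambda>a. l ! a) (indicator B) J v" for u v
    proof -
      have "(\<Sum>j\<in>J. x j *\<^sub>R l[i := u] ! j) = (\<Sum>j\<in>J. x j *\<^sub>R l ! j)" for x
      proof (intro sum.cong refl)
        fix j assume "j \<in> J"
        then have "i \<noteq> j" using J(2) by blast
        then show "x j *\<^sub>R l[i := u] ! j = x j *\<^sub>R l ! j" by simp
      qed
      then show ?thesis by (simp only: slab_integral_def)
    qed
    have "?l' ! i = ?w" using i by (rule nth_list_update_eq)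
    then have "y *\<^sub>R ?l' ! i = y *\<^sub>R (\<alpha> i *\<^sub>R l ! i + (\<Sum>j\<in>J. \<alpha> j *\<^sub>R l ! j))"
      by (simp only: w)
    also have "\<dots> = (0 + \<alpha> i * y) *\<^sub>R l ! i + (\<Sum>j\<in>J. (y * \<alpha> j) *\<^sub>R l ! j)"
      by (simp add: scaleR_right_distrib scaleR_sum_right mult.commute)
    finally have "y *\<^sub>R ?l' ! i = (0 + \<alpha> i * y) *\<^sub>R l ! i + (\<Sum>j\<in>J. (y * \<alpha> j) *\<^sub>R l ! j)" .
    from arg_cong[OF this, of "\<lambda>z. b + z"] have 2: "b + y *\<^sub>R ?l' ! i = (b + (0 + \<alpha> i * y) *\<^sub>R l ! i) + (\<Sum>j\<in>J. (y * \<alpha> j) *\<^sub>R l ! j)"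
      by (simp only: add.assoc)
    show "slab_integral (\<lambda>a. ?l' ! a) (indicator B) J (b + y *\<^sub>R ?l' ! i) = ?H (0 + \<alpha> i * y)"
      unfolding 1 2 by (rule slab_integral_translate[OF g J(1)])
  qed
  finally have "ennreal \<bar>\<alpha> i\<bar> * emeasure (flat_measure b ?l') B =
     ennreal \<bar>\<alpha> i\<bar> * (\<integral>\<^sup>+y. ?H (0 + \<alpha> i * y) \<partial>lborel)" by simp
  also have "\<dots> = (\<integral>\<^sup>+y. ?H y \<partial>lborel)"
    using nn_integral_real_affine[OF slab_integral_measurable[OF g J(1)] \<alpha>, of "\<lambda>a. l ! a" b "l ! i" 0] by simp
  also have "\<dots> = emeasure (flat_measure b l) B"
    unfolding emeasure_flat_measure[OF B] J(3) by (rule slab_integral_insert[OF g J(1,2), symmetric])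
  finally show ?thesis by simp
qed

text \<open>\<open>d\<close> is the determinant of \<open>l\<close> relative to \<open>ts\<close>, characterised by its effect on alternating maps
  and on volumes at once. Both effects are multiplicative along elementary operations on \<open>l\<close>, so
  they never have to be compared through an explicit determinant.\<close>

definition vol_ratio :: "'a::euclidean_space list \<Rightarrow> 'a list \<Rightarrow> real \<Rightarrow> bool" where
  "vol_ratio ts l d \<longleftrightarrow> length l = length ts \<and> d \<noteq> 0 \<and> set ts \<subseteq> span (set l) \<and>
     (\<forall>\<omega>. alternating_map (length ts) \<omega> \<longrightarrow> \<omega> l = d * \<omega> ts) \<and>
     (\<forall>b. \<forall>B\<in>sets borel. emeasure (flat_measure b ts) B = ennreal \<bar>d\<bar> * emeasure (flat_measure b l) B)"

lemma alternating_map_replace: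
  assumes \<omega>: "alternating_map s \<omega>" and l: "length l = s" "i < s"
  shows "\<omega> (l[i := \<Sum>j<s. \<alpha> j *\<^sub>R l ! j]) = \<alpha> i * \<omega> l"
proof -
  have lin: "linear (\<lambda>v. \<omega> (l[i := v]))" using \<omega> l unfolding alternating_map_def by blast
  have "\<omega> (l[i := \<Sum>j<s. \<alpha> j *\<^sub>R l ! j]) = (\<Sum>j<s. \<alpha> j * \<omega> (l[i := l ! j]))"
    by (subst linear_sum[OF lin]) (simp add: linear_scale[OF lin])
  also have "\<dots> = (\<Sum>j<s. if j = i then \<alpha> i * \<omega> l else 0)"
  proof (intro sum.cong refl)
    fix j assume j: "j \<in> {..<s}"
    show "\<alpha> j * \<omega> (l[i := l ! j]) = (if j = i then \<alpha> i * \<omega> l else 0)"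
    proof (cases "j = i")
      case False
      have "(l[i := l ! j]) ! i = (l[i := l ! j]) ! j" using False l j by simp
      then have "\<not> distinct (l[i := l ! j])"
        using False l j by (metis length_list_update lessThan_iff nth_eq_iff_index_eq)
      then show ?thesis using False l alternating_map_not_distinct[OF \<omega>] by simp
    qed simp
  qed
  also have "\<dots> = \<alpha> i * \<omega> l" using l by simp
  finally show ?thesis .
qed

lemma vol_ratio_replace:
  assumes v: "vol_ratio ts l d" and i: "i < length ts" and \<alpha>: "\<alpha> i \<noteq> 0"
  shows "vol_ratio ts (l[i := \<Sum>j<length ts. \<alpha> j *\<^sub>R l ! j]) (\<alpha> i * d)"
proof -
  let ?w = "\<Sum>j<length ts. \<alpha> j *\<^sub>R l ! j"
  let ?l' = "l[i := ?w]"
  have l: "length l = length ts" using v by (simp add: vol_ratio_def)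
  have nth: "?l' ! j \<in> span (set ?l')" if "j < length ts" for j
    using that l by (intro span_base nth_mem) simp
  have "l ! j \<in> span (set ?l')" if j: "j < length ts" for j
  proof (cases "j = i")
    case False
    then show ?thesis using nth[OF j] by simp
  next
    case True
    have "?w = \<alpha> i *\<^sub>R l ! i + (\<Sum>j\<in>{..<length ts} - {i}. \<alpha> j *\<^sub>R l ! j)"
      using i by (simp add: sum.remove)
    then have li: "l ! i = inverse (\<alpha> i) *\<^sub>R (?w - (\<Sum>j\<in>{..<length ts} - {i}. \<alpha> j *\<^sub>R l ! j))"
      using \<alpha> by simp
    have w: "?w \<in> span (set ?l')" using nth[OF i] i l by simp
    have "l ! m \<in> span (set ?l')" if "m \<in> {..<length ts} - {i}" for m
      using nth[of m] that by simp
    then have r: "(\<Sum>j\<in>{..<length ts} - {i}. \<alpha> j *\<^sub>R l ! j) \<in> span (set ?l')"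
      by (intro span_sum span_scale)
    have "l ! i \<in> span (set ?l')"
      by (subst li) (rule span_scale[OF span_diff[OF w r]])
    then show ?thesis using True by simp
  qed
  then have "set l \<subseteq> span (set ?l')" using l by (auto simp: in_set_conv_nth)
  then have "span (set l) \<subseteq> span (set ?l')" by (simp add: span_minimal)
  then have 1: "set ts \<subseteq> span (set ?l')" using v by (auto simp: vol_ratio_def)
  have 2: "\<omega> ?l' = \<alpha> i * d * \<omega> ts" if "alternating_map (length ts) \<omega>" for \<omega>
    using alternating_map_replace[OF that l i] v that by (simp add: vol_ratio_def)
  have 3: "emeasure (flat_measure b ts) B = ennreal \<bar>\<alpha> i * d\<bar> * emeasure (flat_measure b ?l') B"
    if B: "B \<in> sets borel" for b B
  proof -
    have "emeasure (flat_measure b ts) B = ennreal \<bar>d\<bar> * emeasure (flat_measure b l) B"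
      using v B by (simp add: vol_ratio_def)
    also have "emeasure (flat_measure b l) B = ennreal \<bar>\<alpha> i\<bar> * emeasure (flat_measure b ?l') B"
      using flat_measure_replace[of i l \<alpha> B b] i l \<alpha> B by simp
    finally show ?thesis by (simp add: abs_mult ennreal_mult ac_simps)
  qed
  show ?thesis using 1 2 3 v l \<alpha> by (simp add: vol_ratio_def)
qed

lemma vol_ratio_combine:
  assumes v: "vol_ratio ts l d" and ij: "i < length ts" "j < length ts" "i \<noteq> j" and c: "c \<noteq> 0"
  shows "vol_ratio ts (l[i := c *\<^sub>R l ! i + c' *\<^sub>R l ! j]) (c * d)"
proof -
  let ?\<alpha> = "\<lambda>m. if m = i then c else if m = j then c' else 0"
  have "(\<Sum>m<length ts. ?\<alpha> m *\<^sub>R l ! m) =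
     (\<Sum>m<length ts. (if m = i then c *\<^sub>R l ! m else 0) + (if m = j then c' *\<^sub>R l ! m else 0))"
    using ij by (intro sum.cong) auto
  also have "\<dots> = c *\<^sub>R l ! i + c' *\<^sub>R l ! j" using ij by (simp add: sum.distrib)
  finally show ?thesis using vol_ratio_replace[OF v ij(1), of ?\<alpha>] c by simp
qed

lemma vol_ratio_swap:
  assumes v: "vol_ratio ts l d" and ij: "i < length ts" "j < length ts" "i \<noteq> j"
  shows "vol_ratio ts (l[i := l ! j, j := l ! i]) (- d)"
proof -
  have l: "length l = length ts" using v by (simp add: vol_ratio_def)
  define x y where "x = l ! i" and "y = l ! j"
  \<comment> \<open>(x, y), (x + y, y), (x + y, -x), (y, -x), (y, x)\<close>
  define l1 where "l1 = l[i := x + y]"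
  have v1: "vol_ratio ts l1 d"
    using vol_ratio_combine[OF v ij, of 1 1] by (simp add: l1_def x_def y_def)
  have n1: "l1 ! i = x + y" "l1 ! j = y" using ij l by (simp_all add: l1_def y_def)
  define l2 where "l2 = l1[j := - x]"
  have v2: "vol_ratio ts l2 d"
    using vol_ratio_combine[OF v1 ij(2,1) ij(3)[symmetric], of 1 "-1"] n1 by (simp add: l2_def)
  have n2: "l2 ! i = x + y" "l2 ! j = - x" using ij l n1 by (simp_all add: l2_def l1_def)
  define l3 where "l3 = l2[i := y]"
  have v3: "vol_ratio ts l3 d"
    using vol_ratio_combine[OF v2 ij, of 1 1] n2 by (simp add: l3_def)
  have n3: "l3 ! j = - x" using ij n2 by (simp add: l3_def)
  have v4: "vol_ratio ts (l3[j := x]) (- d)"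
    using vol_ratio_combine[OF v3 ij(2,1) ij(3)[symmetric], of "-1" 0] n3 by simp
  have "l3[j := x] = l[i := y, j := x]"
    using ij l by (intro nth_equalityI) (auto simp: l1_def l2_def l3_def nth_list_update)
  then show ?thesis using v4 by (simp add: x_def y_def)
qed

lemma span_list_sum:
  assumes "v \<in> span (set l)"
  obtains \<alpha> where "v = (\<Sum>j<length l. \<alpha> j *\<^sub>R l ! j)"
proof -
  let ?S = "{v. \<exists>\<alpha>. v = (\<Sum>j<length l. \<alpha> j *\<^sub>R l ! j)}"
  have "span (set l) \<subseteq> ?S"
  proof (rule span_minimal)
    show "set l \<subseteq> ?S"
    proof
      fix v assume "v \<in> set l"
      then obtain i where i: "i < length l" "v = l ! i" by (auto simp: in_set_conv_nth)
      have "(\<Sum>j<length l. (if j = i then 1 else 0) *\<^sub>R l ! j) = (\<Sum>j<length l. if j = i then l ! j else 0)"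
        by (intro sum.cong) auto
      also have "\<dots> = v" using i by simp
      finally have "v = (\<Sum>j<length l. (if j = i then 1 else 0) *\<^sub>R l ! j)" ..
      then show "v \<in> ?S" by (intro CollectI exI)
    qed
    show "subspace ?S"
    proof (rule subspaceI)
      have "0 = (\<Sum>j<length l. (0::real) *\<^sub>R l ! j)" by simp
      then show "0 \<in> ?S" by (intro CollectI exI)
      fix x y assume x: "x \<in> ?S" and y: "y \<in> ?S"
      obtain \<alpha> where "x = (\<Sum>j<length l. \<alpha> j *\<^sub>R l ! j)" using x unfolding mem_Collect_eq by (elim exE)
      moreover obtain \<beta> where "y = (\<Sum>j<length l. \<beta> j *\<^sub>R l ! j)" using y unfolding mem_Collect_eq by (elim exE)
      ultimately have "x + y = (\<Sum>j<length l. (\<alpha> j + \<beta> j) *\<^sub>R l ! j)" by (simp add: scaleR_add_left sum.distrib)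
      then show "x + y \<in> ?S" by (intro CollectI exI[of _ "\<lambda>j. \<alpha> j + \<beta> j"])
    next
      fix c x assume x: "x \<in> ?S"
      obtain \<alpha> where "x = (\<Sum>j<length l. \<alpha> j *\<^sub>R l ! j)" using x unfolding mem_Collect_eq by (elim exE)
      then have "c *\<^sub>R x = (\<Sum>j<length l. (c * \<alpha> j) *\<^sub>R l ! j)" by (simp add: scaleR_sum_right)
      then show "c *\<^sub>R x \<in> ?S" by (intro CollectI exI[of _ "\<lambda>j. c * \<alpha> j"])
    qed
  qed
  then have "v \<in> ?S" using assms by (rule subsetD)
  then show thesis unfolding mem_Collect_eq using that by (elim exE)
qed

text \<open>Steinitz exchange: any basis is reached from \<open>ts\<close> by replacements and swaps.\<close>

lemma vol_ratio_exists:
  assumes e: "length e = length ts" "set e \<subseteq> span (set ts)"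
    and ind: "\<And>m. m < length e \<Longrightarrow> e ! m \<notin> span (set (take m e))"
  obtains d where "vol_ratio ts e d"
proof -
  have "\<exists>l d. vol_ratio ts l d \<and> take m l = take m e" if "m \<le> length ts" for m
    using that
  proof (induction m)
    case 0
    have "vol_ratio ts ts 1" by (simp add: vol_ratio_def span_superset)
    then show ?case by (intro exI[of _ ts] exI[of _ 1]) simp
  next
    case (Suc m)
    then obtain l d where l: "vol_ratio ts l d" "take m l = take m e" by auto
    have len: "length l = length ts" and sp: "set ts \<subseteq> span (set l)" using l by (auto simp: vol_ratio_def)
    have m: "m < length ts" using Suc.prems by simp
    have "span (set ts) \<subseteq> span (set l)" using sp by (simp add: span_minimal)
    then have "e ! m \<in> span (set l)" using e m by (metis nth_mem subsetD)
    then obtain \<alpha> where \<alpha>: "e ! m = (\<Sum>j<length ts. \<alpha> j *\<^sub>R l ! j)"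
      using len by (auto elim: span_list_sum)
    have "\<exists>i<length ts. m \<le> i \<and> \<alpha> i \<noteq> 0"
    proof (rule ccontr)
      assume "\<not> ?thesis"
      then have "e ! m = (\<Sum>j<m. \<alpha> j *\<^sub>R l ! j)"
        unfolding \<alpha> using m by (intro sum.mono_neutral_right) auto
      also have "\<dots> \<in> span (set (take m e))"
      proof (intro span_sum span_scale span_base)
        fix j assume "j \<in> {..<m}"
        then have "l ! j = take m l ! j" "j < length (take m l)" using m len by auto
        then show "l ! j \<in> set (take m e)" using l(2) by (metis nth_mem)
      qed
      finally show False using ind[of m] m e by simp
    qed
    then obtain i where i: "i < length ts" "m \<le> i" "\<alpha> i \<noteq> 0" by blast
    let ?l1 = "l[i := e ! m]"
    have v1: "vol_ratio ts ?l1 (\<alpha> i * d)"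
      using vol_ratio_replace[where \<alpha> = \<alpha> and i = i, OF l(1)] i \<alpha> by simp
    have t1: "take m ?l1 = take m e" using i l(2) by simp
    have ts: "take (Suc m) l' = take (Suc m) e"
      if "length l' = length ts" "take m l' = take m e" "l' ! m = e ! m" for l'
      using that m e by (simp add: take_Suc_conv_app_nth)
    show ?case
    proof (cases "i = m")
      case True
      then show ?thesis using v1 ts[of ?l1] t1 m len by auto
    next
      case False
      let ?l2 = "?l1[i := ?l1 ! m, m := ?l1 ! i]"
      have "vol_ratio ts ?l2 (- (\<alpha> i * d))" by (rule vol_ratio_swap[OF v1 i(1) m False])
      moreover have "take (Suc m) ?l2 = take (Suc m) e"
        using ts[of ?l2] i m len l(2) False by simp
      ultimately show ?thesis by blast
    qed
  qed
  from this[of "length ts"] obtain l d where "vol_ratio ts l d" "take (length ts) l = take (length ts) e" by auto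
  then have "vol_ratio ts e d" using e by (auto simp: vol_ratio_def)
  then show thesis by (rule that)
qed

lemma independent_triangular:
  assumes "\<And>m. m < length e \<Longrightarrow> e ! m \<notin> span (set (take m e))"
  shows "independent (set e) \<and> distinct e"
  using assms
proof (induction e rule: rev_induct)
  case (snoc x e)
  have "e ! m \<notin> span (set (take m e))" if "m < length e" for m
    using snoc.prems[of m] that by (simp add: nth_append)
  then have "independent (set e)" "distinct e" using snoc.IH by auto
  moreover have "x \<notin> span (set e)" using snoc.prems[of "length e"] by simp
  moreover from this have "x \<notin> set e" using span_base by blast
  ultimately show ?case by (simp add: independent_insert)
qed (simp add: independent_empty)

subsection \<open>Oriented orthonormal bases\<close>

text \<open>The Leibniz determinant of the scalar products, as an alternating map of \<open>vs\<close>. Its sign is the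
  orientation.\<close>

definition gram_form :: "'a::real_inner list \<Rightarrow> 'a list \<Rightarrow> real" where
  "gram_form ts vs = (\<Sum>\<pi> | \<pi> permutes {..<length ts}. of_int (sign \<pi>) * (\<Prod>a<length ts. ts ! a \<bullet> (vs ! \<pi> a)))"

lemma alternating_gram_form: "alternating_map (length ts) (gram_form ts)"
proof (rule alternating_mapI)
  fix xs ys :: "'a list" assume l: "length xs + length ys + 1 = length ts"
  define s where "s = length ts"
  define i where "i = length xs"
  have i: "i < s" using l by (simp add: i_def s_def)
  have "linear (\<lambda>v. of_int (sign \<pi>) * (\<Prod>a<s. ts ! a \<bullet> ((xs @ v # ys) ! \<pi> a)))" if \<pi>: "\<pi> permutes {..<s}" for \<pi>
  proof -
    obtain c where ci: "i = \<pi> c" using surjD[OF permutes_surj[OF \<pi>]] by blast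
    have c: "c \<in> {..<s}" using ci i permutes_in_image[OF \<pi>, of c] by simp
    have "(\<Prod>a<s. ts ! a \<bullet> ((xs @ v # ys) ! \<pi> a)) =
        (ts ! c \<bullet> v) * (\<Prod>a\<in>{..<s} - {c}. ts ! a \<bullet> ((xs @ 0 # ys) ! \<pi> a))" for v
    proof -
      have "(\<Prod>a\<in>{..<s} - {c}. ts ! a \<bullet> ((xs @ v # ys) ! \<pi> a)) = (\<Prod>a\<in>{..<s} - {c}. ts ! a \<bullet> ((xs @ 0 # ys) ! \<pi> a))"
      proof (intro prod.cong refl)
        fix a assume "a \<in> {..<s} - {c}"
        then have "\<pi> a \<noteq> i" using permutes_inj[OF \<pi>] ci by (auto dest: injD)
        then show "ts ! a \<bullet> ((xs @ v # ys) ! \<pi> a) = ts ! a \<bullet> ((xs @ 0 # ys) ! \<pi> a)"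
          by (auto simp: nth_append nth_Cons' i_def)
      qed
      moreover have "(xs @ v # ys) ! \<pi> c = v" by (simp add: ci[symmetric] i_def)
      ultimately show ?thesis using c by (simp add: prod.remove)
    qed
    then show ?thesis by (auto intro!: linearI simp: algebra_simps inner_add_right)
  qed
  then show "linear (\<lambda>v. gram_form ts (xs @ v # ys))"
    unfolding gram_form_def s_def[symmetric] by (intro linear_compose_sum) auto
next
  fix vs :: "'a list" assume l: "length vs = length ts" "\<not> distinct vs"
  then obtain i j where ij: "i < length ts" "j < length ts" "i \<noteq> j" "vs ! i = vs ! j"
    by (auto simp: distinct_conv_nth)
  from sum_permutes_repeated[of i "length ts" j "\<lambda>a. vs ! a" "\<lambda>g. \<Prod>a<length ts. ts ! a \<bullet> g a", OF ij]
  show "gram_form ts vs = 0" by (simp add: gram_form_def)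
qed

lemma gram_form_orthonormal:
  assumes "\<forall>a<length ts. \<forall>b<length ts. ts ! a \<bullet> ts ! b = (if a = b then 1 else 0)"
  shows "gram_form ts ts = 1"
proof -
  define s where "s = length ts"
  have "(\<Prod>a<s. ts ! a \<bullet> (ts ! \<pi> a)) = (if \<pi> = id then 1 else 0)" if \<pi>: "\<pi> permutes {..<s}" for \<pi>
  proof (cases "\<pi> = id")
    case True
    then show ?thesis using assms by (simp add: s_def)
  next
    case False
    then obtain a where a: "\<pi> a \<noteq> a" by (auto simp: fun_eq_iff)
    then have "a \<in> {..<s}" using permutes_not_in[OF \<pi>] by blast
    moreover have "\<pi> a < s" using calculation permutes_in_image[OF \<pi>, of a] by simp
    ultimately have "\<exists>a\<in>{..<s}. ts ! a \<bullet> (ts ! \<pi> a) = 0" using assms a by (intro bexI[of _ a]) (auto simp: s_def)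
    then have "(\<Prod>a<s. ts ! a \<bullet> (ts ! \<pi> a)) = 0" by (intro prod_zero) auto
    then show ?thesis using False by simp
  qed
  then have "gram_form ts ts = (\<Sum>\<pi> | \<pi> permutes {..<s}. if \<pi> = id then 1 else 0)"
    unfolding gram_form_def s_def[symmetric] by (intro sum.cong) (auto simp: sign_id)
  also have "\<dots> = 1" by (simp add: finite_permutations permutes_id)
  finally show ?thesis .
qed

context nondeg_simplex
begin

definition edges :: "nat list \<Rightarrow> 'a list" where
  "edges J = map (\<lambda>j. X j - X (hd J)) (tl J)"

lemma length_edges [simp]: "length (edges J) = length J - 1" by (simp add: edges_def)

lemma nth_edges: "a < length J - 1 \<Longrightarrow> edges J ! a = X (J ! Suc a) - X (J ! 0)"
  by (cases J) (simp_all add: edges_def)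

lemma oriented_onb_gram:
  "oriented_onb X J ts \<longleftrightarrow> length ts = length J - 1 \<and>
     (\<forall>a<length ts. \<forall>b<length ts. ts ! a \<bullet> ts ! b = (if a = b then 1 else 0)) \<and>
     span (set ts) = tangent_space X (set J) \<and> gram_form ts (edges J) > 0"
proof -
  have "gram_form ts (edges J) = (\<Sum>\<pi> | \<pi> permutes {..<length ts}. of_int (sign \<pi>) *
        (\<Prod>a<length ts. ts ! a \<bullet> (X (J ! Suc (\<pi> a)) - X (J ! 0))))" if l: "length ts = length J - 1"
    unfolding gram_form_def
  proof (intro sum.cong refl arg_cong2[of _ _ _ _ "(*)"] prod.cong)
    fix \<pi> a assume "\<pi> \<in> {\<pi>. \<pi> permutes {..<length ts}}" "a \<in> {..<length ts}"
    then have "\<pi> a < length J - 1" using permutes_in_image[of \<pi> "{..<length ts}" a] l by simp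
    then show "ts ! a \<bullet> (edges J ! \<pi> a) = ts ! a \<bullet> (X (J ! Suc (\<pi> a)) - X (J ! 0))"
      by (simp add: nth_edges)
  qed
  then show ?thesis unfolding oriented_onb_def by auto
qed

text \<open>The coordinate \<open>d\<lambda>\<close> of the newest vertex is \<open>1\<close> on its edge and \<open>0\<close> on all earlier ones.\<close>

lemma edges_triangular:
  assumes J: "distinct J" "set J \<subseteq> {..DIM('a)}" and m: "m < length (edges J)"
  shows "edges J ! m \<notin> span (set (take m (edges J)))"
proof
  assume sp: "edges J ! m \<in> span (set (take m (edges J)))"
  have m': "Suc m < length J" using m by simp
  then have J0: "J \<noteq> []" by auto
  define l where "l = J ! Suc m"
  have le: "J ! a \<le> DIM('a)" if "a < length J" for a using J(2) that nth_mem by blast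
  have "dl l v = 0" if v: "v \<in> set (take m (edges J))" for v
  proof -
    obtain a where a: "a < m" "v = edges J ! a"
      using v m by (auto simp: in_set_conv_nth)
    have "v = X (J ! Suc a) - X (J ! 0)" using a m nth_edges[of a J] by simp
    moreover have "J ! Suc a \<noteq> l" "J ! 0 \<noteq> l"
      using J(1) a m' J0 nth_eq_iff_index_eq[of J 0 "Suc m"] nth_eq_iff_index_eq[of J "Suc a" "Suc m"]
      by (simp_all add: l_def)
    moreover have "J ! Suc a \<le> DIM('a)" "J ! 0 \<le> DIM('a)" using le a m' J0 by auto
    ultimately show ?thesis by (simp add: dl_vertex_diff bary_vertex)
  qed
  then have "dl l (edges J ! m) = 0" using linear_eq_0_on_span[OF linear_dl _ sp] by blast
  moreover have "edges J ! m = X l - X (J ! 0)" using m nth_edges[of m J] by (simp add: l_def)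
  moreover have "J ! 0 \<noteq> l" using J(1) m' J0 nth_eq_iff_index_eq[of J 0 "Suc m"] by (simp add: l_def)
  moreover have "l \<le> DIM('a)" "J ! 0 \<le> DIM('a)" using le m' J0 by (auto simp: l_def)
  ultimately show False by (simp add: dl_vertex_diff bary_vertex)
qed

lemma span_edges:
  assumes "J \<noteq> []"
  shows "span (set (edges J)) = tangent_space X (set J)"
proof -
  let ?D = "{X a - X b | a b. a \<in> set J \<and> b \<in> set J}"
  obtain j J' where J: "J = j # J'" using assms by (cases J) auto
  have "set (edges J) \<subseteq> span ?D"
    using J by (auto simp: edges_def intro!: span_base)
  moreover have "?D \<subseteq> span (set (edges J))"
  proof
    fix v assume "v \<in> ?D"
    then obtain a b where v: "v = (X a - X j) - (X b - X j)" "a \<in> set J" "b \<in> set J" by auto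
    have c: "X c - X j \<in> span (set (edges J))" if "c \<in> set J" for c
    proof (cases "c = j")
      case False
      then show ?thesis using that J by (intro span_base) (auto simp: edges_def)
    qed (simp add: span_zero)
    show "v \<in> span (set (edges J))" unfolding v(1) by (rule span_diff[OF c[OF v(2)] c[OF v(3)]])
  qed
  ultimately show ?thesis unfolding tangent_space_def
    by (intro antisym span_minimal) (auto simp: subspace_span)
qed

text \<open>Take any orthonormal basis of the tangent space. The edge vectors are independent, so their
  determinant is not zero, and reversing one basis vector corrects its sign.\<close>

lemma oriented_onb_exists:
  assumes J: "distinct J" "set J \<subseteq> {..DIM('a)}" "length J \<ge> 2"
  shows "\<exists>ts. oriented_onb X J ts"
proof -
  have J0: "J \<noteq> []" using J by auto
  let ?e = "edges J"
  have tri: "\<And>m. m < length ?e \<Longrightarrow> ?e ! m \<notin> span (set (take m ?e))" using edges_triangular[OF J(1,2)] .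
  have ind: "independent (set ?e)" "distinct ?e" using independent_triangular[OF tri] by auto
  have dim: "dim (tangent_space X (set J)) = length J - 1"
    unfolding span_edges[OF J0, symmetric] dim_span
    using dim_eq_card_independent[OF ind(1)] distinct_card[OF ind(2)] by simp
  have "subspace (tangent_space X (set J))" by (simp add: tangent_space_def)
  then obtain B where B: "B \<subseteq> tangent_space X (set J)" "pairwise orthogonal B" "\<And>x. x \<in> B \<Longrightarrow> norm x = 1"
    "independent B" "card B = dim (tangent_space X (set J))" "span B = tangent_space X (set J)"
    using orthonormal_basis_subspace by metis
  have "finite B" using B(4) by (rule independent_imp_finite)
  then obtain ts where ts: "set ts = B" "distinct ts" using finite_distinct_list by metis
  have len: "length ts = length J - 1" using distinct_card[OF ts(2)] ts(1) B(5) dim by simp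
  have on: "\<forall>a<length ts. \<forall>b<length ts. ts ! a \<bullet> ts ! b = (if a = b then 1 else 0)"
  proof (intro allI impI)
    fix a b assume ab: "a < length ts" "b < length ts"
    then have "ts ! a \<in> B" "ts ! b \<in> B" using ts by auto
    then show "ts ! a \<bullet> ts ! b = (if a = b then 1 else 0)"
      using B(2,3) ab ts(2) by (auto simp: pairwise_def orthogonal_def norm_eq_1 nth_eq_iff_index_eq)
  qed
  have sp: "span (set ts) = tangent_space X (set J)" using ts B by simp
  have "set ?e \<subseteq> span (set ts)" unfolding sp span_edges[OF J0, symmetric] by (rule span_superset)
  then obtain d where d: "vol_ratio ts ?e d"
    using vol_ratio_exists[of ?e ts] tri len by auto
  have "gram_form ts ?e = d * gram_form ts ts"
    using d alternating_gram_form by (auto simp: vol_ratio_def)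
  then have nz: "gram_form ts ?e \<noteq> 0" using d gram_form_orthonormal[OF on] by (simp add: vol_ratio_def)
  show ?thesis
  proof (cases "gram_form ts ?e > 0")
    case True
    then show ?thesis using len on sp oriented_onb_gram by blast
  next
    case False
    obtain t ts' where tts: "ts = t # ts'" using len J(3) by (cases ts) auto
    let ?u = "(- t) # ts'"
    have nu: "?u ! a = (if a = 0 then - ts ! a else ts ! a)" for a by (simp add: tts nth_Cons')
    have "(\<Prod>a<length ts. ?u ! a \<bullet> (?e ! \<pi> a)) = - (\<Prod>a<length ts. ts ! a \<bullet> (?e ! \<pi> a))" for \<pi>
      unfolding tts length_Cons prod.lessThan_Suc_shift by simp
    then have "gram_form ?u ?e = - gram_form ts ?e"
      unfolding gram_form_def by (simp add: tts sum_negf)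
    then have 1: "gram_form ?u ?e > 0" using False nz by simp
    have 2: "\<forall>a<length ?u. \<forall>b<length ?u. ?u ! a \<bullet> ?u ! b = (if a = b then 1 else 0)"
    proof (intro allI impI)
      fix a b assume "a < length ?u" "b < length ?u"
      then have "ts ! a \<bullet> ts ! b = (if a = b then 1 else 0)" using on by (simp add: tts)
      then show "?u ! a \<bullet> ?u ! b = (if a = b then 1 else 0)" unfolding nu by (auto split: if_splits)
    qed
    have "span (set ?u) = span (set ts)"
    proof (rule antisym; rule span_minimal)
      show "set ?u \<subseteq> span (set ts)" by (auto simp: tts intro: span_base span_neg)
      have "- (- t) \<in> span (set ?u)" by (rule span_neg) (simp add: span_base)
      then show "set ts \<subseteq> span (set ?u)" by (auto simp: tts intro: span_base)
    qed simp_all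
    then have 3: "span (set ?u) = tangent_space X (set J)" using sp by simp
    have "length ?u = length J - 1" using len by (simp add: tts)
    with 1 2 3 show ?thesis using oriented_onb_gram by blast
  qed
qed

lemma mem_hull_edges:
  assumes J: "distinct J" "set J \<subseteq> {..DIM('a)}" "J \<noteq> []"
  shows "X (J ! 0) + (\<Sum>a<length (edges J). c a *\<^sub>R edges J ! a) \<in> convex hull (X ` set J) \<longleftrightarrow>
     (\<forall>a<length (edges J). 0 \<le> c a) \<and> (\<Sum>a<length (edges J). c a) \<le> 1" (is "?y \<in> _ \<longleftrightarrow> ?R")
proof -
  define s where "s = length (edges J)"
  have s: "length J = Suc s" using J(3) by (simp add: s_def)
  have le: "J ! a \<le> DIM('a)" if "a \<le> s" for a
  proof -
    have "J ! a \<in> set J" using that s by simp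
    then show ?thesis using J(2) by blast
  qed
  have y: "?y = X (J ! 0) + (\<Sum>a<s. c a *\<^sub>R (X (J ! Suc a) - X (J ! 0)))"
    by (simp add: s_def nth_edges)
  have dl: "bary X l ?y = (if l = J ! 0 then 1 else 0) + (\<Sum>a<s. c a * ((if l = J ! Suc a then 1 else 0) - (if l = J ! 0 then 1 else 0)))" for l
    unfolding y bary_add linear_sum[OF linear_dl] linear_scale[OF linear_dl]
    using le by (simp add: bary_vertex dl_vertex_diff)
  show ?thesis
  proof
    assume "?y \<in> convex hull (X ` set J)"
    then have "?y \<in> simplex_S X"
      using J(2) hull_mono[of "X ` set J" "X ` {..DIM('a)}"] by (auto simp: simplex_S_def)
    then have nn: "bary X (J ! a) ?y \<ge> 0" if "a \<le> s" for a using le[OF that] by (simp add: mem_simplex_S)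
    have "0 \<le> c b" if b: "b < s" for b
    proof -
      have "J ! Suc b \<noteq> J ! 0" "\<And>a. a < s \<Longrightarrow> J ! Suc b = J ! Suc a \<longleftrightarrow> a = b"
        using b s J(1,3) nth_eq_iff_index_eq[of J "Suc b"] by auto
      note eq = this
      have S: "(\<Sum>a<s. c a * ((if J ! Suc b = J ! Suc a then 1 else 0) - (if J ! Suc b = J ! 0 then 1 else 0))) =
          (\<Sum>a<s. if a = b then c a else 0)"
        by (intro sum.cong refl) (use eq in simp)
      have "bary X (J ! Suc b) ?y = (\<Sum>a<s. if a = b then c a else 0)"
        unfolding dl S using eq(1) by simp
      then show ?thesis using nn[of "Suc b"] b by simp
    qed
    moreover have "bary X (J ! 0) ?y = 1 + (\<Sum>a<s. - c a)"
    proof -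
      have "J ! 0 \<noteq> J ! Suc a" if "a < s" for a
        using that s J(1,3) nth_eq_iff_index_eq[of J 0 "Suc a"] by auto
      then have S: "(\<Sum>a<s. c a * ((if J ! 0 = J ! Suc a then 1 else 0) - (if J ! 0 = J ! 0 then 1 else 0))) =
          (\<Sum>a<s. - c a)"
        by (intro sum.cong refl) simp
      show ?thesis unfolding dl S by simp
    qed
    ultimately show ?R using nn[of 0] by (simp add: s_def sum_negf)
  next
    assume R: ?R
    have "?y = (1 - (\<Sum>a<s. c a)) *\<^sub>R X (J ! 0) + (\<Sum>a<s. c a *\<^sub>R X (J ! Suc a))"
      unfolding y by (simp add: scaleR_diff_right sum_subtractf scaleR_diff_left scaleR_left.sum)
    also have "\<dots> = (\<Sum>a<Suc s. (if a = 0 then 1 - (\<Sum>a<s. c a) else c (a - 1)) *\<^sub>R X (J ! a))"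
      unfolding sum.lessThan_Suc_shift by simp
    also have "\<dots> \<in> convex hull (X ` set J)"
    proof (rule convex_sum)
      show "(\<Sum>i<Suc s. if i = 0 then 1 - sum c {..<s} else c (i - 1)) = 1"
        unfolding sum.lessThan_Suc_shift by simp
      fix i assume i: "i \<in> {..<Suc s}"
      then show "0 \<le> (if i = 0 then 1 - sum c {..<s} else c (i - 1))" using R by (auto simp: s_def)
      show "X (J ! i) \<in> convex hull (X ` set J)" using i s by (intro hull_inc) auto
    qed auto
    finally show "?y \<in> convex hull (X ` set J)" .
  qed
qed

text \<open>The value of an alternating map on an orthonormal frame, integrated over the simplex, is its value on
  the edge vectors over \<open>s!\<close>.\<close>

lemma simplex_volume:
  assumes J: "distinct J" "set J \<subseteq> {..DIM('a)}" "length J = Suc s" and onb: "oriented_onb X J ts"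
    and \<omega>: "alternating_map s \<omega>"
  shows "emeasure (flat_measure (X (J ! 0)) ts) (convex hull (X ` set J)) < \<infinity>"
    and "measure (flat_measure (X (J ! 0)) ts) (convex hull (X ` set J)) * \<omega> ts = \<omega> (edges J) / fact s"
proof -
  let ?e = "edges J" and ?H = "convex hull (X ` set J)" and ?b = "X (J ! 0)"
  have J0: "J \<noteq> []" using J by auto
  have ts: "length ts = s" "\<forall>a<length ts. \<forall>b<length ts. ts ! a \<bullet> ts ! b = (if a = b then 1 else 0)"
    "span (set ts) = tangent_space X (set J)" "gram_form ts ?e > 0"
    using onb J(3) by (auto simp: oriented_onb_gram)
  have "set ?e \<subseteq> span (set ts)" unfolding ts(3) span_edges[OF J0, symmetric] by (rule span_superset)
  then obtain d where d: "vol_ratio ts ?e d"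
    using vol_ratio_exists[of ?e ts] edges_triangular[OF J(1,2)] ts(1) J(3) by auto
  have "gram_form ts ?e = d * gram_form ts ts"
    using d alternating_gram_form by (auto simp: vol_ratio_def)
  then have d0: "d > 0" using ts(4) gram_form_orthonormal[OF ts(2)] by simp
  have "compact ?H" by (intro compact_convex_hull finite_imp_compact) simp
  then have H: "?H \<in> sets borel" by (intro borel_closed compact_imp_closed)
  have es: "length ?e = s" using J(3) by simp
  have meas: "(\<lambda>c. ?b + (\<Sum>a<s. c a *\<^sub>R ?e ! a)) \<in>
      measurable (Pi\<^sub>M {..<s} (\<lambda>_. lborel :: real measure)) borel"
    by measurable
  have "emeasure (flat_measure ?b ?e) ?H =
     emeasure (Pi\<^sub>M {..<s} (\<lambda>_. lborel :: real measure)) ((\<lambda>c. ?b + (\<Sum>a<s. c a *\<^sub>R ?e ! a)) -` ?H \<inter> space (Pi\<^sub>M {..<s} (\<lambda>_. lborel :: real measure)))"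
    unfolding flat_measure_def es using meas H by (rule emeasure_distr)
  also have "(\<lambda>c. ?b + (\<Sum>a<s. c a *\<^sub>R ?e ! a)) -` ?H = {c. (\<forall>i\<in>{..<s}. 0 \<le> c i) \<and> sum c {..<s} \<le> 1}"
    using mem_hull_edges[OF J(1,2) J0] unfolding es by auto
  also have "emeasure (Pi\<^sub>M {..<s} (\<lambda>_. lborel :: real measure)) ({c. (\<forall>i\<in>{..<s}. 0 \<le> c i) \<and> sum c {..<s} \<le> 1} \<inter>
      space (Pi\<^sub>M {..<s} (\<lambda>_. lborel :: real measure))) = ennreal (1 / fact s)"
    using emeasure_std_simplex_aux[of "{..<s}" 1] by simp
  finally have "emeasure (flat_measure ?b ts) ?H = ennreal (d / fact s)"
    using d H d0 by (simp add: vol_ratio_def ennreal_mult[symmetric])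
  then show "emeasure (flat_measure ?b ts) ?H < \<infinity>"
    and "measure (flat_measure ?b ts) ?H * \<omega> ts = \<omega> ?e / fact s"
    using d \<omega> d0 ts(1) by (simp_all add: measure_def vol_ratio_def)
qed

end

section \<open>Boundary forms near one facet\<close>

lemma alternating_map_zero: "alternating_map k (\<lambda>_. 0)"
  by (simp add: alternating_map_def linear_zero)

lemma alternating_map_diff_add:
  assumes "alternating_map k f" "alternating_map k g" "alternating_map k h"
  shows "alternating_map k (\<lambda>vs. f vs + (g vs - h vs))"
proof (rule alternating_mapI)
  fix xs ys :: "'a list" assume l: "length xs + length ys + 1 = k"
  have "linear (\<lambda>v. f (xs @ v # ys))" "linear (\<lambda>v. g (xs @ v # ys))" "linear (\<lambda>v. h (xs @ v # ys))"
    using alternating_map_linear[OF assms(1) l] alternating_map_linear[OF assms(2) l]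
      alternating_map_linear[OF assms(3) l] by auto
  then show "linear (\<lambda>v. f (xs @ v # ys) + (g (xs @ v # ys) - h (xs @ v # ys)))"
    by (intro linear_compose_add linear_compose_sub)
next
  fix vs :: "'a list" assume "length vs = k" "\<not> distinct vs"
  then show "f vs + (g vs - h vs) = 0"
    using alternating_map_not_distinct[OF assms(1)] alternating_map_not_distinct[OF assms(2)]
      alternating_map_not_distinct[OF assms(3)] by simp
qed

lemma alternating_map_compose:
  fixes f :: "'a::real_vector list \<Rightarrow> real" and g :: "'a \<Rightarrow> 'a"
  assumes f: "alternating_map k f" and g: "linear g"
  shows "alternating_map k (\<lambda>vs. f (map g vs))"
proof (rule alternating_mapI)
  fix xs ys :: "'a list" assume l: "length xs + length ys + 1 = k"
  have "linear (\<lambda>v. f (map g xs @ v # map g ys))"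
    by (rule alternating_map_linear[OF f]) (use l in simp)
  from linear_compose[OF g this] show "linear (\<lambda>v. f (map g (xs @ v # ys)))" by (simp add: o_def)
next
  fix vs :: "'a list" assume "length vs = k" "\<not> distinct vs"
  then show "f (map g vs) = 0" using distinct_map
    by (intro alternating_map_not_distinct[OF f]) auto
qed

context nondeg_simplex
begin

text \<open>A form \<open>w\<close>, defined for all tangent vectors of the ambient space, that represents \<open>u\<close> on the facet
  opposite to vertex \<open>i\<close>.\<close>

definition facet_form :: "nat \<Rightarrow> 'a form \<Rightarrow> nat \<Rightarrow> 'a form \<Rightarrow> bool" where
  "facet_form k u i w \<longleftrightarrow> (\<forall>x\<in>facet X i. alternating_map k (w x)) \<and>
     (\<forall>vs. length vs = k \<longrightarrow> continuous_on (facet X i) (\<lambda>x. w x vs)) \<and>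
     (\<forall>x\<in>facet X i. \<forall>vs. length vs = k \<longrightarrow> (\<forall>v\<in>set vs. dl i v = 0) \<longrightarrow> u x vs = w x vs)"

lemma facet_form_exists:
  assumes "u \<in> boundary_forms X k" "i \<le> DIM('a)"
  shows "\<exists>w. facet_form k u i w"
proof -
  obtain U w where U: "open U" "facet X i \<subseteq> U" "w \<in> smooth_forms k U"
    "\<forall>x\<in>facet X i. \<forall>vs. length vs = k \<longrightarrow> set vs \<subseteq> facet_tangent X i \<longrightarrow> u x vs = w x vs"
    using assms unfolding boundary_forms_def by blast
  have "continuous_on (facet X i) (\<lambda>x. w x vs)" if "length vs = k" for vs
  proof -
    have "\<forall>m. Ck_on m U (\<lambda>x. w x vs)" using U(3) that unfolding smooth_forms_def by blast
    then have "Ck_on 0 U (\<lambda>x. w x vs)" by (rule spec)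
    then show ?thesis using U(2) continuous_on_subset by auto
  qed
  moreover have "alternating_map k (w x)" if "x \<in> facet X i" for x
    using U(2,3) that by (auto simp: smooth_forms_def)
  ultimately have "facet_form k u i w"
    using U(4) by (auto simp: facet_form_def facet_tangent_eq[OF assms(2)] subset_iff)
  then show ?thesis by blast
qed

text \<open>Alternating maps on several coordinate hyperplanes which agree on the intersections come from
  one alternating map on the whole space: correct one hyperplane at a time, along projections that
  preserve all other hyperplanes.\<close>

lemma common_extension:
  assumes "finite N" "N \<subseteq> {..DIM('a)}" "q \<le> DIM('a)" "q \<notin> N" "\<And>i. i \<in> N \<Longrightarrow> alternating_map k (w i)"
    and "\<And>i j vs. i \<in> N \<Longrightarrow> j \<in> N \<Longrightarrow> length vs = k \<Longrightarrow> (\<And>v. v \<in> set vs \<Longrightarrow> dl i v = 0) \<Longrightarrow>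
      (\<And>v. v \<in> set vs \<Longrightarrow> dl j v = 0) \<Longrightarrow> w i vs = w j vs"
  shows "\<exists>\<omega>. alternating_map k \<omega> \<and>
    (\<forall>i\<in>N. \<forall>vs. length vs = k \<longrightarrow> (\<forall>v\<in>set vs. dl i v = 0) \<longrightarrow> \<omega> vs = w i vs)"
  using assms
proof (induction N rule: finite_induct)
  case empty
  then show ?case using alternating_map_zero by auto
next
  case (insert i N)
  have "\<exists>\<omega>. alternating_map k \<omega> \<and>
    (\<forall>i\<in>N. \<forall>vs. length vs = k \<longrightarrow> (\<forall>v\<in>set vs. dl i v = 0) \<longrightarrow> \<omega> vs = w i vs)"
  proof (rule insert.IH)
    fix j l vs assume "j \<in> N" "l \<in> N" "length vs = k"
      "\<And>v. v \<in> set vs \<Longrightarrow> dl j v = 0" "\<And>v. v \<in> set vs \<Longrightarrow> dl l v = 0"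
    then show "w j vs = w l vs" using insert.prems(5)[of j l vs] by simp
  qed (use insert.prems in auto)
  then obtain \<omega> where \<omega>: "alternating_map k \<omega>"
    "\<And>j vs. j \<in> N \<Longrightarrow> length vs = k \<Longrightarrow> (\<And>v. v \<in> set vs \<Longrightarrow> dl j v = 0) \<Longrightarrow> \<omega> vs = w j vs" by metis
  \<comment> \<open>the projection onto hyperplane \<open>i\<close> along an edge that is tangent to all other hyperplanes\<close>
  define \<rho> where "\<rho> v = v - dl i v *\<^sub>R (X i - X q)" for v
  have iq: "i \<le> DIM('a)" "q \<le> DIM('a)" "i \<noteq> q" using insert.prems by auto
  have lin: "linear \<rho>"
    unfolding \<rho>_def by (auto intro!: linearI simp: linear_add[OF linear_dl] linear_scale[OF linear_dl] algebra_simps)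
  have \<rho>: "dl j (\<rho> v) = (if j = i then 0 else dl j v)" if "j \<in> insert i N" for j v
  proof -
    have "j \<noteq> q" using that insert.prems(3) by auto
    then have "dl j (X i - X q) = (if j = i then 1 else 0)"
      using iq dl_vertex_diff[of q j "X i"] by (simp add: bary_vertex)
    then show ?thesis
      using linear_diff[OF linear_dl, of j v "dl i v *\<^sub>R (X i - X q)"]
        linear_scale[OF linear_dl, of j "dl i v" "X i - X q"] by (simp add: \<rho>_def)
  qed
  have \<rho>_id: "map \<rho> vs = vs" if "\<And>v. v \<in> set vs \<Longrightarrow> dl i v = 0" for vs
    using that by (simp add: \<rho>_def map_idI)
  define \<omega>' where "\<omega>' vs = \<omega> vs + (w i (map \<rho> vs) - \<omega> (map \<rho> vs))" for vs
  have "alternating_map k \<omega>'"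
    unfolding \<omega>'_def using insert.prems(4)[of i] \<omega>(1) lin
    by (intro alternating_map_diff_add alternating_map_compose) auto
  moreover have "\<omega>' vs = w j vs" if j: "j \<in> insert i N" and vs: "length vs = k" "\<And>v. v \<in> set vs \<Longrightarrow> dl j v = 0" for j vs
  proof (cases "j = i")
    case True
    then show ?thesis using \<rho>_id[of vs] vs by (simp add: \<omega>'_def)
  next
    case False
    then have jN: "j \<in> N" using j by simp
    have "\<omega> (map \<rho> vs) = w j (map \<rho> vs)"
      using jN vs \<rho>[OF j] False by (intro \<omega>(2)) auto
    also have "\<dots> = w i (map \<rho> vs)"
      using vs \<rho>[OF j] \<rho>[of i] False j by (intro insert.prems(5)) auto
    finally show ?thesis using \<omega>(2)[OF jN vs] by (simp add: \<omega>'_def)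
  qed
  ultimately show ?case by blast
qed

section \<open>Continuity of the operators R and A\<close>

text \<open>Dominated convergence, with the maximum of \<open>\<bar>g\<bar>\<close> on the compact set \<open>D\<close> as bound.\<close>

lemma continuous_on_flat_integral:
  fixes g :: "'a \<Rightarrow> real" and M :: "'a measure" and F :: "'a \<Rightarrow> 'a \<Rightarrow> 'a"
  assumes K: "compact K" and M: "sets M = sets borel" "emeasure M K < \<infinity>"
    and D: "compact D" "continuous_on D g"
    and F: "\<And>z y. z \<in> S \<Longrightarrow> y \<in> K \<Longrightarrow> F z y \<in> D" "\<And>y. y \<in> K \<Longrightarrow> continuous_on S (\<lambda>z. F z y)"
      "\<And>z. z \<in> S \<Longrightarrow> continuous_on K (F z)"
  shows "continuous_on S (\<lambda>z. LINT y : K | M. g (F z y))"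
  unfolding continuous_on_sequentially
proof (intro allI impI ballI)
  fix xs and x assume x: "x \<in> S" and xs: "(\<forall>n. xs n \<in> S) \<and> xs \<longlonglongrightarrow> x"
  have "bounded (g ` D)" using D compact_continuous_image compact_imp_bounded by blast
  then obtain B where B: "\<And>z. z \<in> D \<Longrightarrow> \<bar>g z\<bar> \<le> B" by (auto simp: bounded_iff)
  have Kb: "K \<in> sets M" using K by (simp add: M compact_imp_closed)
  have meas: "(\<lambda>y. indicator K y *\<^sub>R g (F z y)) \<in> borel_measurable M" if z: "z \<in> S" for z
  proof -
    have "continuous_on K (\<lambda>y. g (F z y))"
      using continuous_on_compose2[OF D(2) F(3)[OF z]] F(1)[OF z] by blast
    then have "(\<lambda>y. indicator K y *\<^sub>R g (F z y)) \<in> borel_measurable borel"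
      using K by (intro borel_measurable_continuous_on_indicator) (auto simp: compact_imp_closed)
    then show ?thesis using measurable_cong_sets[OF M(1) refl] by blast
  qed
  have cont: "continuous_on S (\<lambda>z. g (F z y))" if "y \<in> K" for y
    using continuous_on_compose2[OF D(2) F(2)[OF that]] F(1)[OF _ that] by blast
  have "(\<lambda>n. LINT y|M. indicator K y *\<^sub>R g (F (xs n) y)) \<longlonglongrightarrow> (LINT y|M. indicator K y *\<^sub>R g (F x y))"
  proof (rule integral_dominated_convergence)
    show "integrable M (\<lambda>y. indicator K y *\<^sub>R B)"
      using Kb M(2) by (intro integrable_scaleR_left integrable_real_indicator) auto
    show "AE y in M. (\<lambda>n. indicator K y *\<^sub>R g (F (xs n) y)) \<longlonglongrightarrow> indicator K y *\<^sub>R g (F x y)"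
    proof (intro AE_I2)
      fix y
      show "(\<lambda>n. indicator K y *\<^sub>R g (F (xs n) y)) \<longlonglongrightarrow> indicator K y *\<^sub>R g (F x y)"
      proof (cases "y \<in> K")
        case True
        have "((\<lambda>z. g (F z y)) \<circ> xs) \<longlonglongrightarrow> g (F x y)"
          using cont[OF True] x xs unfolding continuous_on_sequentially by blast
        then show ?thesis using True by (simp add: o_def)
      qed simp
    qed
    show "AE y in M. norm (indicator K y *\<^sub>R g (F (xs n) y)) \<le> indicator K y *\<^sub>R B" for n
      using B F(1) xs by (intro AE_I2) (auto simp: indicator_def)
  qed (use meas x xs in auto)
  then show "((\<lambda>z. LINT y : K | M. g (F z y)) \<circ> xs) \<longlonglongrightarrow> (LINT y : K | M. g (F x y))"
    by (simp add: set_lebesgue_integral_def o_def)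
qed

lemma hull_diff_tangent:
  assumes "y \<in> convex hull (X ` A)" "a \<in> A"
  shows "y - X a \<in> tangent_space X A"
proof -
  have sub: "subspace (tangent_space X A)" by (simp add: tangent_space_def)
  have "convex {y. y - X a \<in> tangent_space X A}"
  proof (rule convexI)
    fix x y and s t :: real
    assume xy: "x \<in> {y. y - X a \<in> tangent_space X A}" "y \<in> {y. y - X a \<in> tangent_space X A}"
      and st: "0 \<le> s" "0 \<le> t" "s + t = 1"
    have "s *\<^sub>R x + t *\<^sub>R y - (s + t) *\<^sub>R X a = s *\<^sub>R (x - X a) + t *\<^sub>R (y - X a)"
      by (simp add: algebra_simps)
    moreover have "\<dots> \<in> tangent_space X A" using xy sub by (auto intro: subspace_add subspace_scale)
    ultimately show "s *\<^sub>R x + t *\<^sub>R y \<in> {y. y - X a \<in> tangent_space X A}" using st by simp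
  qed
  moreover have "X ` A \<subseteq> {y. y - X a \<in> tangent_space X A}"
    using assms(2) by (auto simp: tangent_space_def intro!: span_base)
  ultimately have "convex hull (X ` A) \<subseteq> {y. y - X a \<in> tangent_space X A}" by (intro hull_minimal)
  then show ?thesis using assms(1) by auto
qed

text \<open>One alternating map on the whole space that restricts to the values of \<open>u\<close> at \<open>x\<close> on each facet
  through \<open>x\<close>.\<close>

definition agrees_at :: "nat \<Rightarrow> 'a form \<Rightarrow> 'a \<Rightarrow> ('a list \<Rightarrow> real) \<Rightarrow> bool" where
  "agrees_at k u x \<omega> \<longleftrightarrow> alternating_map k \<omega> \<and> (\<forall>i\<le>DIM('a). x \<in> facet X i \<longrightarrow>
     (\<forall>vs. length vs = k \<longrightarrow> (\<forall>v\<in>set vs. dl i v = 0) \<longrightarrow> \<omega> vs = u x vs))"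

text \<open>The tangential directions of \<open>[x\<^sub>J]\<close> absorb the dependence of the derivative of \<open>F\<close> on \<open>y\<close>, so
  that \<open>y\<close> may be replaced by a vertex.\<close>

lemma Rop_regular:
  assumes u: "u \<in> boundary_forms X k" and I: "set I \<subseteq> {..DIM('a)}" and s: "1 \<le> s" "s \<le> k"
    and J: "distinct J" "set J \<subseteq> {..DIM('a)}" "length J = Suc s" and i: "i \<in> set I" "i \<notin> set J"
  shows "\<exists>C. (\<forall>z\<in>simplex_S X. \<forall>ws. length ws = k - s \<longrightarrow> Rop X k I J u z ws = bsum (set I) z ^ s * C z ws) \<and>
    (\<forall>ws. length ws = k - s \<longrightarrow> continuous_on (simplex_S X) (\<lambda>z. C z ws)) \<and>
    (\<forall>x\<in>simplex_S X. \<forall>\<omega> ws. bsum (set I) x = 0 \<longrightarrow> agrees_at k u x \<omega> \<longrightarrow> length ws = k - s \<longrightarrow>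
       C x ws = \<omega> (map (dF (set I) (X (hd J))) ws @ edges J) / fact s)"
proof -
  define ts where "ts = (SOME ts. oriented_onb X J ts)"
  have "\<exists>ts. oriented_onb X J ts"
    by (rule oriented_onb_exists[OF J(1,2)]) (use J(3) s in simp)
  then have onb: "oriented_onb X J ts" unfolding ts_def by (rule someI_ex)
  have J0: "J \<noteq> []" using J(3) by auto
  have hdJ: "hd J = J ! 0" by (rule hd_conv_nth[OF J0])
  have lts: "length ts = s" and sp: "span (set ts) = tangent_space X (set J)"
    using onb J(3) by (auto simp: oriented_onb_gram)
  have in': "i \<le> DIM('a)" using I i by auto
  obtain w where w: "facet_form k u i w" using facet_form_exists[OF u in'] by blast
  define K where "K = convex hull (X ` set J)"
  define M where "M = flat_measure (X (J ! 0)) ts"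
  define G where "G = dF (set I) (X (hd J))"
  define C where "C z ws = (LINT y : K | M. w (Fmap X I z y) (map G ws @ ts))" for z ws
  have M: "sets M = sets borel" by (simp add: M_def flat_measure_def)
  have K: "compact K" unfolding K_def by (intro compact_convex_hull finite_imp_compact) simp
  have fin: "emeasure M K < \<infinity>"
    unfolding M_def K_def by (rule simplex_volume(1)[OF J onb alternating_map_zero])
  have tts: "dl i t = 0" if "t \<in> set ts" for t
    using tangent_space_dl[OF J(2) i(2), of t] sp that span_base by metis
  have dG: "dl i (dF (set I) y v) = 0" if "bary X i y = 0" for y v
    using dl_dF[OF I, of i y v] i(1) that by simp
  have hd: "hd J \<in> set J" "bary X i (X (hd J)) = 0"
  proof -
    show 1: "hd J \<in> set J" using J0 by simp
    then have "hd J \<le> DIM('a)" "i \<noteq> hd J" using J(2) i(2) by auto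
    then show "bary X i (X (hd J)) = 0" by (simp add: bary_vertex)
  qed
  have tG: "\<forall>v\<in>set (map G ws @ ts). dl i v = 0" for ws
    using tts dG[OF hd(2)] by (auto simp: G_def)
  have F: "Fmap X I z y \<in> facet X i" if "z \<in> simplex_S X" "y \<in> K" for z y
    using Fmap_facet[OF I that(1) J(2) _ i] that(2) by (simp add: K_def)
  have R: "Rop X k I J u z ws = bsum (set I) z ^ s * C z ws"
    if z: "z \<in> simplex_S X" and ws: "length ws = k - s" for z ws
  proof -
    have "u (Fmap X I z y) (map (frechet_derivative (\<lambda>z. Fmap X I z y) (at z)) ws @ ts) =
        w (Fmap X I z y) (map G ws @ ts)" if y: "y \<in> K" for y
    proof -
      have l: "length (map g ws @ ts) = k" for g :: "'a \<Rightarrow> 'a" using ws lts s by simp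
      \<comment> \<open>so the vectors are tangent to the facet, where \<open>u\<close> is defined\<close>
      have by0: "bary X i y = 0"
      proof -
        have "dl i (y - X (hd J)) = 0"
          using hull_diff_tangent[of y "set J" "hd J"] y hd(1) tangent_space_dl[OF J(2) i(2)] by (simp add: K_def)
        moreover have "hd J \<le> DIM('a)" using hd(1) J(2) by auto
        ultimately show ?thesis using hd(1) i(2) by (auto simp: dl_vertex_diff split: if_splits)
      qed
      have "u (Fmap X I z y) (map (dF (set I) y) ws @ ts) = w (Fmap X I z y) (map (dF (set I) y) ws @ ts)"
      proof -
        have "\<forall>v\<in>set (map (dF (set I) y) ws @ ts). dl i v = 0" using tts dG[OF by0] by auto
        then show ?thesis using w F[OF z y] l[of "dF (set I) y"] unfolding facet_form_def by blast
      qed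
      also have "\<dots> = w (Fmap X I z y) (map G ws @ ts)"
      proof (rule alternating_map_shift)
        show "alternating_map k (w (Fmap X I z y))" using w F[OF z y] by (simp add: facet_form_def)
        show "length ws + length ts = k" using ws lts s by simp
        fix v
        show "dF (set I) y v - G v \<in> span (set ts)"
          unfolding G_def dF_shift sp using hull_diff_tangent[of y "set J" "hd J"] y hd(1)
          by (simp add: K_def tangent_space_def span_scale)
      qed
      finally show ?thesis by (simp add: frechet_Fmap)
    qed
    then have "(LINT y : K | M. u (Fmap X I z y) (map (frechet_derivative (\<lambda>z. Fmap X I z y) (at z)) ws @ ts)) = C z ws"
      unfolding C_def using M K by (intro set_lebesgue_integral_cong) (auto simp: compact_imp_closed)
    then show ?thesis
      using s J(3) by (simp add: Rop_def Let_def ts_def[symmetric] K_def M_def bary_sum_eq)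
  qed
  have cont: "continuous_on (simplex_S X) (\<lambda>z. C z ws)" if "length ws = k - s" for ws
    unfolding C_def
  proof (rule continuous_on_flat_integral[OF K M fin compact_facet[of i], where g = "\<lambda>x. w x (map G ws @ ts)"])
    show "continuous_on (facet X i) (\<lambda>x. w x (map G ws @ ts))"
      using w that lts s by (simp add: facet_form_def)
  qed (use F continuous_on_Fmap continuous_on_Fmap' in auto)
  have frz: "C x ws = \<omega> (map G ws @ edges J) / fact s"
    if x: "x \<in> simplex_S X" "bsum (set I) x = 0" and \<omega>: "agrees_at k u x \<omega>" and ws: "length ws = k - s" for x \<omega> ws
  proof -
    have l: "length (map G ws @ ts) = k" using ws lts s by simp
    have xi: "x \<in> facet X i"
    proof -
      have "0 \<le> bary X i x" "bary X i x \<le> bsum (set I) x"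
        using x in' bary_le_bsum[OF x(1) I i(1)] by (auto simp: mem_simplex_S)
      then show ?thesis using x by (auto simp: facet_def)
    qed
    have e: "w x (map G ws @ ts) = \<omega> (map G ws @ ts)"
    proof -
      have "u x (map G ws @ ts) = w x (map G ws @ ts)"
        using w xi l tG[of ws] unfolding facet_form_def by blast
      moreover have "\<omega> (map G ws @ ts) = u x (map G ws @ ts)"
        using \<omega> xi in' l tG[of ws] unfolding agrees_at_def by blast
      ultimately show ?thesis by simp
    qed
    have "C x ws = (LINT y : K | M. \<omega> (map G ws @ ts))"
      unfolding C_def Fmap_degenerate[OF I x] e ..
    also have "\<dots> = measure M K * \<omega> (map G ws @ ts)"
      using K M fin by (subst set_integral_const) (auto simp: compact_imp_closed)
    also have "\<dots> = \<omega> (map G ws @ edges J) / fact s"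
    proof -
      have "alternating_map s (\<lambda>zs. \<omega> (map G ws @ zs @ []))"
        using \<omega> ws s by (intro alternating_map_append) (auto simp: agrees_at_def)
      then have "alternating_map s (\<lambda>zs. \<omega> (map G ws @ zs))" by simp
      from simplex_volume(2)[OF J onb this] show ?thesis by (simp add: M_def K_def)
    qed
    finally show ?thesis .
  qed
  show ?thesis using R cont frz unfolding G_def by (intro exI[of _ C]) blast
qed

text \<open>\<open>C\<close> is \<open>A\<^sub>I\<^sub>J u\<close> with its factor \<open>\<lambda>\<^sub>I\<^sup>s\<close> split off: it is continuous up to the zeros of \<open>\<lambda>\<^sub>I\<close>, where
  \<open>F\<^sub>I\<close> is the identity in \<open>x\<close> and only the value of \<open>u\<close> at \<open>x\<close> enters.\<close>

definition regular_factor :: "nat \<Rightarrow> nat list \<Rightarrow> nat list \<Rightarrow> 'a form \<Rightarrow> 'a form \<Rightarrow> bool" where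
  "regular_factor k I J u C \<longleftrightarrow> (let s = length J - 1 in
    (\<forall>z\<in>simplex_S X. \<forall>ws. length ws = k - s \<longrightarrow> Aop X k I J u z ws = bsum (set I) z ^ s * C z ws) \<and>
    (\<forall>ws. length ws = k - s \<longrightarrow> continuous_on (simplex_S X) (\<lambda>z. C z ws)) \<and>
    (\<forall>x\<in>simplex_S X. \<forall>\<omega> ws. bsum (set I) x = 0 \<longrightarrow> agrees_at k u x \<omega> \<longrightarrow> length ws = k - s \<longrightarrow>
       C x ws = stationaryA k (set I) J \<omega> ws))"

lemma Aop_regular_vertex:
  assumes u: "u \<in> boundary_forms X k" and I: "set I \<subseteq> {..DIM('a)}" "2 \<le> card (set I)" and j: "j \<in> set I"
  shows "\<exists>C. regular_factor k I [j] u C"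
proof -
  have "\<not> set I \<subseteq> {j}" using I(2) card_mono[of "{j}" "set I"] by auto
  then obtain i where i: "i \<in> set I" "i \<noteq> j" by auto
  have ij: "i \<le> DIM('a)" "j \<le> DIM('a)" using I i j by auto
  obtain w where w: "facet_form k u i w" using facet_form_exists[OF u ij(1)] by blast
  define G where "G = dF (set I) (X j)"
  define C where "C z ws = w (Fmap X I z (X j)) (map G ws)" for z ws
  have F: "Fmap X I z (X j) \<in> facet X i" if "z \<in> simplex_S X" for z
    using Fmap_facet[OF I(1) that, of "{j}" "X j" i] ij i by (simp add: hull_inc)
  have tG: "\<forall>v\<in>set (map G ws). dl i v = 0" for ws
    using dl_dF[OF I(1), of i "X j"] i ij by (auto simp: G_def bary_vertex)
  have A: "Aop X k I [j] u z ws = C z ws" if z: "z \<in> simplex_S X" and ws: "length ws = k" for z ws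
  proof -
    have "Aop X k I [j] u z ws = u (Fmap X I z (X j)) (map G ws)"
      by (simp add: Aop_def Let_def pullback_def frechet_Pmap G_def Pmap_def)
    also have "\<dots> = C z ws"
      using w F[OF z] tG[of ws] ws unfolding facet_form_def C_def by simp
    finally show ?thesis .
  qed
  have cont: "continuous_on (simplex_S X) (\<lambda>z. C z ws)" if "length ws = k" for ws
  proof -
    have "continuous_on (facet X i) (\<lambda>x. w x (map G ws))" using w that by (simp add: facet_form_def)
    then show ?thesis unfolding C_def
      by (rule continuous_on_compose2[OF _ continuous_on_Fmap]) (use F in blast)
  qed
  have frz: "C x ws = stationaryA k (set I) [j] \<omega> ws"
    if x: "x \<in> simplex_S X" "bsum (set I) x = 0" and \<omega>: "agrees_at k u x \<omega>" and ws: "length ws = k" for x \<omega> ws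
  proof -
    have xi: "x \<in> facet X i" using F[OF x(1)] Fmap_degenerate[OF I(1) x] by simp
    have "C x ws = u x (map G ws)"
      using w xi tG[of ws] ws unfolding facet_form_def C_def Fmap_degenerate[OF I(1) x] by simp
    also have "\<dots> = \<omega> (map G ws)"
      using \<omega> xi ij(1) tG[of ws] ws unfolding agrees_at_def by simp
    finally show ?thesis by (simp add: stationaryA_def G_def)
  qed
  show ?thesis using A cont frz by (intro exI[of _ C]) (simp add: regular_factor_def Let_def)
qed

lemma Aop_regular:
  assumes u: "u \<in> boundary_forms X k" and I: "set I \<subseteq> {..DIM('a)}" "2 \<le> card (set I)"
    and s: "s \<le> k" and J: "J \<in> sorted_lists (set I) (Suc s)"
  shows "\<exists>C. regular_factor k I J u C"
proof (cases "s = 0")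
  case True
  then obtain j where "J = [j]" using J by (auto simp: sorted_lists_def length_Suc_conv)
  then show ?thesis using Aop_regular_vertex[OF u I, of j] J by (simp add: sorted_lists_def)
next
  case False
  have J': "distinct J" "set J \<subseteq> set I" "length J = Suc s"
    using J by (auto simp: sorted_lists_def strict_sorted_iff)
  let ?P = "{..DIM('a)} - set J"
  define Q where "Q p i C \<longleftrightarrow>
    (\<forall>z\<in>simplex_S X. \<forall>ws. length ws = k - s \<longrightarrow> Rop X k I (p # omit i J) u z ws = bsum (set I) z ^ s * C z ws) \<and>
    (\<forall>ws. length ws = k - s \<longrightarrow> continuous_on (simplex_S X) (\<lambda>z. C z ws)) \<and>
    (\<forall>x\<in>simplex_S X. \<forall>\<omega> ws. bsum (set I) x = 0 \<longrightarrow> agrees_at k u x \<omega> \<longrightarrow> length ws = k - s \<longrightarrow>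
       C x ws = \<omega> (map (dF (set I) (X p)) ws @ map (\<lambda>j. X j - X p) (omit i J)) / fact s)" for p i C
  have "\<exists>C. p \<in> ?P \<longrightarrow> i \<le> s \<longrightarrow> Q p i C" for p i
  proof (cases "p \<in> ?P \<and> i \<le> s")
    case True
    have Jsp: "J = take i J @ J ! i # drop (Suc i) J" using J'(3) True by (simp add: id_take_nth_drop)
    have d: "distinct (take i J @ J ! i # drop (Suc i) J)" using J'(1) Jsp by simp
    have om: "distinct (omit i J)" "J ! i \<notin> set (omit i J)" using d by (auto simp: omit_def)
    have sub: "set (omit i J) \<subseteq> set J"
      unfolding omit_def using set_take_subset[of i J] set_drop_subset[of "Suc i" J] by auto
    have Ji: "J ! i \<in> set J" using J'(3) True by simp
    have 1: "1 \<le> s" using False by simp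
    have 2: "distinct (p # omit i J)" "set (p # omit i J) \<subseteq> {..DIM('a)}" "length (p # omit i J) = Suc s"
      "J ! i \<in> set I" "J ! i \<notin> set (p # omit i J)"
      using om sub Ji J' I True by auto
    from Rop_regular[OF u I(1) 1 s 2] show ?thesis
      unfolding Q_def by (auto simp: edges_def)
  qed auto
  then obtain C where C: "\<And>p i. p \<in> ?P \<Longrightarrow> i \<le> s \<Longrightarrow> Q p i (C p i)" by metis
  define CA where "CA z ws = c_coeff DIM('a) k s * (\<Sum>p\<in>?P. \<Sum>i=0..s. (-1) ^ i * C p i z ws)" for z ws
  have A: "Aop X k I J u z ws = bsum (set I) z ^ s * CA z ws"
    if "z \<in> simplex_S X" "length ws = k - s" for z ws
  proof -
    have "(\<Sum>p\<in>?P. \<Sum>i=0..s. (-1) ^ i * Rop X k I (p # omit i J) u z ws) =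
       (\<Sum>p\<in>?P. \<Sum>i=0..s. bsum (set I) z ^ s * ((-1) ^ i * C p i z ws))"
    proof (intro sum.cong refl)
      fix p i assume "p \<in> ?P" "i \<in> {0..s}"
      then have "Q p i (C p i)" using C by simp
      then have "Rop X k I (p # omit i J) u z ws = bsum (set I) z ^ s * C p i z ws"
        using that unfolding Q_def by blast
      then show "(-1) ^ i * Rop X k I (p # omit i J) u z ws = bsum (set I) z ^ s * ((-1) ^ i * C p i z ws)"
        by simp
    qed
    then show ?thesis using False J'(3)
      by (simp add: Aop_def Let_def CA_def sum_distrib_left[symmetric])
  qed
  have cont: "continuous_on (simplex_S X) (\<lambda>z. CA z ws)" if "length ws = k - s" for ws
    unfolding CA_def
  proof (intro continuous_on_mult continuous_on_sum continuous_on_const)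
    fix p i assume "p \<in> ?P" "i \<in> {0..s}"
    then have "Q p i (C p i)" using C by simp
    then show "continuous_on (simplex_S X) (\<lambda>z. C p i z ws)" using that unfolding Q_def by blast
  qed
  have frz: "CA x ws = stationaryA k (set I) J \<omega> ws"
    if x: "x \<in> simplex_S X" "bsum (set I) x = 0" "agrees_at k u x \<omega>" "length ws = k - s" for x \<omega> ws
  proof -
    have "(\<Sum>p\<in>?P. \<Sum>i=0..s. (-1) ^ i * C p i x ws) =
      (\<Sum>p\<in>?P. \<Sum>i=0..s. (-1) ^ i * (\<omega> (map (dF (set I) (X p)) ws @ map (\<lambda>j. X j - X p) (omit i J)) / fact s))"
    proof (intro sum.cong refl arg_cong[of _ _ "(*) _"])
      fix p i assume "p \<in> ?P" "i \<in> {0..s}"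
      then have "Q p i (C p i)" using C by simp
      then show "C p i x ws = \<omega> (map (dF (set I) (X p)) ws @ map (\<lambda>j. X j - X p) (omit i J)) / fact s"
        using x unfolding Q_def by blast
    qed
    then show ?thesis using False J'(3) by (simp add: CA_def stationaryA_def Let_def)
  qed
  show ?thesis using A cont frz J'(3) by (intro exI[of _ CA]) (simp add: regular_factor_def Let_def)
qed

end

section \<open>Limits of wedge products\<close>

lemma wedge_tendsto:
  assumes "\<And>ws. length ws = p \<Longrightarrow> ((\<lambda>z. \<alpha> z ws) \<longlongrightarrow> a ws) F"
    and "\<And>ws. length ws = q \<Longrightarrow> ((\<lambda>z. \<beta> z ws) \<longlongrightarrow> b ws) F"
  shows "((\<lambda>z. wedge p q \<alpha> \<beta> z vs) \<longlongrightarrow> wedge p q (\<lambda>_. a) (\<lambda>_. b) x vs) F"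
  unfolding wedge_def
  by (intro tendsto_divide tendsto_sum tendsto_mult tendsto_const assms) simp_all

lemma wedge_tendsto_zero:
  assumes "\<And>ws. length ws = p \<Longrightarrow> \<forall>\<^sub>F z in F. \<bar>\<alpha> z ws\<bar> \<le> B ws"
    and "\<And>ws. length ws = q \<Longrightarrow> ((\<lambda>z. \<beta> z ws) \<longlongrightarrow> 0) F"
  shows "((\<lambda>z. wedge p q \<alpha> \<beta> z vs) \<longlongrightarrow> 0) F"
proof -
  have "((\<lambda>z. of_int (sign \<pi>) * \<alpha> z (map (\<lambda>a. vs ! \<pi> a) [0..<p]) * \<beta> z (map (\<lambda>a. vs ! \<pi> a) [p..<p + q])) \<longlongrightarrow> 0) F"
    for \<pi>
  proof -
    let ?A = "map (\<lambda>a. vs ! \<pi> a) [0..<p]" and ?B = "map (\<lambda>a. vs ! \<pi> a) [p..<p + q]"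
    have "((\<lambda>z. \<alpha> z ?A * \<beta> z ?B) \<longlongrightarrow> 0) F"
    proof (rule Lim_null_comparison)
      have "((\<lambda>z. B ?A * \<bar>\<beta> z ?B\<bar>) \<longlongrightarrow> B ?A * \<bar>0\<bar>) F"
        by (intro tendsto_mult tendsto_rabs tendsto_const assms(2)) simp
      then show "((\<lambda>z. B ?A * \<bar>\<beta> z ?B\<bar>) \<longlongrightarrow> 0) F" by simp
      show "\<forall>\<^sub>F z in F. norm (\<alpha> z ?A * \<beta> z ?B) \<le> B ?A * \<bar>\<beta> z ?B\<bar>"
      proof -
        have "\<forall>\<^sub>F z in F. \<bar>\<alpha> z ?A\<bar> \<le> B ?A" by (rule assms(1)) simp
        then show ?thesis by (rule eventually_mono) (auto simp: abs_mult intro: mult_right_mono)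
      qed
    qed
    from tendsto_mult[OF tendsto_const this, of "of_int (sign \<pi>)"] show ?thesis by (simp add: mult.assoc)
  qed
  then have "((\<lambda>z. wedge p q \<alpha> \<beta> z vs) \<longlongrightarrow> (\<Sum>\<pi> | \<pi> permutes {..<p + q}. 0) / (fact p * fact q)) F"
    unfolding wedge_def by (intro tendsto_divide tendsto_sum tendsto_const) simp_all
  then show ?thesis by simp
qed

lemma wedge_diff_right:
  "wedge p q \<alpha> (\<lambda>z ws. \<beta> z ws - \<gamma> z ws) z vs = wedge p q \<alpha> \<beta> z vs - wedge p q \<alpha> \<gamma> z vs"
  by (simp add: wedge_def right_diff_distrib sum_subtractf diff_divide_distrib)

lemma wedge_divide_left:
  "wedge p q (\<lambda>z ws. \<alpha> z ws / c z) \<beta> z vs = wedge p q \<alpha> \<beta> z vs / c z"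
  by (simp add: wedge_def sum_divide_distrib mult.commute)

context nondeg_simplex
begin

section \<open>Continuity of the extension\<close>

lemma exists_agreeing:
  assumes u: "u \<in> boundary_forms X k"
  shows "\<exists>\<omega>. agrees_at k u x \<omega>"
proof -
  define N where "N = {i. i \<le> DIM('a) \<and> x \<in> facet X i}"
  obtain q where q: "q \<le> DIM('a)" "bary X q x \<noteq> 0"
  proof -
    have "\<exists>q\<in>{..DIM('a)}. bary X q x \<noteq> 0"
      using sum_bary[of x] by (metis sum.neutral zero_neq_one)
    then show thesis using that by auto
  qed
  obtain w where w: "\<And>i. i \<le> DIM('a) \<Longrightarrow> facet_form k u i (w i)"
    using facet_form_exists[OF u] by metis
  have "\<exists>\<omega>. alternating_map k \<omega> \<and>
    (\<forall>i\<in>N. \<forall>vs. length vs = k \<longrightarrow> (\<forall>v\<in>set vs. dl i v = 0) \<longrightarrow> \<omega> vs = w i x vs)"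
  proof (rule common_extension[OF _ _ q(1)])
    fix i j vs assume "i \<in> N" "j \<in> N" "length vs = k" "\<And>v. v \<in> set vs \<Longrightarrow> dl i v = 0" "\<And>v. v \<in> set vs \<Longrightarrow> dl j v = 0"
    then have "u x vs = w i x vs" "u x vs = w j x vs"
      using w unfolding N_def facet_form_def by blast+
    then show "w i x vs = w j x vs" by simp
  next
    fix i assume "i \<in> N"
    then show "alternating_map k (w i x)" using w unfolding N_def facet_form_def by blast
  qed (use q in \<open>auto simp: N_def facet_def\<close>)
  then obtain \<omega> where \<omega>: "alternating_map k \<omega>"
    "\<And>i vs. i \<in> N \<Longrightarrow> length vs = k \<Longrightarrow> (\<forall>v\<in>set vs. dl i v = 0) \<Longrightarrow> \<omega> vs = w i x vs" by blast
  have "\<omega> vs = u x vs" if i: "i \<le> DIM('a)" "x \<in> facet X i" and vs: "length vs = k" "\<forall>v\<in>set vs. dl i v = 0" for i vs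
  proof -
    have "u x vs = w i x vs" using w[OF i(1)] i vs unfolding facet_form_def by blast
    then show ?thesis using \<omega>(2)[of i vs] i vs by (simp add: N_def)
  qed
  then show ?thesis using \<omega>(1) unfolding agrees_at_def by blast
qed

text \<open>The contribution of one index set \<open>I\<close> to the sum defining the extension, without its sign.\<close>

definition term_form :: "nat \<Rightarrow> 'a form \<Rightarrow> nat list \<Rightarrow> 'a form" where
  "term_form k u I z vs = (\<Sum>s=0..k. \<Sum>J\<in>Gam_sub DIM('a) s I.
     wedge s (k - s) (\<lambda>z ws. whitney X J z ws / bary_sum X I z ^ (s + 1)) (Aop X k I J u) z vs)"

lemma ext_rational_eq:
  "ext_rational X k u x vs = 1 / real DIM('a) *
     (\<Sum>S | S \<subseteq> {..DIM('a)} \<and> 2 \<le> card S. (-1) ^ card S * term_form k u (sorted_list_of_set S) x vs)"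
  unfolding ext_rational_def term_form_def[symmetric] sum_Gam_sets ..

lemma regular_bsum:
  assumes "x \<in> regular_points X" "S \<subseteq> {..DIM('a)}" "2 \<le> card S"
  shows "bsum S x \<noteq> 0"
proof -
  have fin: "finite S" using assms(2) finite_subset by blast
  have "card S \<le> DIM('a) + 1" using card_mono[OF _ assms(2)] by simp
  then have "card S - 1 \<in> {1..DIM('a)}" using assms(3) by auto
  moreover have "sorted_list_of_set S \<in> Gam DIM('a) (card S - 1)"
    using assms by (intro sorted_list_Gam) auto
  ultimately have "bary_sum X (sorted_list_of_set S) x \<noteq> 0"
    using assms(1) unfolding regular_points_def by blast
  then show ?thesis using fin by (simp add: bary_sum_eq)
qed

lemma bary_tendsto: "((\<lambda>z. bary X i z) \<longlongrightarrow> bary X i x) (at x within A)"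
  using has_derivative_continuous[OF bary_has_derivative] continuous_within_subset
  by (metis continuous_within subset_UNIV)

lemma whitney_const: "whitney X J z ws = (\<Sum>i<length J. (-1) ^ i * bary X (J ! i) z * dbary_wedge X (omit i J) 0 ws)"
  unfolding whitney_def by (intro sum.cong refl arg_cong[of _ _ "(*) _"] dbary_wedge_const)

lemma whitney_tendsto: "((\<lambda>z. whitney X J z ws) \<longlongrightarrow> whitney X J x ws) (at x within A)"
  unfolding whitney_const by (intro tendsto_intros bary_tendsto)

lemma bsum_tendsto: "((\<lambda>z. bsum I z) \<longlongrightarrow> bsum I x) (at x within A)"
  unfolding bsum_def by (intro tendsto_intros bary_tendsto)

text \<open>Each summand has a limit at every point of the simplex. Where \<open>\<lambda>\<^sub>I\<close> vanishes, the quotients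
  \<open>\<phi>\<^sub>J / \<lambda>\<^sub>I\<close> stay bounded without converging, so the factors \<open>A\<^sub>I\<^sub>J u\<close> may be replaced by their
  limits, and the resulting sum is constant by \<open>stationary_sum\<close>.\<close>

lemma term_form_limit:
  assumes u: "u \<in> boundary_forms X k" and I: "set I \<subseteq> {..DIM('a)}" "2 \<le> card (set I)"
    and x: "x \<in> simplex_S X" and vs: "length vs = k" and k: "k \<le> DIM('a) - 1"
  shows "\<exists>L. ((\<lambda>z. term_form k u I z vs) \<longlongrightarrow> L) (at x within regular_points X)"
proof -
  let ?F = "at x within regular_points X"
  let ?b = "bsum (set I)"
  have ev: "\<forall>\<^sub>F z in ?F. z \<in> regular_points X" by (simp add: eventually_at_filter)
  have RS: "regular_points X \<subseteq> simplex_S X" by (auto simp: regular_points_def)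
  define C where "C J = (SOME C. regular_factor k I J u C)" for J
  have C: "regular_factor k I J u (C J)" if "s \<le> k" "J \<in> Gam_sub DIM('a) s I" for s J
  proof -
    have "\<exists>C. regular_factor k I J u C"
      by (rule Aop_regular[OF u I that(1)]) (use that(2) Gam_sub_eq[OF I(1), of s] in simp)
    then show ?thesis unfolding C_def by (rule someI_ex)
  qed
  have len: "length J = Suc s" if "J \<in> Gam_sub DIM('a) s I" for s J
    using that by (simp add: Gam_sub_def Gam_def)
  have CA: "Aop X k I J u z ws = ?b z ^ s * C J z ws"
    if "s \<le> k" "J \<in> Gam_sub DIM('a) s I" "z \<in> simplex_S X" "length ws = k - s" for s J z ws
    using C[OF that(1,2)] len[OF that(2)] that(3,4) by (simp add: regular_factor_def Let_def)
  have Clim: "((\<lambda>z. C J z ws) \<longlongrightarrow> C J x ws) ?F"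
    if "s \<le> k" "J \<in> Gam_sub DIM('a) s I" "length ws = k - s" for s J ws
  proof -
    have "continuous_on (simplex_S X) (\<lambda>z. C J z ws)"
      using C[OF that(1,2)] len[OF that(2)] that(3) by (simp add: regular_factor_def Let_def)
    then have "((\<lambda>z. C J z ws) \<longlongrightarrow> C J x ws) (at x within simplex_S X)"
      using x by (simp add: continuous_on_def)
    then show ?thesis using RS by (rule tendsto_within_subset)
  qed
  let ?\<psi> = "\<lambda>J z ws. whitney X J z ws / ?b z"
  define T where "T z = (\<Sum>s=0..k. \<Sum>J\<in>Gam_sub DIM('a) s I. wedge s (k - s) (?\<psi> J) (C J) z vs)" for z
  have T: "term_form k u I z vs = T z" if z: "z \<in> regular_points X" for z
    unfolding term_form_def T_def
  proof (intro sum.cong refl)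
    fix s J assume s: "s \<in> {0..k}" and J: "J \<in> Gam_sub DIM('a) s I"
    have nz: "?b z \<noteq> 0" using regular_bsum[OF z I] .
    have "wedge s (k - s) (\<lambda>z ws. whitney X J z ws / bary_sum X I z ^ (s + 1)) (Aop X k I J u) z vs =
       wedge s (k - s) (\<lambda>z ws. whitney X J z ws / ?b z ^ (s + 1)) (\<lambda>z ws. ?b z ^ s * C J z ws) z vs"
      using CA[OF _ J] s z RS vs by (intro wedge_cong) (auto simp: bary_sum_eq)
    also have "\<dots> = wedge s (k - s) (?\<psi> J) (C J) z vs"
    proof -
      have "sg * (w / ?b z ^ (s + 1)) * (?b z ^ s * c) = sg * (w / ?b z) * c" for sg w c :: real
        using nz by (simp add: field_simps)
      then show ?thesis by (simp only: wedge_def)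
    qed
    finally show "wedge s (k - s) (\<lambda>z ws. whitney X J z ws / bary_sum X I z ^ (s + 1)) (Aop X k I J u) z vs =
      wedge s (k - s) (?\<psi> J) (C J) z vs" .
  qed
  have "\<exists>L. (T \<longlongrightarrow> L) ?F"
  proof (cases "?b x = 0")
    case False
    have "(T \<longlongrightarrow> (\<Sum>s=0..k. \<Sum>J\<in>Gam_sub DIM('a) s I.
        wedge s (k - s) (\<lambda>_ ws. whitney X J x ws / ?b x) (\<lambda>_. C J x) x vs)) ?F"
      unfolding T_def
    proof (intro tendsto_sum wedge_tendsto)
      fix s J and ws :: "'a list" assume "s \<in> {0..k}" "J \<in> Gam_sub DIM('a) s I" "length ws = k - s"
      then show "((\<lambda>z. C J z ws) \<longlongrightarrow> C J x ws) ?F" by (intro Clim) auto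
    qed (intro tendsto_divide whitney_tendsto bsum_tendsto False)
    then show ?thesis by blast
  next
    case True
    obtain \<omega> where \<omega>: "agrees_at k u x \<omega>" using exists_agreeing[OF u] by blast
    have alt: "alternating_map k \<omega>" using \<omega> by (simp add: agrees_at_def)
    have "I \<noteq> []" using I(2) by auto
    from stationary_sum[OF alt I(1) this vs k] obtain L where L: "\<And>z. (\<Sum>s=0..k. \<Sum>J\<in>Gam_sub DIM('a) s I.
      wedge s (k - s) (whitney X J) (\<lambda>_. stationaryA k (set I) J \<omega>) z vs) = ?b z * L" by blast
    have Cx: "C J x ws = stationaryA k (set I) J \<omega> ws"
      if "s \<le> k" "J \<in> Gam_sub DIM('a) s I" "length ws = k - s" for s J ws
      using C[OF that(1,2)] len[OF that(2)] that(3) x True \<omega> by (simp add: regular_factor_def Let_def)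
    \<comment> \<open>\<open>T\<close> with the continuous factors replaced by their values at \<open>x\<close>\<close>
    define T0 where "T0 z = (\<Sum>s=0..k. \<Sum>J\<in>Gam_sub DIM('a) s I. wedge s (k - s) (?\<psi> J) (\<lambda>_. C J x) z vs)" for z
    have "T0 z = L" if z: "z \<in> regular_points X" for z
    proof -
      have "T0 z = (\<Sum>s=0..k. \<Sum>J\<in>Gam_sub DIM('a) s I.
          wedge s (k - s) (whitney X J) (\<lambda>_. stationaryA k (set I) J \<omega>) z vs / ?b z)"
        unfolding T0_def
      proof (intro sum.cong refl)
        fix s J assume sJ: "s \<in> {0..k}" "J \<in> Gam_sub DIM('a) s I"
        have "wedge s (k - s) (?\<psi> J) (\<lambda>_. C J x) z vs = wedge s (k - s) (whitney X J) (\<lambda>_. C J x) z vs / ?b z"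
          by (rule wedge_divide_left)
        also have "wedge s (k - s) (whitney X J) (\<lambda>_. C J x) z vs =
           wedge s (k - s) (whitney X J) (\<lambda>_. stationaryA k (set I) J \<omega>) z vs"
          using Cx[OF _ sJ(2)] sJ(1) vs by (intro wedge_cong) auto
        finally show "wedge s (k - s) (?\<psi> J) (\<lambda>_. C J x) z vs =
           wedge s (k - s) (whitney X J) (\<lambda>_. stationaryA k (set I) J \<omega>) z vs / ?b z" .
      qed
      also have "\<dots> = (?b z * L) / ?b z" unfolding L[symmetric] by (simp add: sum_divide_distrib)
      finally show ?thesis using regular_bsum[OF z I] by simp
    qed
    then have "(T0 \<longlongrightarrow> L) ?F"
      using ev by (intro tendsto_eventually) (auto elim: eventually_mono)
    moreover have "((\<lambda>z. T z - T0 z) \<longlongrightarrow> 0) ?F"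
    proof -
      have "((\<lambda>z. \<Sum>s=0..k. \<Sum>J\<in>Gam_sub DIM('a) s I. wedge s (k - s) (?\<psi> J) (\<lambda>z ws. C J z ws - C J x ws) z vs)
         \<longlongrightarrow> (\<Sum>s=0..k. \<Sum>J\<in>Gam_sub DIM('a) s I. 0)) ?F"
      proof (intro tendsto_sum wedge_tendsto_zero)
        fix s J and ws :: "'a list" assume sJ: "s \<in> {0..k}" "J \<in> Gam_sub DIM('a) s I" "length ws = k - s"
        then have "((\<lambda>z. C J z ws - C J x ws) \<longlongrightarrow> C J x ws - C J x ws) ?F"
          by (intro tendsto_diff tendsto_const Clim) auto
        then show "((\<lambda>z. C J z ws - C J x ws) \<longlongrightarrow> 0) ?F" by simp
      next
        fix s J and ws :: "'a list" assume sJ: "s \<in> {0..k}" "J \<in> Gam_sub DIM('a) s I" "length ws = s"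
        have "\<bar>?\<psi> J z ws\<bar> \<le> (\<Sum>i<length J. \<bar>dbary_wedge X (omit i J) 0 ws\<bar>)" if z: "z \<in> regular_points X" for z
        proof -
          have zS: "z \<in> simplex_S X" using z RS by blast
          have b0: "?b z > 0" using regular_bsum[OF z I] bsum_nonneg[OF zS I(1)] by simp
          have "\<bar>whitney X J z ws\<bar> \<le> (\<Sum>i<length J. \<bar>(-1) ^ i * bary X (J ! i) z * dbary_wedge X (omit i J) 0 ws\<bar>)"
            unfolding whitney_const by (rule sum_abs)
          also have "\<dots> \<le> (\<Sum>i<length J. ?b z * \<bar>dbary_wedge X (omit i J) 0 ws\<bar>)"
          proof (rule sum_mono)
            fix i assume "i \<in> {..<length J}"
            then have "J ! i \<in> set J" by simp
            then have Ji: "J ! i \<in> set I" using sJ(2) unfolding Gam_sub_def by blast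
            then have "J ! i \<le> DIM('a)" using I(1) by auto
            then have "0 \<le> bary X (J ! i) z" using zS by (simp add: mem_simplex_S)
            moreover have "bary X (J ! i) z \<le> ?b z" using bary_le_bsum[OF zS I(1) Ji] .
            ultimately show "\<bar>(-1) ^ i * bary X (J ! i) z * dbary_wedge X (omit i J) 0 ws\<bar>
               \<le> ?b z * \<bar>dbary_wedge X (omit i J) 0 ws\<bar>"
              by (simp add: abs_mult power_abs mult_right_mono)
          qed
          finally have "\<bar>whitney X J z ws\<bar> \<le> ?b z * (\<Sum>i<length J. \<bar>dbary_wedge X (omit i J) 0 ws\<bar>)"
            by (simp add: sum_distrib_left)
          then show ?thesis using b0 by (simp add: field_simps)
        qed
        then show "\<forall>\<^sub>F z in ?F. \<bar>?\<psi> J z ws\<bar> \<le> (\<Sum>i<length J. \<bar>dbary_wedge X (omit i J) 0 ws\<bar>)"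
          using ev by (auto elim: eventually_mono)
      qed
      then show ?thesis unfolding T_def T0_def wedge_diff_right sum_subtractf by simp
    qed
    ultimately have "((\<lambda>z. T0 z + (T z - T0 z)) \<longlongrightarrow> L + 0) ?F" by (rule tendsto_add)
    then show ?thesis by auto
  qed
  then obtain L where L: "(T \<longlongrightarrow> L) ?F" by blast
  have "((\<lambda>z. term_form k u I z vs) \<longlongrightarrow> L) ?F"
    by (rule Lim_transform_eventually[OF L]) (use ev T in \<open>auto elim!: eventually_mono\<close>)
  then show ?thesis by blast
qed

section \<open>Cancellation on a facet\<close>

lemma set_omit_subset: "set (omit i J) \<subseteq> set J"
  unfolding omit_def using set_take_subset[of i J] set_drop_subset[of "Suc i" J] by auto

lemma dbary_wedge_zero:
  assumes "q \<in> set K" "\<And>v. v \<in> set ws \<Longrightarrow> dl q v = 0" "length ws = length K"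
  shows "dbary_wedge X K x ws = 0"
  using assms
proof (induction K arbitrary: ws)
  case (Cons j K)
  have l: "length ws = Suc (length K)" using Cons.prems by simp
  have "dl j (ws ! b) * dbary_wedge X K x (omit b ws) = 0" if b: "b \<le> length K" for b
  proof (cases "j = q")
    case True
    then show ?thesis using Cons.prems(2)[of "ws ! b"] b l by simp
  next
    case False
    have "dbary_wedge X K x (omit b ws) = 0"
    proof (rule Cons.IH)
      show "q \<in> set K" using Cons.prems(1) False by simp
      show "length (omit b ws) = length K" using b l by simp
      show "dl q v = 0" if "v \<in> set (omit b ws)" for v
        using that set_omit_subset[of b ws] Cons.prems(2) by blast
    qed
    then show ?thesis by simp
  qed
  then show ?case unfolding dbary_wedge_Cons[OF l] by (intro sum.neutral) (auto simp: mult.assoc)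
qed simp

lemma whitney_zero:
  assumes q: "q \<in> set J" "bary X q x = 0" and ws: "\<And>v. v \<in> set ws \<Longrightarrow> dl q v = 0" "length J = Suc (length ws)"
  shows "whitney X J x ws = 0"
  unfolding whitney_def
proof (intro sum.neutral ballI)
  fix i assume i: "i \<in> {..<length J}"
  show "(-1) ^ i * bary X (J ! i) x * dbary_wedge X (omit i J) x ws = 0"
  proof (cases "J ! i = q")
    case True
    then show ?thesis using q by simp
  next
    case False
    have "J = take i J @ J ! i # drop (Suc i) J" using i by (simp add: id_take_nth_drop)
    then have "q \<in> insert (J ! i) (set (omit i J))"
      using q(1) unfolding omit_def by (metis Un_iff insert_iff list.set(2) set_append)
    then have "q \<in> set (omit i J)" using False by simp
    then show ?thesis using dbary_wedge_zero[of q "omit i J" ws x] ws i by simp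
  qed
qed

lemma Fmap_insert:
  "q \<notin> set I \<Longrightarrow> set I' = insert q (set I) \<Longrightarrow> bary X q x = 0 \<Longrightarrow> Fmap X I' x y = Fmap X I x y"
  by (simp add: Fmap_def)

lemma dF_insert:
  "finite I \<Longrightarrow> q \<notin> I \<Longrightarrow> dl q v = 0 \<Longrightarrow> dF (insert q I) y v = dF I y v"
  by (simp add: dF_def)

text \<open>On the facet opposite to \<open>q\<close> the vertex \<open>q\<close> carries no mass, so adding it to \<open>I\<close> changes neither
  \<open>F\<^sub>I\<close> nor its derivative in tangential directions.\<close>

lemma Aop_insert:
  assumes I: "q \<notin> set I" "set I' = insert q (set I)" and x: "bary X q x = 0"
    and ws: "\<And>v. v \<in> set ws \<Longrightarrow> dl q v = 0"
  shows "Aop X k I' J u x ws = Aop X k I J u x ws"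
proof -
  have F: "Fmap X I' x y = Fmap X I x y" for y by (rule Fmap_insert[OF I x])
  have D: "map (dF (set I') y) ws = map (dF (set I) y) ws" for y
    using dF_insert[of "set I" q] I ws by simp
  have pb: "pullback (Pmap X I' j) u x ws = pullback (Pmap X I j) u x ws" for j
    by (simp only: pullback_def frechet_Pmap Pmap_def F D)
  have bs: "bary_sum X I' x = bary_sum X I x"
    using I x by (simp add: bary_sum_eq bsum_def)
  have "Rop X k I' K u x ws = Rop X k I K u x ws" for K
    by (simp only: Rop_def pb bs F D frechet_Fmap)
  then show ?thesis by (simp only: Aop_def pb)
qed

text \<open>New index sets \<open>J\<close> contain \<open>q\<close>, and their Whitney forms have zero trace on the facet.\<close>

lemma term_form_insert:
  assumes I: "q \<notin> set I" "set I' = insert q (set I)" "set I' \<subseteq> {..DIM('a)}" and x: "bary X q x = 0"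
    and vs: "\<And>v. v \<in> set vs \<Longrightarrow> dl q v = 0" "length vs = k"
  shows "term_form k u I' x vs = term_form k u I x vs"
  unfolding term_form_def
proof (rule sum.cong[OF refl])
  fix s assume s: "s \<in> {0..k}"
  have I0: "set I \<subseteq> {..DIM('a)}" using I by blast
  have bs: "bary_sum X I' x = bary_sum X I x"
    using I x by (simp add: bary_sum_eq bsum_def)
  have tan: "dl q v = 0" if "set ws \<subseteq> set vs" "v \<in> set ws" for ws v using that vs(1) by blast
  let ?w = "\<lambda>I J. wedge s (k - s) (\<lambda>z ws. whitney X J z ws / bary_sum X I z ^ (s + 1)) (Aop X k I J u) x vs"
  have "(\<Sum>J\<in>sorted_lists (set I') (Suc s). ?w I' J) = (\<Sum>J\<in>sorted_lists (set I) (Suc s). ?w I' J)"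
  proof (rule sum.mono_neutral_right)
    show "\<forall>J\<in>sorted_lists (set I') (Suc s) - sorted_lists (set I) (Suc s). ?w I' J = 0"
    proof
      fix J assume J: "J \<in> sorted_lists (set I') (Suc s) - sorted_lists (set I) (Suc s)"
      then have "q \<in> set J" "length J = Suc s" using I(2) by (auto simp: sorted_lists_def)
      then have "?w I' J = wedge s (k - s) (\<lambda>_ _. 0) (Aop X k I' J u) x vs"
        using s vs(2) whitney_zero[of q J x, OF _ x] tan by (intro wedge_cong) auto
      then show "?w I' J = 0" by (simp add: wedge_def)
    qed
  qed (use I(2) in \<open>auto simp: sorted_lists_def finite_sorted_lists[unfolded sorted_lists_def]\<close>)
  also have "\<dots> = (\<Sum>J\<in>sorted_lists (set I) (Suc s). ?w I J)"
    using s vs(2) Aop_insert[OF I(1,2) x] tan by (intro sum.cong refl wedge_cong) (auto simp: bs)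
  finally show "(\<Sum>J\<in>Gam_sub DIM('a) s I'. ?w I' J) = (\<Sum>J\<in>Gam_sub DIM('a) s I. ?w I J)"
    unfolding Gam_sub_eq[OF I(3)] Gam_sub_eq[OF I0] .
qed

text \<open>For a single vertex \<open>i\<close> the map \<open>F\<^sub>I(\<cdot>, x\<^sub>i)\<close> is the identity. Such terms do not occur in the
  definition of the extension; they stand for the sets \<open>{i, q}\<close> after \<open>term_form_insert\<close>.\<close>

lemma term_form_single:
  assumes u: "facet_form k u q w" and i: "i \<le> DIM('a)" "bary X i x \<noteq> 0" and x: "x \<in> facet X q"
    and vs: "\<forall>v\<in>set vs. dl q v = 0" "length vs = k"
  shows "term_form k u [i] x vs = u x vs"
proof -
  have I: "set [i] \<subseteq> {..DIM('a)}" using i by simp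
  have sl: "sorted_lists (set [i]) (Suc s) = (if s = 0 then {[i]} else {})" for s
  proof -
    have "s = 0 \<and> J = [i]" if "J \<in> sorted_lists (set [i]) (Suc s)" for J
    proof -
      have J: "distinct J" "set J \<subseteq> {i}" "length J = Suc s"
        using that by (auto simp: sorted_lists_def strict_sorted_iff)
      have "Suc s \<le> 1" using distinct_card[OF J(1)] card_mono[OF _ J(2)] J(3) by simp
      then show ?thesis using J by (auto simp: length_Suc_conv)
    qed
    then show ?thesis by (auto simp: sorted_lists_def)
  qed
  have "dF {i} (X i) = (\<lambda>v. v)" by (auto simp: dF_def)
  then have A: "Aop X k [i] [i] u x ws = u x ws" for ws
    by (simp add: Aop_def Let_def pullback_def frechet_Pmap Pmap_def Fmap_def)
  have "term_form k u [i] x vs =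
     (\<Sum>s=0..k. if s = 0 then wedge 0 k (\<lambda>z ws. whitney X [i] z ws / bary_sum X [i] z ^ 1) (Aop X k [i] [i] u) x vs else 0)"
    unfolding term_form_def Gam_sub_eq[OF I] sl by (intro sum.cong) auto
  also have "\<dots> = wedge 0 k (\<lambda>z ws. whitney X [i] z ws / bary_sum X [i] z ^ 1) (Aop X k [i] [i] u) x vs"
    by simp
  also have "\<dots> = (\<Sum>\<pi> | \<pi> permutes {..<k}. of_int (sign \<pi>) * u x (map (\<lambda>a. vs ! \<pi> a) [0..<k])) / fact k"
    using i(2) by (simp add: wedge_def A whitney_def omit_def bary_sum_def)
  also have "(\<Sum>\<pi> | \<pi> permutes {..<k}. of_int (sign \<pi>) * u x (map (\<lambda>a. vs ! \<pi> a) [0..<k])) =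
     (\<Sum>\<pi> | \<pi> permutes {..<k}. u x vs)"
  proof (intro sum.cong refl)
    fix \<pi> assume "\<pi> \<in> {\<pi>. \<pi> permutes {..<k}}"
    then have \<pi>: "\<pi> permutes {..<k}" by simp
    then have \<pi>': "\<pi> permutes {0..<0 + k}" by (simp add: atLeast0LessThan)
    have uw: "u x us = w x us" if "length us = k" "\<forall>v\<in>set us. dl q v = 0" for us
      using u x that unfolding facet_form_def by blast
    have "w x (map (\<lambda>a. vs ! \<pi> a) [0..<0 + k]) = of_int (sign \<pi>) * w x (map (\<lambda>a. vs ! a) [0..<0 + k])"
      by (rule alternating_map_permute_fun[OF _ \<pi>']) (use u x in \<open>simp add: facet_form_def\<close>)
    moreover have "map (\<lambda>a. vs ! a) [0..<k] = vs" using map_nth[of vs] vs(2) by simp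
    moreover have "\<forall>v\<in>set (map (\<lambda>a. vs ! \<pi> a) [0..<k]). dl q v = 0"
      using vs permutes_in_image[OF \<pi>] by auto
    ultimately have "u x (map (\<lambda>a. vs ! \<pi> a) [0..<k]) = of_int (sign \<pi>) * u x vs"
      using uw vs by simp
    then show "of_int (sign \<pi>) * u x (map (\<lambda>a. vs ! \<pi> a) [0..<k]) = u x vs"
      by (simp add: sign_def)
  qed
  also have "\<dots> = fact k * u x vs" by (simp add: card_permutations[of "{..<k}" k])
  finally show ?thesis by simp
qed

text \<open>The sets \<open>S\<close> and \<open>insert q S\<close> contribute with opposite signs and cancel, unless \<open>S\<close> has a single element
  and is absent from the sum. This leaves \<open>n\<close> sets \<open>{i, q}\<close>, each contributing \<open>u\<close>.\<close>

lemma ext_rational_facet: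
  assumes u: "u \<in> boundary_forms X k" and q: "q \<le> DIM('a)" and x: "x \<in> regular_points X" "x \<in> facet X q"
    and vs: "\<forall>v\<in>set vs. dl q v = 0" "length vs = k"
  shows "ext_rational X k u x vs = u x vs"
proof -
  let ?n = "DIM('a)"
  obtain w where w: "facet_form k u q w" using facet_form_exists[OF u q] by blast
  have xq: "bary X q x = 0" using x(2) by (simp add: facet_def)
  have nz: "bary X i x \<noteq> 0" if i: "i \<le> ?n" "i \<noteq> q" for i
    using regular_bsum[OF x(1), of "{i, q}"] i q xq by (simp add: bsum_def)
  define g where "g S = (-1) ^ card S * term_form k u (sorted_list_of_set S) x vs" for S
  define P where "P = {..?n} - {q}"
  define A where "A = {S. S \<subseteq> P \<and> 2 \<le> card S}"
  define B where "B = {S. S \<subseteq> P \<and> 1 \<le> card S}"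
  have finP: "finite P" by (simp add: P_def)
  have fin: "finite A" "finite B" using finP by (simp_all add: A_def B_def)
  have finS: "finite S" if "S \<subseteq> P" for S using that finP finite_subset by blast
  have split: "{S. S \<subseteq> {..?n} \<and> 2 \<le> card S} = A \<union> insert q ` B"
  proof (intro set_eqI iffI)
    fix S assume S: "S \<in> {S. S \<subseteq> {..?n} \<and> 2 \<le> card S}"
    show "S \<in> A \<union> insert q ` B"
    proof (cases "q \<in> S")
      case True
      have "finite S" using S finite_subset by blast
      then have "card (S - {q}) = card S - 1" using True by simp
      then have "S - {q} \<in> B" using S by (auto simp: B_def P_def)
      moreover have "S = insert q (S - {q})" using True by blast
      ultimately show ?thesis by blast
    next
      case False
      then show ?thesis using S by (auto simp: A_def P_def)
    qed
  next
    fix S assume "S \<in> A \<union> insert q ` B"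
    then show "S \<in> {S. S \<subseteq> {..?n} \<and> 2 \<le> card S}"
    proof
      assume "S \<in> A"
      then show ?thesis by (auto simp: A_def P_def)
    next
      assume "S \<in> insert q ` B"
      then obtain S' where S': "S = insert q S'" "S' \<subseteq> P" "1 \<le> card S'" by (auto simp: B_def)
      then have "q \<notin> S'" by (auto simp: P_def)
      then have "card S = Suc (card S')" using finS[OF S'(2)] S'(1) by simp
      then show ?thesis using S' q by (auto simp: P_def)
    qed
  qed
  have gq: "g (insert q S) = - g S" if "S \<in> B" for S
  proof -
    have S: "S \<subseteq> P" "finite S" "q \<notin> S" using that finS by (auto simp: B_def P_def)
    have "term_form k u (sorted_list_of_set (insert q S)) x vs = term_form k u (sorted_list_of_set S) x vs"
    proof (rule term_form_insert[OF _ _ _ xq])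
      have sl: "set (sorted_list_of_set T) = T" if "finite T" for T :: "nat set" using that by simp
      have "finite (insert q S)" using S(2) by simp
      then show "q \<notin> set (sorted_list_of_set S)"
        "set (sorted_list_of_set (insert q S)) = insert q (set (sorted_list_of_set S))"
        "set (sorted_list_of_set (insert q S)) \<subseteq> {..?n}"
        unfolding sl[OF S(2)] sl[OF \<open>finite (insert q S)\<close>] using S(1,3) q by (auto simp: P_def)
    qed (use vs in auto)
    then show ?thesis using S by (simp add: g_def)
  qed
  have "(\<Sum>S | S \<subseteq> {..?n} \<and> 2 \<le> card S. g S) = sum g A + sum g (insert q ` B)"
    unfolding split by (rule sum.union_disjoint) (use fin in \<open>auto simp: A_def P_def\<close>)
  also have "sum g (insert q ` B) = (\<Sum>S\<in>B. - g S)"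
  proof -
    have "inj_on (insert q) B" by (rule inj_onI) (auto simp: B_def P_def)
    then show ?thesis using gq by (simp add: sum.reindex)
  qed
  also have "\<dots> = - (sum g A + sum g ((\<lambda>i. {i}) ` P))"
  proof -
    have "B = A \<union> (\<lambda>i. {i}) ` P"
    proof (intro set_eqI iffI)
      fix S assume S: "S \<in> B"
      show "S \<in> A \<union> (\<lambda>i. {i}) ` P"
      proof (cases "card S = 1")
        case True
        then obtain i where "S = {i}" by (auto simp: card_1_singleton_iff)
        then show ?thesis using S by (auto simp: B_def)
      qed (use S in \<open>auto simp: A_def B_def\<close>)
    qed (auto simp: A_def B_def)
    moreover have "A \<inter> (\<lambda>i. {i}) ` P = {}" by (auto simp: A_def)
    ultimately show ?thesis using fin finP by (simp add: sum_negf sum.union_disjoint)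
  qed
  also have "sum g ((\<lambda>i. {i}) ` P) = (\<Sum>i\<in>P. - u x vs)"
  proof (subst sum.reindex)
    show "inj_on (\<lambda>i. {i}) P" by (simp add: inj_on_def)
    show "sum (g \<circ> (\<lambda>i. {i})) P = (\<Sum>i\<in>P. - u x vs)"
    proof (intro sum.cong refl)
      fix i assume "i \<in> P"
      then have "term_form k u [i] x vs = u x vs"
        using term_form_single[OF w _ nz x(2) vs] by (simp add: P_def)
      then show "(g \<circ> (\<lambda>i. {i})) i = - u x vs" by (simp add: g_def)
    qed
  qed
  finally have "(\<Sum>S | S \<subseteq> {..?n} \<and> 2 \<le> card S. g S) = real ?n * u x vs"
    using q by (simp add: P_def card_Diff_singleton)
  then show ?thesis unfolding ext_rational_eq g_def[symmetric] by simp
qed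

text \<open>From a boundary point, walk towards the barycenter of the facet.\<close>

lemma facet_path:
  assumes q: "q \<le> DIM('a)" and x: "x \<in> facet X q" "x \<notin> regular_points X"
  obtains y where "filterlim y (at x within regular_points X) (at_right (0::real))"
    "\<forall>\<^sub>F e in at_right 0. y e \<in> facet X q"
proof -
  let ?n = "DIM('a)"
  define P where "P = {..?n} - {q}"
  define c where "c = (\<Sum>i\<in>P. (1 / real ?n) *\<^sub>R (X i - x))"
  have P: "finite P" "card P = ?n" using q by (simp_all add: P_def card_Diff_singleton)
  have n: "real ?n > 0" using DIM_positive[where 'a = 'a] by simp
  define y where "y e = x + e *\<^sub>R c" for e :: real
  have dlc: "dl l c = (if l \<in> P then 1 / real ?n else 0) - bary X l x" if l: "l \<le> ?n" for l
  proof -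
    have "dl l c = (\<Sum>i\<in>P. (1 / real ?n) * dl l (X i - x))"
      by (simp add: c_def linear_sum[OF linear_dl] linear_scale[OF linear_dl])
    also have "\<dots> = (\<Sum>i\<in>P. (if i = l then 1 / real ?n else 0) - (1 / real ?n) * bary X l x)"
      by (intro sum.cong refl) (auto simp: bary_diff[symmetric] bary_vertex P_def algebra_simps)
    also have "\<dots> = (if l \<in> P then 1 / real ?n else 0) - bary X l x"
      using P n by (simp add: sum_subtractf)
    finally show ?thesis .
  qed
  have by': "bary X l (y e) = (1 - e) * bary X l x + (if l \<in> P then e / real ?n else 0)" if "l \<le> ?n" for l e
    unfolding y_def bary_add linear_scale[OF linear_dl] dlc[OF that] by (simp add: algebra_simps)
  have xnn: "bary X l x \<ge> 0" if "l \<le> ?n" for l using x(1) that by (simp add: facet_mem)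
  have xq: "bary X q x = 0" using x(1) by (simp add: facet_mem)
  have pos: "bary X l (y e) > 0" if "0 < e" "e < 1" "l \<in> P" for e l
  proof -
    have l: "l \<le> ?n" using that by (simp add: P_def)
    have "(1 - e) * bary X l x \<ge> 0" using that xnn[OF l] by simp
    moreover have "e / real ?n > 0" using that n by simp
    ultimately have "(1 - e) * bary X l x + e / real ?n > 0" by (rule add_nonneg_pos)
    then show ?thesis using by'[OF l, of e] that by simp
  qed
  have yq: "bary X q (y e) = 0" for e using by'[OF q, of e] xq by (simp add: P_def)
  have yf: "y e \<in> facet X q" if "0 < e" "e < 1" for e
    unfolding facet_mem
  proof (intro conjI allI impI)
    fix l assume l: "l \<le> ?n"
    show "0 \<le> bary X l (y e)"
    proof (cases "l = q")
      case False
      then have "l \<in> P" using l by (simp add: P_def)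
      then show ?thesis using pos[OF that] by (simp add: less_imp_le)
    qed (simp add: yq)
  qed (rule yq)
  have yr: "y e \<in> regular_points X" if e: "0 < e" "e < 1" for e
  proof -
    have "bary_sum X I (y e) \<noteq> 0" if m: "m \<in> {1..?n}" and I: "I \<in> Gam ?n m" for m I
    proof -
      have I': "set I \<subseteq> {..?n}" "card (set I) = m + 1" using Gam_mem[OF I] by auto
      have "\<not> set I \<subseteq> {q}" using I'(2) m card_mono[of "{q}" "set I"] by auto
      then obtain l where l: "l \<in> set I" "l \<in> P" using I'(1) by (auto simp: P_def)
      have S: "y e \<in> simplex_S X" using yf[OF e] by (simp add: facet_def)
      have "0 < bary X l (y e)" using pos[OF e l(2)] .
      also have "\<dots> \<le> bsum (set I) (y e)" by (rule bary_le_bsum[OF S I'(1) l(1)])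
      finally show ?thesis by (simp add: bary_sum_eq)
    qed
    then show ?thesis using yf[OF e] by (auto simp: regular_points_def facet_def)
  qed
  have ev: "\<forall>\<^sub>F e in at_right (0::real). 0 < e \<and> e < 1"
    using eventually_at_right_real[of 0 1] by (auto elim: eventually_mono)
  have "(y \<longlongrightarrow> x + 0 *\<^sub>R c) (at_right 0)"
    unfolding y_def by (intro tendsto_intros)
  moreover have "\<forall>\<^sub>F e in at_right 0. y e \<in> regular_points X \<and> y e \<noteq> x"
    using ev by (rule eventually_mono) (use yr x(2) in auto)
  ultimately have "filterlim y (at x within regular_points X) (at_right 0)"
    by (simp add: filterlim_at)
  moreover have "\<forall>\<^sub>F e in at_right 0. y e \<in> facet X q"
    using ev by (rule eventually_mono) (use yf in auto)
  ultimately show thesis by (rule that)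
qed

text \<open>At a singular point the limit exists, so it may be computed along any path of regular points,
  in particular along one inside the facet, where the formula reproduces \<open>u\<close>.\<close>

lemma ext_op_facet:
  assumes u: "u \<in> boundary_forms X k" and k: "k \<le> DIM('a) - 1" and q: "q \<le> DIM('a)" and x: "x \<in> facet X q"
    and vs: "\<forall>v\<in>set vs. dl q v = 0" "length vs = k"
  shows "ext_op X k u x vs = u x vs"
proof (cases "x \<in> regular_points X")
  case True
  then show ?thesis using ext_rational_facet[OF u q True x vs] by (simp add: ext_op_def)
next
  case False
  let ?F = "at x within regular_points X"
  have xS: "x \<in> simplex_S X" using x by (simp add: facet_def)
  have "\<exists>L. ((\<lambda>z. ext_rational X k u z vs) \<longlongrightarrow> L) ?F"
  proof -
    have "\<exists>L. ((\<lambda>z. term_form k u (sorted_list_of_set S) z vs) \<longlongrightarrow> L) ?F"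
      if "S \<in> {S. S \<subseteq> {..DIM('a)} \<and> 2 \<le> card S}" for S
    proof -
      have "finite S" using that finite_subset by blast
      then show ?thesis using that by (intro term_form_limit[OF u _ _ xS vs(2) k]) auto
    qed
    then obtain L where "\<And>S. S \<in> {S. S \<subseteq> {..DIM('a)} \<and> 2 \<le> card S} \<Longrightarrow>
        ((\<lambda>z. term_form k u (sorted_list_of_set S) z vs) \<longlongrightarrow> L S) ?F" by metis
    then have "((\<lambda>z. ext_rational X k u z vs) \<longlongrightarrow> 1 / real DIM('a) *
     (\<Sum>S | S \<subseteq> {..DIM('a)} \<and> 2 \<le> card S. (-1) ^ card S * L S)) ?F"
      unfolding ext_rational_eq by (intro tendsto_mult tendsto_sum tendsto_const)
    then show ?thesis by blast
  qed
  then obtain L where L: "((\<lambda>z. ext_rational X k u z vs) \<longlongrightarrow> L) ?F" by blast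
  obtain y where y: "filterlim y ?F (at_right (0::real))" "\<forall>\<^sub>F e in at_right 0. y e \<in> facet X q"
    using facet_path[OF q x False] by blast
  obtain w where w: "facet_form k u q w" using facet_form_exists[OF u q] by blast
  have "(\<forall>\<^sub>F e in at_right 0. y e \<in> regular_points X \<and> y e \<noteq> x) \<and> (y \<longlongrightarrow> x) (at_right 0)"
    using y(1) unfolding filterlim_at .
  then have yx: "(y \<longlongrightarrow> x) (at_right 0)" and yr: "\<forall>\<^sub>F e in at_right 0. y e \<in> regular_points X"
    by (simp_all add: eventually_conj_iff)
  have "((\<lambda>e. w (y e) vs) \<longlongrightarrow> w x vs) (at_right 0)"
  proof (rule continuous_on_tendsto_compose[OF _ yx x y(2)])
    show "continuous_on (facet X q) (\<lambda>x. w x vs)" using w vs(2) by (simp add: facet_form_def)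
  qed
  moreover have "\<forall>\<^sub>F e in at_right 0. w (y e) vs = ext_rational X k u (y e) vs"
    using y(2) yr
  proof eventually_elim
    case (elim e)
    then have "u (y e) vs = w (y e) vs" using w vs unfolding facet_form_def by blast
    then show ?case using ext_rational_facet[OF u q _ _ vs] elim by simp
  qed
  ultimately have "((\<lambda>e. ext_rational X k u (y e) vs) \<longlongrightarrow> w x vs) (at_right 0)"
    by (rule Lim_transform_eventually)
  moreover have "((\<lambda>e. ext_rational X k u (y e) vs) \<longlongrightarrow> L) (at_right 0)"
    using filterlim_compose[OF L y(1)] .
  ultimately have "L = w x vs" by (intro tendsto_unique[of "at_right (0::real)"]) simp_all
  also have "\<dots> = u x vs" using w x vs unfolding facet_form_def by simp
  finally have "L = u x vs" .
  moreover have "?F \<noteq> bot"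
  proof
    assume "?F = bot"
    with y(1) have "filtermap y (at_right (0::real)) \<le> bot" by (simp only: filterlim_def)
    then have "filtermap y (at_right (0::real)) = bot" by (rule le_bot)
    then have "at_right (0::real) = bot" by (simp only: filtermap_bot_iff)
    then show False by simp
  qed
  ultimately have "Lim ?F (\<lambda>z. ext_rational X k u z vs) = u x vs" using L by (simp add: tendsto_Lim)
  then show ?thesis using False by (simp add: ext_op_def)
qed

end

theorem theorem6p1:
  fixes X :: "nat \<Rightarrow> 'a::euclidean_space" and n k :: nat
  assumes "n = DIM('a)" and "n \<ge> 1" and "k \<le> n - 1"
    and "nondegenerate_simplex X"
  shows "\<forall>u \<in> boundary_forms X k. boundary_trace X k (ext_op X k u) = u"
proof
  fix u assume u: "u \<in> boundary_forms X k"
  interpret nondeg_simplex X by (rule nondeg_simplex.intro) fact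
  have k: "k \<le> DIM('a) - 1" using assms by simp
  show "boundary_trace X k (ext_op X k u) = u"
  proof (intro ext)
    fix x vs
    show "boundary_trace X k (ext_op X k u) x vs = u x vs"
    proof (cases "on_boundary X k x vs")
      case True
      then obtain q where q: "q \<le> DIM('a)" "x \<in> facet X q" "set vs \<subseteq> facet_tangent X q" "length vs = k"
        by (auto simp: on_boundary_def)
      then have "ext_op X k u x vs = u x vs"
        by (intro ext_op_facet[OF u k q(1,2)]) (auto simp: facet_tangent_eq)
      then show ?thesis using True by (simp add: boundary_trace_def)
    next
      case False
      then show ?thesis using u by (simp add: boundary_trace_def boundary_forms_def)
    qed
  qed
qed

end
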